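(* Let $(M,F)$ be a Finsler space, let $\nabla$ be a linear connection on $\hat\pi^*TM$, and let $\langle\Gamma^i_{jk}\rangle$ be the connection coefficients of the average connection $\langle\nabla\rangle$ in a coordinate chart of $M$. Let $\gamma:[a,b]\to M$ be a smooth curve in the domain of this chart with $\gamma(a)=x$ and $\gamma(b)=z$. For a positive integer $A$ put $\epsilon=\frac{b-a}{A}$ and $t_k=a+k\epsilon$. Then the parallel transport $p_{xz}:T_xM\to T_zM$ of $\langle\nabla\rangle$ along $\gamma$ is given, for $X=X^ie_i\in T_xM$, by $$(p_{xz}X)^j=\lim_{A\to\infty,\ \epsilon\to0}\ \prod_{k=1}^{A}\Big(\delta^{j_k}_{i_{k-1}}-\epsilon\,\langle\Gamma^{j_k}_{i_{k-1}l_k}\rangle(\gamma(t_k))\,\dot\gamma^{l_k}\Big)X^{i_0},\qquad j=1,\dots,n,$$ where $j_A=j$, $\dot\gamma^{l_k}$ is the component of the tangent vector $\dot\gamma(t_k)$, and the product is the composition of the successive matrices (the output index $j_k$ of the $k$-th factor is identified with the input index $i_k$ of the $(k+1)$-th factor, with summation over repeated indices).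
   Context: The summation convention is used. $M$ is an $n$-dimensional smooth manifold, $\hat\pi:N=TM\setminus\{0\}\to M$ is the slit tangent bundle, local coordinates $(x^i)$ on $M$ induce natural coordinates $(x^i,y^i)$ on $TM$, and $e_i=\frac{\partial}{\partial x^i}$. A Finsler space $(M,F)$ is a manifold $M$ with a function $F:TM\to[0,\infty)$ that is smooth on $N$, satisfies $F(x,\lambda y)=\lambda F(x,y)$ for $\lambda\ge 0$, and for which $g_{ij}(x,y):=\frac12\frac{\partial^2F^2}{\partial y^i\partial y^j}$ is positive definite on $N$. Put $A_{ijk}=\frac F2\frac{\partial g_{ij}}{\partial y^k}$, $A^i_{jk}=g^{il}A_{ljk}$, $\gamma^i_{jk}=\frac12g^{is}\big(\frac{\partial g_{sj}}{\partial x^k}-\frac{\partial g_{jk}}{\partial x^s}+\frac{\partial g_{sk}}{\partial x^j}\big)$, and define $N^i_j$ by $\frac{N^i_j}{F}=\gamma^i_{jk}\frac{y^k}{F}-A^i_{jk}\gamma^k_{rs}\frac{y^r}{F}\frac{y^s}{F}$. Put $\frac{\delta}{\delta x^j}=\frac{\partial}{\partial x^j}-N^i_j\frac{\partial}{\partial y^i}$ and $\delta y^i=dy^i+N^i_jdx^j$. The horizontal lift at $u\in\hat\pi^{-1}(x)$ is $\iota_u\big(X^i\frac{\partial}{\partial x^i}\big)=X^i\frac{\delta}{\delta x^i}|_u$. $\hat\pi^*TM\to N$ is the pull-back bundle, with fiber over $u$ canonically identified with $T_{\hat\pi(u)}M$ through $\pi_2:\hat\pi^*TM\to TM$. $\hat\pi^*Y$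 is the pull-back section of a vector field $Y$. The indicatrix is $I_x=\{y\in T_xM:F(x,y)=1\}$. Its volume form $dvol_x$ is the pull-back to $I_x$ of the contraction of $\sqrt{\det g}\,\frac{\delta y^1}{F}\wedge\cdots\wedge\frac{\delta y^n}{F}$ with $l=\frac{y^i}{F}\frac{\partial}{\partial y^i}$ ($I_x$ is oriented so that $dvol_x$ is positive). Put $vol(I_x)=\int_{I_x}dvol_x$ and $\langle f\rangle(x)=\frac1{vol(I_x)}\int_{I_x}f\,dvol_x$. The average connection is the affine connection on $M$ given by $\langle\nabla\rangle_XY=\langle\pi_2(\nabla_{\iota_u(X)}\hat\pi^*Y)\rangle$ (average over $u\in I_x$, for $X\in T_xM$, $Y\in\Gamma TM$). Its coefficients are given by $\langle\nabla\rangle_{e_l}e_i=\langle\Gamma^j_{il}\rangle e_j$. The parallel transport of an affine connection along $\gamma$ sends $X\in T_{\gamma(a)}M$ to the value at $t=b$ of the solution $S(t)$ along $\gamma$ of $\langle\nabla\rangle_{\dot\gamma}S=0$, $S(a)=X$. *)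

theory Defs
  imports "HOL-Analysis.Analysis"
begin

section \<open>Smooth maps on open sets of Euclidean spaces\<close>

primrec ck_on ::
  "nat \<Rightarrow> 'e::euclidean_space set \<Rightarrow> ('e \<Rightarrow> 'b::real_normed_vector) \<Rightarrow> bool"
where
  "ck_on 0 S f \<longleftrightarrow> continuous_on S f"
| "ck_on (Suc k) S f \<longleftrightarrow>
     (\<forall>x\<in>S. f differentiable (at x)) \<and> (\<forall>v. ck_on k S (\<lambda>x. frechet_derivative f (at x) v))"

text \<open>Only meant for open \<open>S\<close>.\<close>
definition smooth_on :: "'e::euclidean_space set \<Rightarrow> ('e \<Rightarrow> 'b::real_normed_vector) \<Rightarrow> bool"
  where "smooth_on S f \<longleftrightarrow> (\<forall>k. ck_on k S f)"

text \<open>Derivatives of all orders exist on \<open>[a,b]\<close>, one-sided ones at the endpoints.\<close>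
definition smooth_on_interval :: "real \<Rightarrow> real \<Rightarrow> (real \<Rightarrow> 'b::real_normed_vector) \<Rightarrow> bool"
  where "smooth_on_interval a b f \<longleftrightarrow>
    (\<exists>d. d (0::nat) = f \<and>
      (\<forall>k. \<forall>t\<in>{a..b}. (d k has_vector_derivative d (Suc k) t) (at t within {a..b})))"


section \<open>Manifolds, tangent vectors and fields\<close>

text \<open>
  A chart is a pair of a domain and a coordinate map; the values of the map outside the domain
  are irrelevant.  The manifold is the whole type \<open>'a\<close> of points; the dimension is \<open>CARD('n)\<close> when
  the coordinates are in \<open>real ^ 'n\<close>.  An atlas need not be maximal (but may be).
\<close>
type_synonym ('p, 'e) chart = "'p set \<times> ('p \<Rightarrow> 'e)"

definition chart_inv :: "('p, 'e) chart \<Rightarrow> 'e \<Rightarrow> 'p"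
  where "chart_inv c = inv_into (fst c) (snd c)"

definition smooth_atlas ::
  "('a::{t2_space, second_countable_topology}, 'e::euclidean_space) chart set \<Rightarrow> bool"
where "smooth_atlas A \<longleftrightarrow>
    (\<forall>p. \<exists>c\<in>A. p \<in> fst c) \<and>
    (\<forall>c\<in>A. open (fst c) \<and> open (snd c ` fst c) \<and>
       homeomorphism (fst c) (snd c ` fst c) (snd c) (chart_inv c)) \<and>
    (\<forall>c\<in>A. \<forall>c'\<in>A. smooth_on (snd c ` (fst c \<inter> fst c')) (snd c' \<circ> chart_inv c))"

text \<open>
  A tangent vector at \<open>p\<close> is the family of its component vectors in all the charts around \<open>p\<close>,
  related by the derivatives of the coordinate changes.  The components in the other charts are
  set to \<open>0\<close>, so that the family is determined by its value in any single chart around \<open>p\<close>.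
  The vector space operations are componentwise.
\<close>
type_synonym ('p, 'e) tangent = "('p, 'e) chart \<Rightarrow> 'e"

definition tangent_space ::
  "('p, 'e::euclidean_space) chart set \<Rightarrow> 'p \<Rightarrow> ('p, 'e) tangent set"
where "tangent_space A p = {v.
    (\<forall>c\<in>A. \<forall>c'\<in>A. p \<in> fst c \<and> p \<in> fst c' \<longrightarrow>
       v c' = frechet_derivative (snd c' \<circ> chart_inv c) (at (snd c p)) (v c)) \<and>
    (\<forall>c. \<not> (c \<in> A \<and> p \<in> fst c) \<longrightarrow> v c = 0)}"

text \<open>The tangent vector at \<open>p\<close> with components \<open>y\<close> in the chart \<open>c\<close>.\<close>
definition tangent_of ::
  "('p, 'e::euclidean_space) chart set \<Rightarrow> ('p, 'e) chart \<Rightarrow> 'p \<Rightarrow> 'e \<Rightarrow> ('p, 'e) tangent"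
where "tangent_of A c p y = (THE v. v \<in> tangent_space A p \<and> v c = y)"

definition coord_field ::
  "('p, real ^ 'n) chart set \<Rightarrow> ('p, real ^ 'n) chart \<Rightarrow> 'n \<Rightarrow> 'p \<Rightarrow> ('p, real ^ 'n) tangent"
where "coord_field A c i p = tangent_of A c p (axis i 1)"

text \<open>\<open>Q\<close> is the image in the chart \<open>c\<close> of an open neighbourhood of \<open>u\<close>.\<close>
definition coord_nbhd ::
  "('p, 'e::euclidean_space) chart set \<Rightarrow> 'p \<Rightarrow> ('p, 'e) chart \<Rightarrow> 'e set \<Rightarrow> bool"
where "coord_nbhd A u c Q \<longleftrightarrow>
    c \<in> A \<and> u \<in> fst c \<and> open Q \<and> snd c u \<in> Q \<and> Q \<subseteq> snd c ` fst c"

definition holds_near ::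
  "('p, 'e::euclidean_space) chart set \<Rightarrow> 'p \<Rightarrow> ('p \<Rightarrow> bool) \<Rightarrow> bool"
where "holds_near A u P \<longleftrightarrow> (\<exists>c Q. coord_nbhd A u c Q \<and> (\<forall>w\<in>Q. P (chart_inv c w)))"

definition smooth_fun_near ::
  "('p, 'e::euclidean_space) chart set \<Rightarrow> 'p \<Rightarrow> ('p \<Rightarrow> real) \<Rightarrow> bool"
where "smooth_fun_near A u f \<longleftrightarrow> (\<exists>c Q. coord_nbhd A u c Q \<and> smooth_on Q (f \<circ> chart_inv c))"

definition smooth_field_near ::
  "('p, 'e::euclidean_space) chart set \<Rightarrow> 'p \<Rightarrow> ('p \<Rightarrow> ('p, 'e) tangent) \<Rightarrow> bool"
where "smooth_field_near A u Z \<longleftrightarrow> (\<exists>c Q. coord_nbhd A u c Q \<and>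
    (\<forall>w\<in>Q. Z (chart_inv c w) \<in> tangent_space A (chart_inv c w)) \<and>
    smooth_on Q (\<lambda>w. Z (chart_inv c w) c))"


section \<open>The slit tangent bundle\<close>

text \<open>
  Points of the tangent bundle are pairs \<open>(p, v)\<close>.  The slit tangent bundle \<open>N\<close> is itself a manifold,
  with the atlas of the natural charts \<open>(p, v) \<mapsto> (x, y)\<close>, so the general definitions above give the
  tangent spaces of \<open>N\<close> as well.
\<close>
type_synonym ('a, 'n) bundle_point = "'a \<times> ('a, real ^ 'n) tangent"
type_synonym ('a, 'n) bundle_tangent =
  "(('a, 'n) bundle_point, (real ^ 'n) \<times> (real ^ 'n)) tangent"

definition slit_bundle :: "('a, real ^ 'n) chart set \<Rightarrow> ('a, 'n) bundle_point set"
  where "slit_bundle A = {(p, v). v \<in> tangent_space A p \<and> v \<noteq> (\<lambda>_. 0)}"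

definition slit_chart ::
  "('a, real ^ 'n) chart set \<Rightarrow> ('a, real ^ 'n) chart
    \<Rightarrow> (('a, 'n) bundle_point, (real ^ 'n) \<times> (real ^ 'n)) chart"
where "slit_chart A c =
    ({(p, v). (p, v) \<in> slit_bundle A \<and> p \<in> fst c}, \<lambda>(p, v). (snd c p, v c))"

definition slit_atlas ::
  "('a, real ^ 'n) chart set \<Rightarrow> (('a, 'n) bundle_point, (real ^ 'n) \<times> (real ^ 'n)) chart set"
where "slit_atlas A = slit_chart A ` A"


section \<open>Local Finsler geometry in natural coordinates\<close>

text \<open>
  Here \<open>L\<close> is the Finsler function as a function of the natural coordinates \<open>w = (x, y)\<close>.
\<close>
definition ddx :: "'n \<Rightarrow> ((real ^ 'n) \<times> (real ^ 'n) \<Rightarrow> real) \<Rightarrow> (real ^ 'n) \<times> (real ^ 'n) \<Rightarrow> real"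
  where "ddx k f w = frechet_derivative f (at w) (axis k 1, 0)"

definition ddy :: "'n \<Rightarrow> ((real ^ 'n) \<times> (real ^ 'n) \<Rightarrow> real) \<Rightarrow> (real ^ 'n) \<times> (real ^ 'n) \<Rightarrow> real"
  where "ddy k f w = frechet_derivative f (at w) (0, axis k 1)"

definition fundamental ::
  "((real ^ 'n) \<times> (real ^ 'n) \<Rightarrow> real) \<Rightarrow> (real ^ 'n) \<times> (real ^ 'n) \<Rightarrow> real ^ 'n ^ 'n"
where "fundamental L w = (\<chi> i j. 1/2 * ddy i (ddy j (\<lambda>w'. (L w')\<^sup>2)) w)"

definition cartan_lower ::
  "((real ^ 'n) \<times> (real ^ 'n) \<Rightarrow> real) \<Rightarrow> 'n \<Rightarrow> 'n \<Rightarrow> 'n \<Rightarrow> (real ^ 'n) \<times> (real ^ 'n) \<Rightarrow> real"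
where "cartan_lower L i j k w = L w / 2 * ddy k (\<lambda>w'. fundamental L w' $ i $ j) w"

definition cartan ::
  "((real ^ 'n) \<times> (real ^ 'n) \<Rightarrow> real) \<Rightarrow> 'n \<Rightarrow> 'n \<Rightarrow> 'n \<Rightarrow> (real ^ 'n) \<times> (real ^ 'n) \<Rightarrow> real"
where "cartan L i j k w =
    (\<Sum>l\<in>UNIV. matrix_inv (fundamental L w) $ i $ l * cartan_lower L l j k w)"

definition formal_christoffel ::
  "((real ^ 'n) \<times> (real ^ 'n) \<Rightarrow> real) \<Rightarrow> 'n \<Rightarrow> 'n \<Rightarrow> 'n \<Rightarrow> (real ^ 'n) \<times> (real ^ 'n) \<Rightarrow> real"
where "formal_christoffel L i j k w =
    1/2 * (\<Sum>s\<in>UNIV. matrix_inv (fundamental L w) $ i $ s *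
      (ddx k (\<lambda>w'. fundamental L w' $ s $ j) w
       - ddx s (\<lambda>w'. fundamental L w' $ j $ k) w
       + ddx j (\<lambda>w'. fundamental L w' $ s $ k) w))"

definition nonlinear_coeff ::
  "((real ^ 'n) \<times> (real ^ 'n) \<Rightarrow> real) \<Rightarrow> 'n \<Rightarrow> 'n \<Rightarrow> (real ^ 'n) \<times> (real ^ 'n) \<Rightarrow> real"
where "nonlinear_coeff L i j w = L w *
    ((\<Sum>k\<in>UNIV. formal_christoffel L i j k w * (snd w $ k / L w))
     - (\<Sum>k\<in>UNIV. \<Sum>r\<in>UNIV. \<Sum>s\<in>UNIV. cartan L i j k w * formal_christoffel L k r s w
          * (snd w $ r / L w) * (snd w $ s / L w)))"

text \<open>The 1-forms \<open>\<delta>y\<^sup>i = dy\<^sup>i + N\<^sup>i\<^sub>j dx\<^sup>j\<close>, evaluated at the tangent vector \<open>\<xi>\<close> with components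
  \<open>(dx, dy)\<close>.\<close>
definition delta_y ::
  "((real ^ 'n) \<times> (real ^ 'n) \<Rightarrow> real) \<Rightarrow> (real ^ 'n) \<times> (real ^ 'n) \<Rightarrow> 'n
    \<Rightarrow> (real ^ 'n) \<times> (real ^ 'n) \<Rightarrow> real"
where "delta_y L w i \<xi> = snd \<xi> $ i + (\<Sum>j\<in>UNIV. nonlinear_coeff L i j w * fst \<xi> $ j)"

text \<open>
  The \<open>n\<close>-form \<open>sqrt (det g) \<delta>y\<^sup>1/F \<and> \<dots> \<and> \<delta>y\<^sup>n/F\<close> evaluated at an \<open>'n\<close>-indexed family of tangent
  vectors.  As \<open>'n\<close> carries no order this is meaningful up to a global sign only, which is harmless,
  since the indicatrix is oriented so that its volume form is positive.
\<close>
definition vertical_volume_form ::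
  "((real ^ 'n) \<times> (real ^ 'n) \<Rightarrow> real) \<Rightarrow> (real ^ 'n) \<times> (real ^ 'n)
    \<Rightarrow> ('n \<Rightarrow> (real ^ 'n) \<times> (real ^ 'n)) \<Rightarrow> real"
where "vertical_volume_form L w \<xi> =
    sqrt (det (fundamental L w)) * det ((\<chi> j i. delta_y L w i (\<xi> j) / L w) :: real ^ 'n ^ 'n)"

text \<open>
  Lebesgue measure of the coordinate hyperplane \<open>u $ i0 = 0\<close>; this hyperplane serves as the
  parameter space \<open>R\<^sup>n\<^sup>-\<^sup>1\<close>.
\<close>
definition hyperplane_measure :: "'n::finite \<Rightarrow> (real ^ 'n) measure"
  where "hyperplane_measure i0 =
    distr (PiM (UNIV - {i0}) (\<lambda>_. lborel)) borel (\<lambda>f. \<chi> j. if j = i0 then 0 else f j)"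

text \<open>
  Regular local parametrizations of the hypersurface \<open>I\<close> of \<open>R\<^sup>n\<close> by a relatively open piece
  \<open>{u \<in> U. u $ i0 = 0}\<close> of a coordinate hyperplane.
\<close>
definition hypersurface_patch ::
  "(real ^ 'n) set \<Rightarrow> 'n::finite \<Rightarrow> (real ^ 'n) set \<Rightarrow> (real ^ 'n \<Rightarrow> real ^ 'n) \<Rightarrow> bool"
where "hypersurface_patch I i0 U \<phi> \<longleftrightarrow>
    open U \<and> smooth_on U \<phi> \<and>
    inj_on \<phi> {u\<in>U. u $ i0 = 0} \<and> \<phi> ` {u\<in>U. u $ i0 = 0} \<subseteq> I \<and>
    (\<forall>u\<in>U. u $ i0 = 0 \<longrightarrow> inj_on (frechet_derivative \<phi> (at u)) {h. h $ i0 = 0})"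

text \<open>
  The pull-back by \<open>\<phi>\<close> of the contraction of the \<open>n\<close>-form with \<open>l = (y\<^sup>i/F) \<partial>/\<partial>y\<^sup>i\<close>, evaluated at
  the coordinate vectors of the hyperplane \<open>u $ i0 = 0\<close>: the slot \<open>i0\<close> is filled with \<open>l\<close>, the slot
  \<open>j \<noteq> i0\<close> with the vertical vector \<open>\<partial>\<phi>/\<partial>u\<^sup>j\<close>.  The absolute value expresses the choice of the
  orientation.
\<close>
definition patch_density ::
  "((real ^ 'n) \<times> (real ^ 'n) \<Rightarrow> real) \<Rightarrow> real ^ 'n \<Rightarrow> 'n \<Rightarrow> (real ^ 'n \<Rightarrow> real ^ 'n)
    \<Rightarrow> real ^ 'n \<Rightarrow> real"
where "patch_density L x i0 \<phi> u = \<bar>vertical_volume_form L (x, \<phi> u)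
    (\<lambda>j. if j = i0 then (0, \<phi> u /\<^sub>R L (x, \<phi> u))
         else (0, frechet_derivative \<phi> (at u) (axis j 1)))\<bar>"

text \<open>
  \<open>I\<close> is the indicatrix over \<open>x\<close>, in coordinates.  Its volume form, being positive, is the same as
  the Borel measure which is concentrated on \<open>I\<close> and which in each local parametrization has the
  pulled back form as its density.
\<close>
definition indicatrix_measure ::
  "((real ^ 'n) \<times> (real ^ 'n) \<Rightarrow> real) \<Rightarrow> real ^ 'n \<Rightarrow> (real ^ 'n::finite) set \<Rightarrow> (real ^ 'n) measure"
where "indicatrix_measure L x I = (THE \<mu>.
    sets \<mu> = sets borel \<and> emeasure \<mu> (- I) = 0 \<and>
    (\<forall>i0 U \<phi>. hypersurface_patch I i0 U \<phi> \<longrightarrow>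
      (\<forall>S\<in>sets borel. S \<subseteq> \<phi> ` {u\<in>U. u $ i0 = 0} \<longrightarrow>
        emeasure \<mu> S =
          (\<integral>\<^sup>+ u. indicator {u\<in>U. \<phi> u \<in> S} u * ennreal (patch_density L x i0 \<phi> u)
             \<partial>hyperplane_measure i0))))"


section \<open>Finsler spaces\<close>

text \<open>The Finsler function in the natural coordinates; only meaningful for \<open>y \<noteq> 0\<close>.\<close>
definition local_rep ::
  "('a, real ^ 'n) chart set \<Rightarrow> (('a, 'n) bundle_point \<Rightarrow> real) \<Rightarrow> ('a, real ^ 'n) chart
    \<Rightarrow> (real ^ 'n) \<times> (real ^ 'n) \<Rightarrow> real"
where "local_rep A F c = F \<circ> chart_inv (slit_chart A c)"

definition finsler_space ::
  "('a::{t2_space, second_countable_topology}, real ^ 'n::finite) chart set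
    \<Rightarrow> (('a, 'n) bundle_point \<Rightarrow> real) \<Rightarrow> bool"
where "finsler_space A F \<longleftrightarrow> smooth_atlas A \<and>
    (\<forall>p. \<forall>v\<in>tangent_space A p. F (p, v) \<ge> 0) \<and>
    (\<forall>p. \<forall>v\<in>tangent_space A p. \<forall>r\<ge>0. F (p, \<lambda>c. r *\<^sub>R v c) = r * F (p, v)) \<and>
    (\<forall>c\<in>A. smooth_on ((snd c ` fst c) \<times> (- {0})) (local_rep A F c)) \<and>
    (\<forall>c\<in>A. \<forall>w\<in>(snd c ` fst c) \<times> (- {0}). \<forall>\<xi>. \<xi> \<noteq> 0 \<longrightarrow>
       (\<Sum>i\<in>UNIV. \<Sum>j\<in>UNIV. fundamental (local_rep A F c) w $ i $ j * \<xi> $ i * \<xi> $ j) > 0)"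

definition indicatrix ::
  "('a, real ^ 'n) chart set \<Rightarrow> (('a, 'n) bundle_point \<Rightarrow> real) \<Rightarrow> 'a \<Rightarrow> ('a, real ^ 'n) tangent set"
where "indicatrix A F p = {v \<in> tangent_space A p. F (p, v) = 1}"

text \<open>
  The notions below which are given by formulas in natural coordinates take the chart \<open>c\<close> that
  induces the coordinates as a parameter.  The horizontal lift and the averages over the indicatrix
  at \<open>p\<close> are the same for all the charts around \<open>p\<close> (for \<open>nonlinear_coeff\<close> and the volume form this
  is the classical transformation behaviour); \<open>dvol\<close> is the volume transported to coordinates.
\<close>
definition dvol ::
  "('a, real ^ 'n::finite) chart set \<Rightarrow> (('a, 'n) bundle_point \<Rightarrow> real) \<Rightarrow> ('a, real ^ 'n) chart
    \<Rightarrow> 'a \<Rightarrow> (real ^ 'n) measure"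
where "dvol A F c p =
    indicatrix_measure (local_rep A F c) (snd c p) ((\<lambda>v. v c) ` indicatrix A F p)"

text \<open>The average over the indicatrix at \<open>p\<close> of a function with values in the tangent space at \<open>p\<close>.\<close>
definition average ::
  "('a, real ^ 'n::finite) chart set \<Rightarrow> (('a, 'n) bundle_point \<Rightarrow> real) \<Rightarrow> ('a, real ^ 'n) chart
    \<Rightarrow> 'a \<Rightarrow> (('a, 'n) bundle_point \<Rightarrow> ('a, real ^ 'n) tangent) \<Rightarrow> ('a, real ^ 'n) tangent"
where "average A F c p f = (\<lambda>c'.
    (1 / measure (dvol A F c p) UNIV) *\<^sub>R
      (\<integral>y. f (p, tangent_of A c p y) c' \<partial>dvol A F c p))"

definition horizontal_lift ::
  "('a, real ^ 'n::finite) chart set \<Rightarrow> (('a, 'n) bundle_point \<Rightarrow> real) \<Rightarrow> ('a, real ^ 'n) chart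
    \<Rightarrow> ('a, 'n) bundle_point \<Rightarrow> ('a, real ^ 'n) tangent \<Rightarrow> ('a, 'n) bundle_tangent"
where "horizontal_lift A F c u X =
    tangent_of (slit_atlas A) (slit_chart A c) u
      (X c, \<chi> i. - (\<Sum>j\<in>UNIV. nonlinear_coeff (local_rep A F c) i j (snd (slit_chart A c) u) * X c $ j))"


section \<open>Linear connections on the pull-back bundle and the average connection\<close>

text \<open>
  The fiber of the pull-back bundle over \<open>u = (p, v)\<close> is identified with the tangent space at \<open>p\<close>
  (so \<open>\<pi>\<^sub>2\<close> does not appear in the formulas), and a section is a function \<open>s\<close> on the slit bundle with
  \<open>s u\<close> in the tangent space at \<open>fst u\<close>.
\<close>
definition smooth_section_near ::
  "('a, real ^ 'n) chart set \<Rightarrow> ('a, 'n) bundle_point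
    \<Rightarrow> (('a, 'n) bundle_point \<Rightarrow> ('a, real ^ 'n) tangent) \<Rightarrow> bool"
where "smooth_section_near A u s \<longleftrightarrow>
    (\<exists>c\<in>A. \<exists>Q. coord_nbhd (slit_atlas A) u (slit_chart A c) Q \<and>
      (\<forall>w\<in>Q. s (chart_inv (slit_chart A c) w)
                \<in> tangent_space A (fst (chart_inv (slit_chart A c) w))) \<and>
      smooth_on Q (\<lambda>w. s (chart_inv (slit_chart A c) w) c))"

text \<open>
  \<open>nabla u Z s\<close> is the covariant derivative at \<open>u\<close> in the direction \<open>Z \<in> T\<^sub>u N\<close> of a section \<open>s\<close> which
  is smooth near \<open>u\<close>.  The clauses: values in the fiber, linearity in \<open>Z\<close>, additivity in \<open>s\<close>, Leibniz
  rule, dependence on the germ of \<open>s\<close> only, smoothness.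
\<close>
definition linear_connection ::
  "('a, real ^ 'n) chart set
    \<Rightarrow> (('a, 'n) bundle_point \<Rightarrow> ('a, 'n) bundle_tangent
         \<Rightarrow> (('a, 'n) bundle_point \<Rightarrow> ('a, real ^ 'n) tangent) \<Rightarrow> ('a, real ^ 'n) tangent)
    \<Rightarrow> bool"
where "linear_connection A nabla \<longleftrightarrow> (\<forall>u\<in>slit_bundle A.
    (\<forall>Z\<in>tangent_space (slit_atlas A) u. \<forall>s. smooth_section_near A u s \<longrightarrow>
       nabla u Z s \<in> tangent_space A (fst u)) \<and>
    (\<forall>Z\<in>tangent_space (slit_atlas A) u. \<forall>Z'\<in>tangent_space (slit_atlas A) u. \<forall>\<alpha> \<beta> s.
       smooth_section_near A u s \<longrightarrow>
       nabla u (\<lambda>k. \<alpha> *\<^sub>R Z k + \<beta> *\<^sub>R Z' k) s = (\<lambda>c. \<alpha> *\<^sub>R nabla u Z s c + \<beta> *\<^sub>R nabla u Z' s c)) \<and>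
    (\<forall>Z\<in>tangent_space (slit_atlas A) u. \<forall>s s'.
       smooth_section_near A u s \<and> smooth_section_near A u s' \<longrightarrow>
       nabla u Z (\<lambda>u'. \<lambda>c. s u' c + s' u' c) = (\<lambda>c. nabla u Z s c + nabla u Z s' c)) \<and>
    (\<forall>Z\<in>tangent_space (slit_atlas A) u. \<forall>f s.
       smooth_fun_near (slit_atlas A) u f \<and> smooth_section_near A u s \<longrightarrow>
       (\<forall>k\<in>slit_atlas A. u \<in> fst k \<longrightarrow>
         nabla u Z (\<lambda>u'. \<lambda>c. f u' *\<^sub>R s u' c) =
           (\<lambda>c. frechet_derivative (f \<circ> chart_inv k) (at (snd k u)) (Z k) *\<^sub>R s u c
                + f u *\<^sub>R nabla u Z s c))) \<and>
    (\<forall>Z\<in>tangent_space (slit_atlas A) u. \<forall>s s'.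
       smooth_section_near A u s \<and> smooth_section_near A u s' \<and>
       holds_near (slit_atlas A) u (\<lambda>u'. s u' = s' u') \<longrightarrow> nabla u Z s = nabla u Z s') \<and>
    (\<forall>Zf s. smooth_field_near (slit_atlas A) u Zf \<and> smooth_section_near A u s \<longrightarrow>
       smooth_section_near A u (\<lambda>u'. nabla u' (Zf u') s)))"

text \<open>The average connection at \<open>p\<close>; \<open>Y\<close> is a vector field defined near \<open>p\<close>, and \<open>Y \<circ> fst\<close> is its
  pull-back section.\<close>
definition average_connection ::
  "('a, real ^ 'n::finite) chart set \<Rightarrow> (('a, 'n) bundle_point \<Rightarrow> real)
    \<Rightarrow> (('a, 'n) bundle_point \<Rightarrow> ('a, 'n) bundle_tangent
         \<Rightarrow> (('a, 'n) bundle_point \<Rightarrow> ('a, real ^ 'n) tangent) \<Rightarrow> ('a, real ^ 'n) tangent)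
    \<Rightarrow> ('a, real ^ 'n) chart
    \<Rightarrow> 'a \<Rightarrow> ('a, real ^ 'n) tangent \<Rightarrow> ('a \<Rightarrow> ('a, real ^ 'n) tangent) \<Rightarrow> ('a, real ^ 'n) tangent"
where "average_connection A F nabla c p X Y =
    average A F c p (\<lambda>u. nabla u (horizontal_lift A F c u X) (Y \<circ> fst))"


section \<open>Affine connections: coefficients and parallel transport in a chart\<close>

text \<open>\<open>D p X Y\<close> is the derivative at \<open>p\<close> of the vector field \<open>Y\<close> in the direction \<open>X\<close>.  The coefficient
  with indices \<open>j\<close> (upper), \<open>i\<close>, \<open>l\<close> (lower) is the \<open>j\<close>-th component of the derivative of \<open>e\<^sub>i\<close>
  in the direction \<open>e\<^sub>l\<close>.\<close>
definition connection_coeff ::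
  "('a, real ^ 'n::finite) chart set \<Rightarrow> ('a, real ^ 'n) chart
    \<Rightarrow> ('a \<Rightarrow> ('a, real ^ 'n) tangent \<Rightarrow> ('a \<Rightarrow> ('a, real ^ 'n) tangent) \<Rightarrow> ('a, real ^ 'n) tangent)
    \<Rightarrow> 'n \<Rightarrow> 'n \<Rightarrow> 'n \<Rightarrow> 'a \<Rightarrow> real"
where "connection_coeff A c D j i l p = D p (coord_field A c l p) (coord_field A c i) c $ j"

definition velocity ::
  "('a, real ^ 'n) chart set \<Rightarrow> ('a, real ^ 'n) chart \<Rightarrow> real \<Rightarrow> real \<Rightarrow> (real \<Rightarrow> 'a) \<Rightarrow> real
    \<Rightarrow> ('a, real ^ 'n) tangent"
where "velocity A c a b \<gamma> t =
    tangent_of A c (\<gamma> t) (vector_derivative (snd c \<circ> \<gamma>) (at t within {a..b}))"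

text \<open>
  The derivative along \<open>\<gamma>\<close> of the vector field \<open>S = S\<^sup>i e\<^sub>i\<close> along \<open>\<gamma>\<close>: by additivity and the Leibniz
  rule it is \<open>(dS\<^sup>i/dt) e\<^sub>i + S\<^sup>i D\<^bsub>\<gamma>'\<^esub> e\<^sub>i\<close>.
\<close>
definition derivative_along ::
  "('a, real ^ 'n::finite) chart set \<Rightarrow> ('a, real ^ 'n) chart
    \<Rightarrow> ('a \<Rightarrow> ('a, real ^ 'n) tangent \<Rightarrow> ('a \<Rightarrow> ('a, real ^ 'n) tangent) \<Rightarrow> ('a, real ^ 'n) tangent)
    \<Rightarrow> real \<Rightarrow> real \<Rightarrow> (real \<Rightarrow> 'a) \<Rightarrow> (real \<Rightarrow> ('a, real ^ 'n) tangent) \<Rightarrow> real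
    \<Rightarrow> ('a, real ^ 'n) tangent"
where "derivative_along A c D a b \<gamma> S t = (\<lambda>c'. \<Sum>i\<in>UNIV.
    (vector_derivative (\<lambda>s. S s c) (at t within {a..b}) $ i) *\<^sub>R coord_field A c i (\<gamma> t) c'
    + (S t c $ i) *\<^sub>R D (\<gamma> t) (velocity A c a b \<gamma> t) (coord_field A c i) c')"

definition parallel_along ::
  "('a, real ^ 'n::finite) chart set \<Rightarrow> ('a, real ^ 'n) chart
    \<Rightarrow> ('a \<Rightarrow> ('a, real ^ 'n) tangent \<Rightarrow> ('a \<Rightarrow> ('a, real ^ 'n) tangent) \<Rightarrow> ('a, real ^ 'n) tangent)
    \<Rightarrow> real \<Rightarrow> real \<Rightarrow> (real \<Rightarrow> 'a) \<Rightarrow> (real \<Rightarrow> ('a, real ^ 'n) tangent) \<Rightarrow> bool"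
where "parallel_along A c D a b \<gamma> S \<longleftrightarrow> (\<forall>t\<in>{a..b}.
    S t \<in> tangent_space A (\<gamma> t) \<and>
    (\<lambda>s. S s c) differentiable (at t within {a..b}) \<and>
    derivative_along A c D a b \<gamma> S t = (\<lambda>_. 0))"

definition parallel_transport ::
  "('a, real ^ 'n::finite) chart set \<Rightarrow> ('a, real ^ 'n) chart
    \<Rightarrow> ('a \<Rightarrow> ('a, real ^ 'n) tangent \<Rightarrow> ('a \<Rightarrow> ('a, real ^ 'n) tangent) \<Rightarrow> ('a, real ^ 'n) tangent)
    \<Rightarrow> real \<Rightarrow> real \<Rightarrow> (real \<Rightarrow> 'a) \<Rightarrow> ('a, real ^ 'n) tangent \<Rightarrow> ('a, real ^ 'n) tangent"
where "parallel_transport A c D a b \<gamma> X =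
    (THE Z. \<exists>S. parallel_along A c D a b \<gamma> S \<and> S a = X \<and> S b = Z)"

text \<open>\<open>M m ** \<dots> ** M 2 ** M 1\<close>\<close>
primrec ordered_product :: "(nat \<Rightarrow> real ^ 'n ^ 'n) \<Rightarrow> nat \<Rightarrow> real ^ 'n ^ 'n"
where
  "ordered_product M 0 = mat 1"
| "ordered_product M (Suc k) = M (Suc k) ** ordered_product M k"

end

theory Submission
  imports Defs
begin

text \<open>
  In a chart, the equation of parallel transport along the curve \<open>\<gamma>\<close> is the linear
  differential equation \<open>s' = M s\<close> with \<open>M\<^sup>r\<^sub>i = - \<Gamma>\<^sup>r\<^sub>i\<^sub>l \<gamma>'\<^sup>l\<close>, and the ordered product is the result
  of solving it by a one-step difference scheme, in which \<open>M\<close> is evaluated at the right end of each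
  step.  If \<open>M\<close> is continuous, the local error of a step is \<open>o(\<epsilon>)\<close> uniformly in the step, and errors
  are amplified by at most \<open>exp (C (b - a))\<close>; so the products converge to the value at \<open>b\<close> of any
  solution (\<open>euler_product_tendsto\<close>).  In particular the solution is unique; it exists by Picard
  iteration (\<open>linear_ode_solution_exists\<close>).

  The substance is therefore the continuity of the averaged coefficients \<open>\<langle>\<Gamma>\<^sup>r\<^sub>i\<^sub>l\<rangle>\<close>, that is, the continuous
  dependence on the base point of an integral over the indicatrix, a hypersurface that moves with the
  point.  Let \<open>x\<close> be fixed, and let \<open>q (y) = sqrt (det g (x, y))\<close>, which is homogeneous of degree \<open>0\<close>.
  In polar coordinates \<open>y = r \<phi>(u)\<close> over a local parametrization \<open>\<phi>\<close> of the indicatrix, the measure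
  \<open>q(y) F(y)\<^sup>-\<^sup>n dy\<close> becomes \<open>dr/r\<close> times the volume form of the indicatrix.  As \<open>dr/r\<close> is invariant under
  scaling, the Euclidean annulus \<open>1 \<le> |y| \<le> e\<close> meets every ray in a segment of \<open>dr/r\<close>-length \<open>1\<close>.  Hence
  the volume of the indicatrix is the image of \<open>q(y) F(y)\<^sup>-\<^sup>n dy\<close>, restricted to the annulus, under the
  radial projection \<open>y \<mapsto> y / F(y)\<close> (\<open>cone_measure_patch\<close>, \<open>indicatrix_measure_eq_cone_measure\<close>).  All
  averages become integrals over one compact set that does not depend on \<open>x\<close> and stays away from
  the origin, with integrands that are jointly continuous in \<open>x\<close> and \<open>y\<close> (\<open>connection_coeff_continuous\<close>).

  The integrands are continuous because the horizontal lift of a coordinate field has smooth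
  components (\<open>nonlinear_coeff_smooth\<close>), so that a linear connection turns it into a smooth section of the
  pull-back bundle.  The same integral formula shows that the average connection takes its values in
  the tangent space and is linear in the direction, which identifies its parallel fields with the solutions
  of \<open>s' = M s\<close> (\<open>parallel_along_iff\<close>).
\<close>

section \<open>Calculus of smooth maps\<close>

lemma ck_on_imp_continuous_on:
  assumes "ck_on k S f" shows "continuous_on S f"
  using assms
proof (cases k)
  case (Suc m)
  then have "isCont f x" if "x \<in> S" for x
    using assms that by (simp add: differentiable_imp_continuous_within)
  then show ?thesis by (simp add: continuous_at_imp_continuous_on)
qed simp

lemma ck_on_Suc_lower: "ck_on (Suc k) S f \<Longrightarrow> ck_on k S f"
proof (induction k arbitrary: f)
  case 0
  then show ?case using ck_on_imp_continuous_on[of "Suc 0" S f] by simp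
next
  case (Suc k)
  then show ?case by (metis ck_on.simps(2))
qed

lemma frechet_derivative_cong_open:
  assumes "open S" "x \<in> S" "\<And>x. x \<in> S \<Longrightarrow> f x = g x"
  shows "frechet_derivative f (at x) = frechet_derivative g (at x)"
proof -
  have "(f has_derivative D) (at x) \<longleftrightarrow> (g has_derivative D) (at x)" for D
    using assms has_derivative_transform_within_open[of f D x UNIV S g]
      has_derivative_transform_within_open[of g D x UNIV S f] by auto
  then show ?thesis unfolding frechet_derivative_def by simp
qed

lemma differentiable_cong_open:
  assumes "open S" "x \<in> S" "\<And>x. x \<in> S \<Longrightarrow> f x = g x" "f differentiable (at x)"
  shows "g differentiable (at x)"
  using assms unfolding differentiable_def
  by (meson has_derivative_transform_within_open)

lemma ck_on_cong:
  assumes "open S" "\<And>x. x \<in> S \<Longrightarrow> f x = g x" "ck_on k S f"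
  shows "ck_on k S g"
  using assms(2,3)
proof (induction k arbitrary: f g)
  case 0
  then show ?case by (auto cong: continuous_on_cong)
next
  case (Suc k)
  have "ck_on k S (\<lambda>x. frechet_derivative g (at x) v)" for v
    using Suc.IH[of "\<lambda>x. frechet_derivative f (at x) v" "\<lambda>x. frechet_derivative g (at x) v"] Suc.prems
      frechet_derivative_cong_open[OF assms(1) _ Suc.prems(1)] by auto
  moreover have "g differentiable (at x)" if "x \<in> S" for x
    using differentiable_cong_open[OF assms(1) that Suc.prems(1)] Suc.prems(2) that by auto
  ultimately show ?case by simp
qed

text \<open>
  The Frechet derivative is a chosen function; this rule lets it be replaced by any explicit derivative,
  which is how all the closure properties below are proved by induction on the order.
\<close>
lemma ck_on_SucI:
  assumes "open S" "\<And>x. x \<in> S \<Longrightarrow> (f has_derivative f' x) (at x)"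
    "\<And>v. ck_on k S (\<lambda>x. f' x v)"
  shows "ck_on (Suc k) S f"
proof -
  have "frechet_derivative f (at x) = f' x" if "x \<in> S" for x
    using assms(2)[OF that] by (metis frechet_derivative_at)
  then have "ck_on k S (\<lambda>x. frechet_derivative f (at x) v)" for v
    using ck_on_cong[OF assms(1) _ assms(3)] by auto
  then show ?thesis using assms(2) by (auto simp: differentiable_def)
qed

lemma ck_on_Suc_derivative:
  assumes "ck_on (Suc k) S f" "x \<in> S"
  shows "(f has_derivative frechet_derivative f (at x)) (at x)"
  using assms by (simp add: frechet_derivative_works[symmetric])

lemma ck_on_const: "open S \<Longrightarrow> ck_on k S (\<lambda>_. c)"
proof (induction k arbitrary: c)
  case (Suc k)
  show ?case by (rule ck_on_SucI[where f' = "\<lambda>_ _. 0"]) (use Suc in auto)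
qed auto

lemma ck_on_bounded_linear:
  assumes "bounded_linear h" "open S" "ck_on k S f"
  shows "ck_on k S (\<lambda>x. h (f x))"
  using assms(3)
proof (induction k arbitrary: f)
  case 0
  then show ?case using bounded_linear.continuous_on[OF assms(1)] by auto
next
  case (Suc k)
  show ?case
    by (rule ck_on_SucI[OF assms(2), where f' = "\<lambda>x v. h (frechet_derivative f (at x) v)"])
      (use Suc in \<open>auto intro!: bounded_linear.has_derivative[OF assms(1)] ck_on_Suc_derivative[OF Suc.prems]\<close>)
qed

lemma ck_on_add:
  assumes "open S" "ck_on k S f" "ck_on k S g"
  shows "ck_on k S (\<lambda>x. f x + g x)"
  using assms(2,3)
proof (induction k arbitrary: f g)
  case 0
  then show ?case by (auto intro: continuous_intros)
next
  case (Suc k)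
  show ?case
    by (rule ck_on_SucI[OF assms(1), where f' = "\<lambda>x v. frechet_derivative f (at x) v + frechet_derivative g (at x) v"])
      (use Suc in \<open>auto intro!: has_derivative_add ck_on_Suc_derivative[OF Suc.prems(1)] ck_on_Suc_derivative[OF Suc.prems(2)]\<close>)
qed

lemma ck_on_bilinear:
  assumes "bounded_bilinear h" "open S" "ck_on k S f" "ck_on k S g"
  shows "ck_on k S (\<lambda>x. h (f x) (g x))"
  using assms(3,4)
proof (induction k arbitrary: f g)
  case 0
  then show ?case using bounded_bilinear.continuous_on[OF assms(1)] by auto
next
  case (Suc k)
  show ?case
    by (rule ck_on_SucI[OF assms(2),
          where f' = "\<lambda>x v. h (f x) (frechet_derivative g (at x) v) + h (frechet_derivative f (at x) v) (g x)"])
      (use Suc ck_on_Suc_lower[OF Suc.prems(1)] ck_on_Suc_lower[OF Suc.prems(2)] in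
        \<open>auto intro!: ck_on_add[OF assms(2)] bounded_bilinear.FDERIV[OF assms(1)]
          ck_on_Suc_derivative[OF Suc.prems(1)] ck_on_Suc_derivative[OF Suc.prems(2)]\<close>)
qed

text \<open>
  The derivative of \<open>1/f\<close> is again built from \<open>1/f\<close> and a derivative of \<open>f\<close>, so the induction runs over
  the order with \<open>f\<close> fixed.
\<close>
lemma ck_on_inverse:
  fixes f :: "'e::euclidean_space \<Rightarrow> real"
  assumes "open S" "\<And>x. x \<in> S \<Longrightarrow> f x \<noteq> 0" "ck_on k S f"
  shows "ck_on k S (\<lambda>x. inverse (f x))"
  using assms(3)
proof (induction k)
  case 0
  then show ?case using assms(2) by (auto intro: continuous_intros)
next
  case (Suc k)
  have "ck_on k S (\<lambda>x. inverse (f x))" using Suc ck_on_Suc_lower by blast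
  moreover have "ck_on k S (\<lambda>x. frechet_derivative f (at x) v)" for v using Suc by simp
  ultimately have "ck_on k S (\<lambda>x. - (inverse (f x) * frechet_derivative f (at x) v * inverse (f x)))" for v
    by (intro ck_on_bounded_linear[OF bounded_linear_minus[OF bounded_linear_ident]]
        ck_on_bilinear[OF bounded_bilinear_mult] assms(1))
  then show ?case
    using ck_on_SucI[OF assms(1) Deriv.has_derivative_inverse[OF assms(2) ck_on_Suc_derivative[OF Suc.prems]]] by blast
qed

lemma ck_on_affine:
  assumes "bounded_linear h" "open S" "\<And>x. x \<in> S \<Longrightarrow> q + h x \<in> T" "ck_on k T f"
  shows "ck_on k S (\<lambda>x. f (q + h x))"
  using assms(4)
proof (induction k arbitrary: f)
  case 0
  have "continuous_on S (\<lambda>x. q + h x)"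
    using assms(1) by (intro continuous_intros linear_continuous_on)
  then show ?case using 0 assms(3)
    by (auto intro: continuous_on_compose2)
next
  case (Suc k)
  have "((\<lambda>x. f (q + h x)) has_derivative (\<lambda>v. frechet_derivative f (at (q + h x)) (h v))) (at x)"
    if "x \<in> S" for x
  proof (rule has_derivative_compose[of "\<lambda>x. q + h x" h])
    show "((\<lambda>x. q + h x) has_derivative h) (at x)"
      by (rule derivative_eq_intros bounded_linear_imp_has_derivative[OF assms(1)] | simp)+
    show "(f has_derivative frechet_derivative f (at (q + h x))) (at (q + h x))"
      using ck_on_Suc_derivative[OF Suc.prems] assms(3) that by blast
  qed
  then show ?case
    by (rule ck_on_SucI[OF assms(2)]) (use Suc in auto)
qed

lemma smooth_on_cong:
  "open S \<Longrightarrow> (\<And>x. x \<in> S \<Longrightarrow> f x = g x) \<Longrightarrow> smooth_on S f \<Longrightarrow> smooth_on S g"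
  using ck_on_cong unfolding smooth_on_def by blast

lemma ck_on_subset: "T \<subseteq> S \<Longrightarrow> ck_on k S f \<Longrightarrow> ck_on k T f"
  by (induction k arbitrary: f) (auto intro: continuous_on_subset)

lemma smooth_on_subset: "T \<subseteq> S \<Longrightarrow> smooth_on S f \<Longrightarrow> smooth_on T f"
  using ck_on_subset unfolding smooth_on_def by blast

lemma smooth_on_const: "open S \<Longrightarrow> smooth_on S (\<lambda>_. c)"
  by (simp add: smooth_on_def ck_on_const)

lemma smooth_on_bounded_linear:
  "bounded_linear h \<Longrightarrow> open S \<Longrightarrow> smooth_on S f \<Longrightarrow> smooth_on S (\<lambda>x. h (f x))"
  by (simp add: smooth_on_def ck_on_bounded_linear)

lemma smooth_on_add:
  "open S \<Longrightarrow> smooth_on S f \<Longrightarrow> smooth_on S g \<Longrightarrow> smooth_on S (\<lambda>x. f x + g x)"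
  by (simp add: smooth_on_def ck_on_add)

lemma smooth_on_bilinear:
  "bounded_bilinear m \<Longrightarrow> open S \<Longrightarrow> smooth_on S f \<Longrightarrow> smooth_on S g
    \<Longrightarrow> smooth_on S (\<lambda>x. m (f x) (g x))"
  by (simp add: smooth_on_def ck_on_bilinear)

lemma smooth_on_affine:
  assumes "bounded_linear h" "open S" "\<And>x. x \<in> S \<Longrightarrow> q + h x \<in> T" "smooth_on T f"
  shows "smooth_on S (\<lambda>x. f (q + h x))"
  unfolding smooth_on_def
proof
  fix k show "ck_on k S (\<lambda>x. f (q + h x))"
    using assms(4) by (intro ck_on_affine[OF assms(1-3)]) (simp_all add: smooth_on_def)
qed

lemma smooth_on_continuous_on: "smooth_on S f \<Longrightarrow> continuous_on S f"
  unfolding smooth_on_def using ck_on_imp_continuous_on by blast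

lemma smooth_on_differentiable: "smooth_on S f \<Longrightarrow> x \<in> S \<Longrightarrow> f differentiable (at x)"
  unfolding smooth_on_def by (meson ck_on.simps(2))

lemma smooth_on_derivative: "smooth_on S f \<Longrightarrow> smooth_on S (\<lambda>x. frechet_derivative f (at x) v)"
  unfolding smooth_on_def by (metis ck_on.simps(2))

lemma smooth_on_inverse:
  fixes f :: "'e::euclidean_space \<Rightarrow> real"
  shows "open S \<Longrightarrow> (\<And>x. x \<in> S \<Longrightarrow> f x \<noteq> 0) \<Longrightarrow> smooth_on S f \<Longrightarrow> smooth_on S (\<lambda>x. inverse (f x))"
  using ck_on_inverse unfolding smooth_on_def by blast

lemma smooth_on_mult:
  fixes f :: "'e::euclidean_space \<Rightarrow> real"
  shows "open S \<Longrightarrow> smooth_on S f \<Longrightarrow> smooth_on S g \<Longrightarrow> smooth_on S (\<lambda>x. f x * g x)"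
  by (rule smooth_on_bilinear[OF bounded_bilinear_mult])

lemma smooth_on_divide:
  fixes f :: "'e::euclidean_space \<Rightarrow> real"
  shows "open S \<Longrightarrow> (\<And>x. x \<in> S \<Longrightarrow> g x \<noteq> 0) \<Longrightarrow> smooth_on S f \<Longrightarrow> smooth_on S g \<Longrightarrow> smooth_on S (\<lambda>x. f x / g x)"
  unfolding divide_inverse by (intro smooth_on_mult smooth_on_inverse)

lemma smooth_on_minus: "open S \<Longrightarrow> smooth_on S f \<Longrightarrow> smooth_on S (\<lambda>x. - f x)"
  by (rule smooth_on_bounded_linear[OF bounded_linear_minus[OF bounded_linear_ident]])

lemma smooth_on_diff:
  "open S \<Longrightarrow> smooth_on S f \<Longrightarrow> smooth_on S g \<Longrightarrow> smooth_on S (\<lambda>x. f x - g x)"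
  using smooth_on_add[OF _ _ smooth_on_minus, of S f g] by simp

lemma smooth_on_sum:
  "open S \<Longrightarrow> (\<And>i. i \<in> I \<Longrightarrow> smooth_on S (f i)) \<Longrightarrow> smooth_on S (\<lambda>x. \<Sum>i\<in>I. f i x)"
  by (induction I rule: infinite_finite_induct) (auto intro: smooth_on_const smooth_on_add)

lemma smooth_on_prod:
  fixes f :: "'i \<Rightarrow> 'e::euclidean_space \<Rightarrow> real"
  shows "open S \<Longrightarrow> (\<And>i. i \<in> I \<Longrightarrow> smooth_on S (f i)) \<Longrightarrow> smooth_on S (\<lambda>x. \<Prod>i\<in>I. f i x)"
  by (induction I rule: infinite_finite_induct) (auto intro: smooth_on_const smooth_on_mult)

lemma smooth_on_id_linear: "bounded_linear h \<Longrightarrow> open S \<Longrightarrow> smooth_on S h"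
proof -
  assume h: "bounded_linear h" and S: "open S"
  have "ck_on k S h" for k
  proof (cases k)
    case 0 then show ?thesis using h by (simp add: linear_continuous_on)
  next
    case (Suc m)
    show ?thesis unfolding Suc
      by (rule ck_on_SucI[OF S, where f' = "\<lambda>_. h"])
        (auto intro: bounded_linear_imp_has_derivative h ck_on_const S)
  qed
  then show "smooth_on S h" by (simp add: smooth_on_def)
qed

lemma smooth_on_Pair:
  assumes "open S" "smooth_on S f" "smooth_on S g"
  shows "smooth_on S (\<lambda>x. (f x, g x))"
proof -
  have "bounded_linear (\<lambda>y. (y, 0))" "bounded_linear (\<lambda>z. (0, z))"
    by (intro bounded_linear_Pair bounded_linear_ident bounded_linear_zero)+
  from smooth_on_add[OF assms(1) smooth_on_bounded_linear[OF this(1) assms(1,2)]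
      smooth_on_bounded_linear[OF this(2) assms(1,3)]]
  show ?thesis by simp
qed

lemma smooth_on_fst:
  assumes "open T" "smooth_on S f" "\<And>w. w \<in> T \<Longrightarrow> fst w \<in> S"
  shows "smooth_on T (\<lambda>w. f (fst w))"
  using smooth_on_affine[OF bounded_linear_fst assms(1), of 0 S f] assms by simp

lemma smooth_on_vec:
  fixes f :: "'e::euclidean_space \<Rightarrow> 'i::finite \<Rightarrow> real"
  assumes "open S" "\<And>i. smooth_on S (\<lambda>x. f x i)"
  shows "smooth_on S (\<lambda>x. \<chi> i. f x i)"
proof -
  have eq: "(\<chi> i. f x i) = (\<Sum>i\<in>UNIV. f x i *\<^sub>R axis i 1)" for x
    by (simp add: vec_eq_iff sum_component axis_def if_distrib if_distribR cong: if_cong)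
  show ?thesis unfolding eq
    by (intro smooth_on_sum smooth_on_bounded_linear[OF bounded_linear_scaleR_left] assms)
qed

lemma smooth_on_det:
  fixes M :: "'e::euclidean_space \<Rightarrow> real ^ 'n ^ 'n"
  assumes "open S" "\<And>i j. smooth_on S (\<lambda>x. M x $ i $ j)"
  shows "smooth_on S (\<lambda>x. det (M x))"
  unfolding det_def by (intro smooth_on_sum smooth_on_mult smooth_on_const smooth_on_prod assms)

text \<open>
  Cramer's rule exhibits the entries of the inverse as quotients of determinants, which depend smoothly
  on the matrix.
\<close>
lemma matrix_inv_entry:
  fixes M :: "real ^ 'n ^ 'n"
  assumes "det M \<noteq> 0"
  shows "matrix_inv M $ i $ k =
    det (\<chi> r j. if j = i then axis k 1 $ r else M $ r $ j) / det M"
proof -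
  have inv: "invertible M" using assms invertible_det_nz by blast
  have "M *v (matrix_inv M *v axis k 1) = axis k 1"
    using someI_ex[OF inv[unfolded invertible_def]]
    by (simp add: matrix_vector_mul_assoc matrix_inv_def)
  then have "matrix_inv M *v axis k 1 =
      (\<chi> i. det (\<chi> r j. if j = i then axis k 1 $ r else M $ r $ j) / det M)"
    using cramer[OF assms] by blast
  then show ?thesis
    by (simp add: matrix_vector_mul_component[symmetric] matrix_vector_mult_basis column_def vec_eq_iff)
qed

lemma smooth_on_matrix_inv:
  fixes M :: "'e::euclidean_space \<Rightarrow> real ^ 'n ^ 'n"
  assumes "open S" "\<And>i j. smooth_on S (\<lambda>x. M x $ i $ j)" "\<And>x. x \<in> S \<Longrightarrow> det (M x) \<noteq> 0"
  shows "smooth_on S (\<lambda>x. matrix_inv (M x) $ i $ k)"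
proof -
  have "smooth_on S (\<lambda>x. (\<chi> r j. if j = i then axis k 1 $ r else M x $ r $ j) $ r $ j)" for r j
    by (cases "j = i") (auto intro: smooth_on_const assms)
  then have "smooth_on S (\<lambda>x. det (\<chi> r j. if j = i then axis k 1 $ r else M x $ r $ j) / det (M x))"
    by (intro smooth_on_divide smooth_on_det assms)
  then show ?thesis
    by (rule smooth_on_cong[OF assms(1), rotated]) (simp add: matrix_inv_entry assms(3))
qed

section \<open>Change of variables for an arbitrary finite index type\<close>

text \<open>
  The substitution rule for multidimensional integrals is proved by treating the coordinates one after
  the other, so it speaks of an ordered index type.  An arbitrary finite index type is reduced to this case
  by relabelling the coordinates with a copy of the type that is ordered through some injection
  into the natural numbers.
\<close>
datatype 'n wellordered_copy = Copy (orig: 'n)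

lemma bij_orig: "bij orig"
  by (rule bij_betw_byWitness[of _ Copy]) auto

instance wellordered_copy :: (finite) finite
proof
  have "(UNIV :: 'a wellordered_copy set) = range Copy" by (metis UNIV_eq_I rangeI wellordered_copy.exhaust)
  then show "finite (UNIV :: 'a wellordered_copy set)" by (metis finite finite_imageI)
qed

definition index_rank :: "'n::finite \<Rightarrow> nat" where "index_rank = (SOME r. inj r)"

lemma inj_index_rank: "inj (index_rank :: 'n::finite \<Rightarrow> nat)"
proof -
  have "\<exists>r :: 'n \<Rightarrow> nat. inj r" using finite_imp_inj_to_nat_seg[of "UNIV :: 'n set"] by auto
  then show ?thesis unfolding index_rank_def by (rule someI_ex)
qed

instantiation wellordered_copy :: (finite) wellorder
begin

definition "i \<le> j \<longleftrightarrow> index_rank (orig i) \<le> index_rank (orig j)" for i j :: "'a wellordered_copy"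
definition "i < j \<longleftrightarrow> index_rank (orig i) < index_rank (orig j)" for i j :: "'a wellordered_copy"

instance
proof
  fix i j k :: "'a wellordered_copy"
  show "i = j" if "i \<le> j" "j \<le> i"
  proof -
    have "index_rank (orig i) = index_rank (orig j)" using that by (simp add: less_eq_wellordered_copy_def)
    then show ?thesis by (rule wellordered_copy.expand[OF injD[OF inj_index_rank]])
  qed
  fix P :: "'a wellordered_copy \<Rightarrow> bool" and a
  assume step: "\<And>i. (\<And>j. j < i \<Longrightarrow> P j) \<Longrightarrow> P i"
  show "P a"
    by (induction a rule: measure_induct_rule[of "\<lambda>i. index_rank (orig i)"])
      (rule step, simp add: less_wellordered_copy_def)
qed (auto simp: less_eq_wellordered_copy_def less_wellordered_copy_def)

end

definition relabel :: "real ^ 'n \<Rightarrow> real ^ 'n wellordered_copy" where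
  "relabel x = (\<chi> i. x $ orig i)"

definition unlabel :: "real ^ 'n wellordered_copy \<Rightarrow> real ^ 'n" where
  "unlabel x = (\<chi> i. x $ Copy i)"

lemma unlabel_relabel [simp]: "unlabel (relabel x) = x"
  and relabel_unlabel [simp]: "relabel (unlabel z) = z"
  by (simp_all add: relabel_def unlabel_def vec_eq_iff)

lemma bounded_linear_relabel: "bounded_linear (relabel :: real ^ 'n::finite \<Rightarrow> _)"
  by (rule linear_conv_bounded_linear[THEN iffD1]) (auto intro!: linearI simp: relabel_def vec_eq_iff)

lemma bounded_linear_unlabel: "bounded_linear (unlabel :: _ \<Rightarrow> real ^ 'n::finite)"
  by (rule linear_conv_bounded_linear[THEN iffD1]) (auto intro!: linearI simp: unlabel_def vec_eq_iff)

lemma unlabel_measurable [measurable]: "(unlabel :: _ \<Rightarrow> real ^ 'n::finite) \<in> borel \<rightarrow>\<^sub>M borel"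
  by (auto intro!: borel_measurable_continuous_onI linear_continuous_on
      bounded_linear_relabel bounded_linear_unlabel)

lemma Basis_vec_real: "(Basis :: (real ^ 'n::finite) set) = (\<lambda>i. axis i 1) ` UNIV"
  by (auto simp: Basis_vec_def)

lemma prod_Basis_vec:
  "(\<Prod>b\<in>Basis. f (b :: real ^ 'n::finite)) = (\<Prod>i\<in>UNIV. f (axis i 1))"
  unfolding Basis_vec_real by (subst prod.reindex) (auto simp: inj_on_def axis_eq_axis)

lemma lborel_vec_eqI:
  fixes M :: "(real ^ 'n::finite) measure"
  assumes "\<And>l u. (\<And>i. l $ i \<le> u $ i) \<Longrightarrow>
      emeasure M {x. \<forall>i. l $ i < x $ i \<and> x $ i < u $ i} = ennreal (\<Prod>i\<in>UNIV. u $ i - l $ i)"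
    and "sets M = sets borel"
  shows "lborel = M"
proof (rule lborel_eqI)
  fix l u :: "real ^ 'n"
  assume "\<And>b. b \<in> Basis \<Longrightarrow> l \<bullet> b \<le> u \<bullet> b"
  then have "l \<bullet> axis i 1 \<le> u \<bullet> axis i 1" for i by (simp add: Basis_vec_real)
  then have "l $ i \<le> u $ i" for i by (simp add: inner_axis)
  moreover have "box l u = {x. \<forall>i. l $ i < x $ i \<and> x $ i < u $ i}"
    by (auto simp: mem_box Basis_vec_real inner_axis)
  ultimately show "emeasure M (box l u) = ennreal (\<Prod>b\<in>Basis. (u - l) \<bullet> b)"
    using assms(1)[of l u] by (simp add: prod_Basis_vec inner_axis)
qed (rule assms(2))

lemma emeasure_lborel_vec_box:
  fixes l u :: "real ^ 'n::finite"
  assumes "\<And>i. l $ i \<le> u $ i"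
  shows "emeasure lborel {x. \<forall>i. l $ i < x $ i \<and> x $ i < u $ i} = ennreal (\<Prod>i\<in>UNIV. u $ i - l $ i)"
proof -
  have "box l u = {x. \<forall>i. l $ i < x $ i \<and> x $ i < u $ i}"
    by (auto simp: mem_box Basis_vec_real inner_axis)
  moreover have "\<forall>b\<in>Basis. l \<bullet> b \<le> u \<bullet> b"
    using assms by (auto simp: Basis_vec_real inner_axis)
  ultimately show ?thesis
    using emeasure_lborel_box[of l u] by (simp add: prod_Basis_vec inner_axis)
qed

lemma open_vec_box: "open {x :: real ^ 'n::finite. \<forall>i. l $ i < x $ i \<and> x $ i < u $ i}"
proof -
  have "box l u = {x. \<forall>i. l $ i < x $ i \<and> x $ i < u $ i}"
    by (auto simp: mem_box Basis_vec_real inner_axis)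
  then show ?thesis using open_box by metis
qed

lemma lborel_relabel: "distr lborel borel (unlabel :: _ \<Rightarrow> real ^ 'n::finite) = lborel"
proof (rule lborel_vec_eqI[symmetric])
  fix l u :: "real ^ 'n" assume lu: "\<And>i. l $ i \<le> u $ i"
  have "unlabel -` {x. \<forall>i. l $ i < x $ i \<and> x $ i < u $ i} =
      {x. \<forall>i. relabel l $ i < x $ i \<and> x $ i < relabel u $ i}"
  proof -
    have "(\<forall>i. l $ i < x $ Copy i \<and> x $ Copy i < u $ i) \<longleftrightarrow>
        (\<forall>i. l $ orig i < x $ i \<and> x $ i < u $ orig i)" for x :: "real ^ 'n wellordered_copy"
    proof (intro iffI allI)
      show "l $ i < x $ Copy i \<and> x $ Copy i < u $ i"
        if "\<forall>i. l $ orig i < x $ i \<and> x $ i < u $ orig i" for i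
        using that[rule_format, of "Copy i"] by simp
      show "l $ orig i < x $ i \<and> x $ i < u $ orig i"
        if "\<forall>i. l $ i < x $ Copy i \<and> x $ Copy i < u $ i" for i
        using that[rule_format, of "orig i"] by simp
    qed
    then show ?thesis by (simp add: unlabel_def relabel_def vimage_def)
  qed
  moreover have "(\<Prod>i\<in>UNIV. relabel u $ i - relabel l $ i) = (\<Prod>i\<in>UNIV. u $ i - l $ i)"
    using prod.reindex_bij_betw[OF bij_orig, of "\<lambda>i. u $ i - l $ i"] by (simp add: relabel_def)
  moreover have "\<And>i. relabel l $ i \<le> relabel u $ i" using lu by (simp add: relabel_def)
  ultimately show "emeasure (distr lborel borel unlabel) {x. \<forall>i. l $ i < x $ i \<and> x $ i < u $ i} =
      ennreal (\<Prod>i\<in>UNIV. u $ i - l $ i)"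
    using emeasure_lborel_vec_box[of "relabel l" "relabel u"] open_vec_box[of l u]
    by (subst emeasure_distr) auto
qed simp

text \<open>
  Conjugation with a bijection of the index types matches the terms of the two Leibniz expansions and
  preserves the signs of the permutations.
\<close>
lemma det_relabel:
  fixes M :: "real ^ 'n::finite ^ 'n"
  shows "det (\<chi> i j. M $ orig i $ orig j) = det M"
proof -
  define m where "m = map_permutation UNIV (orig :: 'n wellordered_copy \<Rightarrow> 'n)"
  have inj: "inj (orig :: 'n wellordered_copy \<Rightarrow> 'n)" using bij_orig by (rule bij_is_inj)
  have bij: "bij_betw m {p. p permutes UNIV} {p. p permutes UNIV}"
  proof (rule bij_betw_byWitness[where f' = "map_permutation UNIV Copy"])
    have b: "bij_betw Copy (UNIV :: 'n set) UNIV" by (rule bij_betw_byWitness[of _ orig]) auto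
    show "\<forall>p\<in>{p. p permutes UNIV}. map_permutation UNIV Copy (m p) = p"
      unfolding m_def by (auto intro!: map_permutation_compose_inv[OF bij_orig])
    show "\<forall>p\<in>{p. p permutes UNIV}. m (map_permutation UNIV Copy p) = p"
      unfolding m_def by (auto intro!: map_permutation_compose_inv[OF b])
    show "m ` {p. p permutes UNIV} \<subseteq> {p. p permutes UNIV}"
      unfolding m_def using map_permutation_permutes[OF bij_orig] by auto
    show "map_permutation UNIV (Copy :: 'n \<Rightarrow> _) ` {p. p permutes UNIV} \<subseteq> {p. p permutes UNIV}"
      using map_permutation_permutes[OF b] by auto
  qed
  have "det M = (\<Sum>p\<in>{p. p permutes UNIV}. of_int (sign (m p)) * (\<Prod>i\<in>UNIV. M $ i $ m p i))"
    unfolding det_def by (rule sum.reindex_bij_betw[OF bij, symmetric])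
  also have "\<dots> = (\<Sum>p\<in>{p. p permutes UNIV}. of_int (sign p) * (\<Prod>i\<in>UNIV. M $ orig i $ orig (p i)))"
  proof (rule sum.cong[OF refl])
    fix p :: "'n wellordered_copy \<Rightarrow> 'n wellordered_copy" assume p: "p \<in> {p. p permutes UNIV}"
    have "m p (orig i) = orig (p i)" for i
      by (simp add: m_def map_permutation_def restrict_id_def inv_f_f[OF inj])
    then have "(\<Prod>i\<in>UNIV. M $ i $ m p i) = (\<Prod>i\<in>UNIV. M $ orig i $ orig (p i))"
      using prod.reindex_bij_betw[OF bij_orig, of "\<lambda>i. M $ i $ m p i"] by simp
    moreover have "sign (m p) = sign p"
      unfolding m_def using p inj by (intro sign_map_permutation) auto
    ultimately show "of_int (sign (m p)) * (\<Prod>i\<in>UNIV. M $ i $ m p i) =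
        of_int (sign p) * (\<Prod>i\<in>UNIV. M $ orig i $ orig (p i))" by simp
  qed
  finally show ?thesis unfolding det_def by simp
qed

text \<open>
  For a nonnegative integrand that is integrable on the image, equality of the absolute integrals is
  the same as equality of the nonnegative extended integrals.
\<close>
lemma nn_integral_change_of_variables_wellorder:
  fixes f :: "real ^ 'm::{finite,wellorder} \<Rightarrow> real" and g :: "real ^ 'm::_ \<Rightarrow> real ^ 'm::_"
  assumes S: "S \<in> sets lebesgue"
    and der: "\<And>x. x \<in> S \<Longrightarrow> (g has_derivative g' x) (at x within S)"
    and inj: "inj_on g S"
    and nonneg: "\<And>y. f y \<ge> 0"
    and int: "set_integrable lebesgue (g ` S) f"
  shows "(\<integral>\<^sup>+x. indicator S x * ennreal (\<bar>det (matrix (g' x))\<bar> * f (g x)) \<partial>lborel) =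
    (\<integral>\<^sup>+y. indicator (g ` S) y * ennreal (f y) \<partial>lborel)"
proof -
  let ?h = "\<lambda>x. \<bar>det (matrix (g' x))\<bar> * f (g x)"
  have "(\<lambda>y. vec (f y) :: real ^ 1) absolutely_integrable_on g ` S"
    using int by (subst absolutely_integrable_on_1_iff) simp
  then have *: "(\<lambda>x. \<bar>det (matrix (g' x))\<bar> *\<^sub>R (vec (f (g x)) :: real ^ 1)) absolutely_integrable_on S"
    "integral S (\<lambda>x. \<bar>det (matrix (g' x))\<bar> *\<^sub>R (vec (f (g x)) :: real ^ 1)) = integral (g ` S) (\<lambda>y. vec (f y))"
    using has_absolute_integral_change_of_variables[OF S der inj, of "\<lambda>y. vec (f y) :: real ^ 1"
        "integral (g ` S) (\<lambda>y. vec (f y))"] by auto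
  have int': "set_integrable lebesgue S ?h"
    using *(1) by (subst (asm) absolutely_integrable_on_1_iff) simp
  have "integral S ?h = integral (g ` S) f"
    using *(2) by (simp add: integral_on_1_eq vec_eq_iff)
  then have eq: "(LINT x:S|lebesgue. ?h x) = (LINT y:g ` S|lebesgue. f y)"
    using set_lebesgue_integral_eq_integral(2)[OF int'] set_lebesgue_integral_eq_integral(2)[OF int] by simp
  have nn: "(\<integral>\<^sup>+x. indicator T x * ennreal (k x) \<partial>lborel) = ennreal (LINT x:T|lebesgue. k x)"
    if "set_integrable lebesgue T k" "\<And>x. k x \<ge> 0" for T and k :: "real ^ 'm::_ \<Rightarrow> real"
  proof -
    have "(\<integral>\<^sup>+x. indicator T x * ennreal (k x) \<partial>lborel) = (\<integral>\<^sup>+x. ennreal (indicator T x *\<^sub>R k x) \<partial>lebesgue)"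
      unfolding nn_integral_completion by (auto intro!: nn_integral_cong simp: indicator_def)
    also have "\<dots> = ennreal (LINT x:T|lebesgue. k x)"
      using that unfolding set_integrable_def set_lebesgue_integral_def
      by (intro nn_integral_eq_integral) auto
    finally show ?thesis .
  qed
  show ?thesis using nn[OF int] nn[OF int'] nonneg eq by simp
qed

text \<open>
  The relabelling of the coordinates preserves Lebesgue measure, and Jacobian determinants as well.
\<close>
lemma nn_integral_change_of_variables:
  fixes f :: "real ^ 'n::finite \<Rightarrow> real" and g :: "real ^ 'n \<Rightarrow> real ^ 'n"
  assumes S: "S \<in> sets borel"
    and der: "\<And>x. x \<in> S \<Longrightarrow> (g has_derivative g' x) (at x)"
    and inj: "inj_on g S"
    and nonneg: "\<And>y. f y \<ge> 0"
    and gS: "g ` S \<in> sets borel"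
    and f [measurable]: "f \<in> borel_measurable borel"
    and int: "integrable lborel (\<lambda>y. indicator (g ` S) y * f y)"
    and meas: "(\<lambda>x. indicator S x * ennreal (\<bar>det (matrix (g' x))\<bar> * f (g x))) \<in> borel_measurable borel"
  shows "(\<integral>\<^sup>+x. indicator S x * ennreal (\<bar>det (matrix (g' x))\<bar> * f (g x)) \<partial>lborel) =
    (\<integral>\<^sup>+y. indicator (g ` S) y * ennreal (f y) \<partial>lborel)"
proof -
  define G where "G = relabel \<circ> g \<circ> unlabel"
  define G' where "G' = (\<lambda>z. relabel \<circ> g' (unlabel z) \<circ> unlabel)"
  define T where "T = unlabel -` S"
  have GT: "G ` T = unlabel -` (g ` S)"
  proof -
    have "z \<in> G ` T" if "unlabel z = g s" "s \<in> S" for z s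
    proof (rule image_eqI)
      show "z = G (relabel s)" using that(1) relabel_unlabel[of z] by (simp add: G_def)
      show "relabel s \<in> T" using that(2) by (simp add: T_def)
    qed
    then show ?thesis by (auto simp: G_def T_def)
  qed
  have "T \<in> sets borel"
    unfolding T_def using measurable_sets[OF unlabel_measurable S] by simp
  then have T: "T \<in> sets lebesgue" by simp
  have der': "(G has_derivative G' z) (at z within T)" if "z \<in> T" for z
  proof -
    have "(g has_derivative g' (unlabel z)) (at (unlabel z))" using that der by (simp add: T_def)
    from bounded_linear.has_derivative[OF bounded_linear_relabel
        has_derivative_compose[OF bounded_linear_imp_has_derivative[OF bounded_linear_unlabel] this]]
    have "(G has_derivative G' z) (at z)" by (simp add: G_def G'_def comp_def)
    then show ?thesis by (rule has_derivative_at_withinI)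
  qed
  have inj': "inj_on G T"
  proof (rule inj_onI)
    fix w z assume wz: "w \<in> T" "z \<in> T" "G w = G z"
    have "g (unlabel w) = g (unlabel z)"
      using arg_cong[OF wz(3), of unlabel] by (simp add: G_def)
    then have "unlabel w = unlabel z" using inj wz(1,2) by (auto simp: T_def inj_on_def)
    from arg_cong[OF this, of relabel] show "w = z" by simp
  qed
  have matrix: "det (matrix (G' z)) = det (matrix (g' (unlabel z)))" for z
  proof -
    have "unlabel (axis j 1) = axis (orig j) 1" for j :: "'n wellordered_copy"
      by (auto simp: unlabel_def axis_def vec_eq_iff)
    then have "matrix (G' z) = (\<chi> i j. matrix (g' (unlabel z)) $ orig i $ orig j)"
      by (simp add: matrix_def G'_def relabel_def)
    then show ?thesis using det_relabel by metis
  qed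
  have int_distr: "(\<integral>\<^sup>+x. k x \<partial>lborel) = (\<integral>\<^sup>+z. k (unlabel z) \<partial>lborel)"
    if "k \<in> borel_measurable borel" for k :: "real ^ 'n \<Rightarrow> ennreal"
    using nn_integral_distr[of unlabel lborel borel k] that by (simp add: lborel_relabel)
  have "integrable lborel (\<lambda>z. indicator (g ` S) (unlabel z) * f (unlabel z))"
    using integrable_distr_eq[of unlabel lborel borel "\<lambda>y. indicator (g ` S) y * f y"] int
    by (simp add: lborel_relabel)
  moreover have "(\<lambda>z. indicator (g ` S) (unlabel z) * f (unlabel z)) =
      (\<lambda>z. indicator (G ` T) z *\<^sub>R f (unlabel z))"
    by (simp add: GT fun_eq_iff indicator_def)
  ultimately have "set_integrable lebesgue (G ` T) (\<lambda>z. f (unlabel z))"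
    unfolding set_integrable_def
    using integrable_completion[of "\<lambda>z. indicator (G ` T) z *\<^sub>R f (unlabel z)" lborel]
    by (simp add: borel_measurable_integrable)
  then have *: "(\<integral>\<^sup>+z. indicator T z * ennreal (\<bar>det (matrix (G' z))\<bar> * f (unlabel (G z))) \<partial>lborel) =
    (\<integral>\<^sup>+z. indicator (G ` T) z * ennreal (f (unlabel z)) \<partial>lborel)"
    using nn_integral_change_of_variables_wellorder[where f = "\<lambda>z. f (unlabel z)", OF T der' inj'] nonneg by simp
  have "(\<integral>\<^sup>+x. indicator S x * ennreal (\<bar>det (matrix (g' x))\<bar> * f (g x)) \<partial>lborel) =
    (\<integral>\<^sup>+z. indicator T z * ennreal (\<bar>det (matrix (G' z))\<bar> * f (unlabel (G z))) \<partial>lborel)"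
    unfolding int_distr[OF meas] by (simp add: matrix T_def G_def indicator_def)
  also note *
  also have "(\<integral>\<^sup>+z. indicator (G ` T) z * ennreal (f (unlabel z)) \<partial>lborel) =
    (\<integral>\<^sup>+y. indicator (g ` S) y * ennreal (f y) \<partial>lborel)"
  proof -
    have m: "(\<lambda>y. indicator (g ` S) y * ennreal (f y)) \<in> borel_measurable borel"
      using gS by measurable
    show ?thesis unfolding int_distr[OF m] by (simp add: GT indicator_def)
  qed
  finally show ?thesis .
qed

section \<open>Fubini for hyperplanes and the cone measure\<close>

interpretation lborel_product: product_sigma_finite "\<lambda>_::'i. lborel :: real measure"
  by standard

lemma measurable_vec [measurable (raw)]:
  assumes "\<And>i. (\<lambda>x. f x i) \<in> borel_measurable M"
  shows "(\<lambda>x. (\<chi> i. f x i) :: real ^ 'n::finite) \<in> borel_measurable M"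
  using assms by (subst borel_measurable_euclidean_space) (auto simp: Basis_vec_real inner_axis)

lemma lborel_eq_distr_PiM: "distr (PiM UNIV (\<lambda>_. lborel)) borel (\<lambda>f. \<chi> i. f i) = (lborel :: (real ^ 'n::finite) measure)"
proof (rule lborel_vec_eqI[symmetric])
  fix l u :: "real ^ 'n" assume lu: "\<And>i. l $ i \<le> u $ i"
  have "(\<lambda>f. \<chi> i. f i) -` {x. \<forall>i. l $ i < x $ i \<and> x $ i < u $ i} \<inter> space (PiM UNIV (\<lambda>_. lborel)) =
      PiE UNIV (\<lambda>i. {l $ i <..< u $ i})"
    by (auto simp: space_PiM)
  moreover have "emeasure (PiM UNIV (\<lambda>_. lborel)) (PiE UNIV (\<lambda>i. {l $ i <..< u $ i})) =
      (\<Prod>i\<in>UNIV. ennreal (u $ i - l $ i))"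
    using lu by (subst lborel_product.emeasure_PiM) auto
  ultimately show "emeasure (distr (PiM UNIV (\<lambda>_. lborel)) borel (\<lambda>f. \<chi> i. f i)) {x. \<forall>i. l $ i < x $ i \<and> x $ i < u $ i} =
      ennreal (\<Prod>i\<in>UNIV. u $ i - l $ i)"
    using open_vec_box[of l u] lu
    by (subst emeasure_distr) (auto simp: prod_ennreal)
qed simp

definition set_coord :: "'n \<Rightarrow> real \<Rightarrow> real ^ 'n \<Rightarrow> real ^ 'n" where
  "set_coord i0 r u = (\<chi> j. if j = i0 then r else u $ j)"

lemma set_coord_nth: "set_coord i0 r u $ j = (if j = i0 then r else u $ j)"
  by (simp add: set_coord_def)

lemma set_coord_measurable [measurable (raw)]:
  assumes [measurable]: "f \<in> borel_measurable M" "g \<in> borel_measurable M"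
  shows "(\<lambda>x. set_coord i0 (f x) (g x)) \<in> borel_measurable M"
proof -
  have "(\<lambda>x. g x $ j) \<in> borel_measurable M" for j
    using assms(2) by (rule measurable_compose)
      (auto intro!: borel_measurable_continuous_onI continuous_intros)
  then have "(\<lambda>x. if j = i0 then f x else g x $ j) \<in> borel_measurable M" for j
    by (cases "j = i0") simp_all
  then show ?thesis unfolding set_coord_def by (rule measurable_vec)
qed

text \<open>
  Both measures are images of product measures, so this is Fubini for splitting one factor off the
  product.
\<close>
lemma nn_integral_hyperplane:
  fixes f :: "real ^ 'n::finite \<Rightarrow> ennreal"
  assumes [measurable]: "f \<in> borel_measurable borel"
  shows "(\<integral>\<^sup>+x. f x \<partial>lborel) = (\<integral>\<^sup>+u. (\<integral>\<^sup>+r. f (set_coord i0 r u) \<partial>lborel) \<partial>hyperplane_measure i0)"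
proof -
  have ins: "insert i0 (UNIV - {i0}) = (UNIV :: 'n set)" by auto
  have m: "(\<lambda>h. if j = i0 then 0 else h j) \<in> borel_measurable (PiM (UNIV - {i0}) (\<lambda>_. lborel))" for j
    by (cases "j = i0") auto
  have [measurable]: "(\<lambda>h. (\<chi> j. if j = i0 then 0 else h j) :: real ^ 'n)
      \<in> PiM (UNIV - {i0}) (\<lambda>_. lborel) \<rightarrow>\<^sub>M borel"
    by (intro measurable_vec m)
  have [measurable]: "(\<lambda>h. (\<chi> j. h j) :: real ^ 'n) \<in> PiM UNIV (\<lambda>_. lborel) \<rightarrow>\<^sub>M borel"
    by (intro measurable_vec) simp
  have "(\<integral>\<^sup>+x. f x \<partial>lborel) = (\<integral>\<^sup>+h. f (\<chi> j. h j) \<partial>PiM UNIV (\<lambda>_. lborel))"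
    unfolding lborel_eq_distr_PiM[symmetric] by (subst nn_integral_distr) auto
  also have "\<dots> = (\<integral>\<^sup>+h. (\<integral>\<^sup>+r. f (\<chi> j. (h(i0 := r)) j) \<partial>lborel) \<partial>PiM (UNIV - {i0}) (\<lambda>_. lborel))"
    using lborel_product.product_nn_integral_insert[of "UNIV - {i0}" i0 "\<lambda>h. f (\<chi> j. h j)"]
    unfolding ins by simp
  also have "\<dots> = (\<integral>\<^sup>+h. (\<integral>\<^sup>+r. f (set_coord i0 r (\<chi> j. if j = i0 then 0 else h j)) \<partial>lborel) \<partial>PiM (UNIV - {i0}) (\<lambda>_. lborel))"
    by (auto intro!: nn_integral_cong arg_cong[of _ _ f] simp: vec_eq_iff set_coord_def)
  also have "\<dots> = (\<integral>\<^sup>+u. (\<integral>\<^sup>+r. f (set_coord i0 r u) \<partial>lborel) \<partial>hyperplane_measure i0)"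
    unfolding hyperplane_measure_def by (subst nn_integral_distr) (auto intro!: lborel.borel_measurable_nn_integral)
  finally show ?thesis .
qed

lemma AE_hyperplane_measure: "AE u in hyperplane_measure i0. (u :: real ^ 'n::finite) $ i0 = 0"
proof -
  have m: "(\<lambda>h. if j = i0 then 0 else h j) \<in> borel_measurable (PiM (UNIV - {i0}) (\<lambda>_. lborel))" for j
    by (cases "j = i0") auto
  have "(\<lambda>h. (\<chi> j. if j = i0 then 0 else h j) :: real ^ 'n)
      \<in> PiM (UNIV - {i0}) (\<lambda>_. lborel) \<rightarrow>\<^sub>M borel"
    by (intro measurable_vec m)
  then show ?thesis unfolding hyperplane_measure_def by (subst AE_distr_iff) auto
qed

text \<open>
  A ray \<open>r \<mapsto> r y\<close> with \<open>|y| = \<rho>\<close> meets the annulus in a segment whose logarithmic length is \<open>1\<close>,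
  whatever \<open>\<rho>\<close> is.
\<close>
lemma nn_integral_inverse_annulus:
  fixes \<rho> :: real
  assumes "\<rho> > 0"
  shows "(\<integral>\<^sup>+r. indicator {r. 0 < r \<and> 1 \<le> r * \<rho> \<and> r * \<rho> \<le> exp 1} r * ennreal (1 / r) \<partial>lborel) = 1"
proof -
  have "(\<integral>\<^sup>+r. indicator {r. 0 < r \<and> 1 \<le> r * \<rho> \<and> r * \<rho> \<le> exp 1} r * ennreal (1 / r) \<partial>lborel) =
      (\<integral>\<^sup>+r. ennreal (1 / r) * indicator {1 / \<rho> .. exp 1 / \<rho>} r \<partial>lborel)"
  proof (intro nn_integral_cong)
    fix r :: real
    have "0 < r \<and> 1 \<le> r * \<rho> \<and> r * \<rho> \<le> exp 1 \<longleftrightarrow> r \<in> {1 / \<rho> .. exp 1 / \<rho>}"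
    proof -
      have "r > 0" if "1 / \<rho> \<le> r" using that assms less_le_trans[of 0 "1 / \<rho>" r] by simp
      then show ?thesis using assms by (auto simp: pos_divide_le_eq pos_le_divide_eq)
    qed
    then show "indicator {r. 0 < r \<and> 1 \<le> r * \<rho> \<and> r * \<rho> \<le> exp 1} r * ennreal (1 / r) =
        ennreal (1 / r) * indicator {1 / \<rho> .. exp 1 / \<rho>} r"
      by (simp add: indicator_def mult.commute)
  qed
  also have "\<dots> = ennreal (ln (exp 1 / \<rho>) - ln (1 / \<rho>))"
  proof (rule nn_integral_FTC_Icc)
    fix r :: real assume "r \<in> {1 / \<rho> .. exp 1 / \<rho>}"
    then have "r > 0" using assms by (auto intro: less_le_trans[of 0 "1 / \<rho>"])
    then show "DERIV ln r :> 1 / r" "0 \<le> 1 / r" by (auto intro!: derivative_eq_intros)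
  qed (use assms in \<open>auto simp: divide_right_mono\<close>)
  also have "ln (exp 1 / \<rho>) - ln (1 / \<rho>) = 1" using assms by (simp add: ln_div)
  finally show ?thesis by simp
qed

text \<open>
  The outer radius \<open>e\<close> makes the logarithmic length of each radial segment equal to \<open>1\<close>; any other
  annulus would only introduce a constant factor.
\<close>
definition annulus :: "(real ^ 'n::finite) set" where
  "annulus = {y. 1 \<le> norm y \<and> norm y \<le> exp 1}"

lemma compact_annulus: "compact (annulus :: (real ^ 'n::finite) set)"
proof -
  have "annulus = cball 0 (exp 1) - ball (0 :: real ^ 'n) 1" by (auto simp: annulus_def)
  then show ?thesis using compact_diff[OF compact_cball open_ball, of 0 "exp 1" "0 :: real ^ 'n" 1] by simp
qed

lemma zero_notin_annulus [simp]: "(0 :: real ^ 'n::finite) \<notin> annulus" by (simp add: annulus_def)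

lemma measurable_off_zero:
  fixes f :: "real ^ 'n::finite \<Rightarrow> 'b::topological_space"
  assumes "continuous_on (- {0}) f" shows "f \<in> borel_measurable borel"
  using borel_measurable_continuous_countable_exceptions[of "{0}" f] assms by simp

text \<open>
  The data of a Finsler metric in one tangent space: \<open>N\<close> is the Finsler norm, and \<open>q\<close> is the square root of the
  determinant of the fundamental tensor.
\<close>
locale cone_data =
  fixes N q :: "real ^ 'n::finite \<Rightarrow> real"
  assumes cont_N: "continuous_on (- {0}) N" and N_pos: "y \<noteq> 0 \<Longrightarrow> N y > 0"
    and N_scale: "r > 0 \<Longrightarrow> y \<noteq> 0 \<Longrightarrow> N (r *\<^sub>R y) = r * N y"
    and cont_q: "continuous_on (- {0}) q" and q_pos: "y \<noteq> 0 \<Longrightarrow> q y > 0"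
    and q_scale: "r > 0 \<Longrightarrow> y \<noteq> 0 \<Longrightarrow> q (r *\<^sub>R y) = q y"
begin

text \<open>
  The exponent is the dimension, so that in polar coordinates the power \<open>r\<^sup>n\<^sup>-\<^sup>1\<close> of the Jacobian leaves
  exactly \<open>dr/r\<close>.
\<close>
definition cone_weight :: "real ^ 'n \<Rightarrow> real" where
  "cone_weight y = indicator annulus y * (q y / N y ^ CARD('n))"

definition radial_proj :: "real ^ 'n \<Rightarrow> real ^ 'n" where "radial_proj y = y /\<^sub>R N y"

definition cone_measure :: "(real ^ 'n) measure" where
  "cone_measure = distr (density lborel (\<lambda>y. ennreal (cone_weight y))) borel radial_proj"

definition unit_sphere :: "(real ^ 'n) set" where "unit_sphere = {y. y \<noteq> 0 \<and> N y = 1}"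

lemma N_measurable [measurable]: "N \<in> borel_measurable borel"
  and q_measurable [measurable]: "q \<in> borel_measurable borel"
  using measurable_off_zero cont_N cont_q by blast+

lemma annulus_measurable [measurable]: "annulus \<in> sets borel"
  by (intro borel_closed compact_imp_closed compact_annulus)

lemma cone_weight_measurable [measurable]: "cone_weight \<in> borel_measurable borel"
  unfolding cone_weight_def by measurable

lemma radial_proj_measurable [measurable]: "radial_proj \<in> borel_measurable borel"
  unfolding radial_proj_def by measurable

lemma cone_weight_nonneg: "cone_weight y \<ge> 0"
  using N_pos[of y] q_pos[of y] zero_notin_annulus unfolding cone_weight_def
  by (cases "y = 0") (auto simp: less_imp_le)

lemma cone_weight_integrable: "integrable lborel cone_weight"
proof -
  have "continuous_on annulus (\<lambda>y. q y / N y ^ CARD('n))"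
    using N_pos zero_notin_annulus
  proof (intro continuous_intros continuous_on_subset[OF cont_N] continuous_on_subset[OF cont_q])
    show "\<forall>y\<in>annulus. N y ^ CARD('n) \<noteq> 0"
    proof
      fix y :: "real ^ 'n" assume "y \<in> annulus"
      then have "N y > 0" using N_pos[of y] zero_notin_annulus by metis
      then show "N y ^ CARD('n) \<noteq> 0" by simp
    qed
  qed (use zero_notin_annulus in blast)+
  from borel_integrable_compact[OF compact_annulus this] show ?thesis
    by (simp add: cone_weight_def[abs_def])
qed

lemma radial_proj_unit_sphere: "y \<noteq> 0 \<Longrightarrow> radial_proj y \<in> unit_sphere"
  using N_pos[of y] N_scale[of "inverse (N y)" y] by (auto simp: radial_proj_def unit_sphere_def)

lemma emeasure_cone_measure:
  assumes [measurable]: "B \<in> sets borel"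
  shows "emeasure cone_measure B = (\<integral>\<^sup>+y. indicator {y. y \<noteq> 0 \<and> radial_proj y \<in> B} y * ennreal (cone_weight y) \<partial>lborel)"
proof -
  have "emeasure cone_measure B = (\<integral>\<^sup>+y. ennreal (cone_weight y) * indicator (radial_proj -` B) y \<partial>lborel)"
    unfolding cone_measure_def by (subst emeasure_distr, simp, simp, subst emeasure_density) (use measurable_sets_borel[OF radial_proj_measurable assms] in auto)
  also have "\<dots> = (\<integral>\<^sup>+y. indicator {y. y \<noteq> 0 \<and> radial_proj y \<in> B} y * ennreal (cone_weight y) \<partial>lborel)"
    by (intro nn_integral_cong) (auto simp: indicator_def cone_weight_def)
  finally show ?thesis .
qed

lemma cone_measure_off_unit_sphere: "emeasure cone_measure (- unit_sphere) = 0"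
proof -
  have [measurable]: "unit_sphere \<in> sets borel" unfolding unit_sphere_def by measurable
  have "{y. y \<noteq> 0 \<and> radial_proj y \<in> - unit_sphere} = {}" using radial_proj_unit_sphere by auto
  then show ?thesis using emeasure_cone_measure[of "- unit_sphere"] by simp
qed

text \<open>
  In the polar coordinates \<open>(r, u) \<mapsto> r \<phi>(u)\<close>, the radius being stored in the coordinate \<open>i0\<close> which \<open>u\<close>
  does not use, the Jacobian is \<open>r\<^sup>n\<^sup>-\<^sup>1\<close> times the determinant in the pulled back volume form.  With the
  weight of degree \<open>-n\<close> the integrand becomes the density of the patch times \<open>dr/r\<close>, and the integral over
  the radius is \<open>1\<close>.
\<close>
lemma cone_measure_patch:
  assumes patch: "hypersurface_patch unit_sphere i0 U \<phi>"
    and S [measurable]: "S \<in> sets borel" and SU: "S \<subseteq> \<phi> ` {u\<in>U. u $ i0 = 0}"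
  shows "emeasure cone_measure S =
    (\<integral>\<^sup>+u. indicator {u\<in>U. \<phi> u \<in> S} u *
      ennreal (q (\<phi> u) * \<bar>det (\<chi> j. if j = i0 then \<phi> u else frechet_derivative \<phi> (at u) (axis j 1))\<bar>)
      \<partial>hyperplane_measure i0)"
proof -
  let ?D = "\<lambda>u. det (\<chi> j. if j = i0 then \<phi> u else frechet_derivative \<phi> (at u) (axis j 1))"
  have U: "open U" and smooth: "smooth_on U \<phi>" and inj: "inj_on \<phi> {u\<in>U. u $ i0 = 0}"
    and ind: "\<And>u. u \<in> U \<Longrightarrow> u $ i0 = 0 \<Longrightarrow> \<phi> u \<in> unit_sphere"
    using patch by (auto simp: hypersurface_patch_def)
  have ck: "ck_on (Suc 0) U \<phi>" using smooth by (simp add: smooth_on_def)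
  have diff: "(\<phi> has_derivative frechet_derivative \<phi> (at u)) (at u)" if "u \<in> U" for u
    using ck that by (simp add: frechet_derivative_works[symmetric])
  have contd: "continuous_on U (\<lambda>u. frechet_derivative \<phi> (at u) v)" for v using ck by simp
  have cont: "continuous_on U \<phi>" using smooth unfolding smooth_on_def by (metis ck_on.simps(1))
  \<comment> \<open>\<open>P\<close> forgets the radius, \<open>g\<close> is the polar coordinate map on the cone \<open>V\<close> over \<open>S\<close>, and \<open>g'\<close> is its
    derivative.\<close>
  define P where "P = set_coord i0 0"
  have P_lin: "bounded_linear P"
    unfolding P_def by (rule linear_conv_bounded_linear[THEN iffD1])
      (auto intro!: linearI simp: set_coord_def vec_eq_iff)
  have [measurable]: "P \<in> borel_measurable borel"
    by (intro borel_measurable_continuous_onI linear_continuous_on P_lin)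
  have P0 [simp]: "P v $ i0 = 0" for v by (simp add: P_def set_coord_nth)
  have P_eq: "P v = v - v $ i0 *\<^sub>R axis i0 1" for v
    by (simp add: P_def set_coord_def vec_eq_iff axis_def)
  define V where "V = {v. v $ i0 > 0 \<and> P v \<in> U \<and> \<phi> (P v) \<in> S}"
  define g where "g = (\<lambda>v. v $ i0 *\<^sub>R \<phi> (P v))"
  define g' where "g' = (\<lambda>v h. v $ i0 *\<^sub>R frechet_derivative \<phi> (at (P v)) (P h) + h $ i0 *\<^sub>R \<phi> (P v))"
  have ind': "\<phi> (P v) \<noteq> 0" "N (\<phi> (P v)) = 1" if "v \<in> V" for v
    using ind[of "P v"] that by (auto simp: V_def unit_sphere_def)
  have Ng: "N (g v) = v $ i0" and g0: "g v \<noteq> 0" and qg: "q (g v) = q (\<phi> (P v))"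
    and projg: "radial_proj (g v) = \<phi> (P v)" if "v \<in> V" for v
    using that ind'[OF that] N_scale[of "v $ i0" "\<phi> (P v)"] q_scale[of "v $ i0" "\<phi> (P v)"]
    by (auto simp: V_def g_def radial_proj_def)
  have der: "(g has_derivative g' v) (at v)" if "v \<in> V" for v
  proof -
    have "((\<lambda>v. \<phi> (P v)) has_derivative (\<lambda>h. frechet_derivative \<phi> (at (P v)) (P h))) (at v)"
      using that by (intro has_derivative_compose[OF bounded_linear_imp_has_derivative[OF P_lin] diff]) (simp add: V_def)
    then show ?thesis unfolding g_def g'_def
      by (intro has_derivative_scaleR bounded_linear_imp_has_derivative bounded_linear_vec_nth)
  qed
  have inj_g: "inj_on g V"
  proof (rule inj_onI)
    fix v w assume vw: "v \<in> V" "w \<in> V" "g v = g w"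
    then have i: "v $ i0 = w $ i0" and "\<phi> (P v) = \<phi> (P w)" using Ng projg by metis+
    then have "P v = P w" using inj vw by (auto simp: inj_on_def V_def)
    then show "v = w" using i unfolding P_eq by simp
  qed
  have gV: "g ` V = {y. y \<noteq> 0 \<and> radial_proj y \<in> S}"
  proof (intro equalityI subsetI)
    fix y assume y: "y \<in> {y. y \<noteq> 0 \<and> radial_proj y \<in> S}"
    then obtain u where u: "u \<in> U" "u $ i0 = 0" "radial_proj y = \<phi> u" using SU by auto
    define v where "v = set_coord i0 (N y) u"
    have "P v = u" using u(2) by (simp add: v_def P_def set_coord_def vec_eq_iff)
    moreover have "v $ i0 = N y" by (simp add: v_def set_coord_nth)
    moreover have "y = N y *\<^sub>R \<phi> u" using N_pos[of y] y by (simp add: u(3)[symmetric] radial_proj_def)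
    ultimately show "y \<in> g ` V"
      using u y N_pos[of y] by (intro image_eqI[of _ _ v]) (auto simp: g_def V_def)
  qed (use g0 projg in \<open>auto simp: V_def\<close>)
  \<comment> \<open>\<open>\<phi>\<close> is controlled on \<open>U\<close> only; cutting it off there makes it Borel measurable.\<close>
  define \<phi>0 where "\<phi>0 = (\<lambda>u. indicator U u *\<^sub>R \<phi> u)"
  have \<phi>0 [measurable]: "\<phi>0 \<in> borel_measurable borel"
    unfolding \<phi>0_def using U cont by (intro borel_measurable_continuous_on_indicator) auto
  have [measurable]: "U \<in> sets borel" using U by simp
  have V_eq: "V = {v. v $ i0 > 0 \<and> P v \<in> U \<and> \<phi>0 (P v) \<in> S}"
    by (auto simp: V_def \<phi>0_def)
  have V [measurable]: "V \<in> sets borel"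
    unfolding V_eq by measurable
  have "continuous_on U ?D"
  proof -
    have "continuous_on U (\<lambda>u. (\<chi> j. if j = i0 then \<phi> u else frechet_derivative \<phi> (at u) (axis j 1)) $ i $ j)" for i j
      using cont contd by (cases "i = i0") (auto intro!: continuous_intros)
    then have "continuous_on U (\<lambda>u. \<Sum>p | p permutes UNIV. of_int (sign p) * (\<Prod>i\<in>UNIV.
        (\<chi> j. if j = i0 then \<phi> u else frechet_derivative \<phi> (at u) (axis j 1)) $ i $ p i))"
      by (intro continuous_on_sum continuous_on_mult continuous_on_const continuous_on_prod)
    then show ?thesis unfolding det_def .
  qed
  then have D0 [measurable]: "(\<lambda>u. indicator U u *\<^sub>R ?D u) \<in> borel_measurable borel"
    using U by (intro borel_measurable_continuous_on_indicator) auto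
  have det: "\<bar>det (matrix (g' v))\<bar> = (v $ i0) ^ (CARD('n) - 1) * \<bar>?D (P v)\<bar>" if "v \<in> V" for v
  proof -
    have lin: "linear (frechet_derivative \<phi> (at (P v)))"
      using diff[of "P v"] that by (auto simp: V_def dest: has_derivative_linear)
    have "transpose (matrix (g' v)) = (\<chi> j. (if j = i0 then 1 else v $ i0) *s
        (if j = i0 then \<phi> (P v) else frechet_derivative \<phi> (at (P v)) (axis j 1)))"
    proof -
      have "P (axis j 1) = (if j = i0 then 0 else axis j 1)" for j
        by (simp add: P_def set_coord_def vec_eq_iff axis_def)
      moreover have axis_i0: "(axis j 1 :: real ^ 'n) $ i0 = (if j = i0 then 1 else 0)" for j
        by (simp add: axis_def)
      ultimately have "g' v (axis j 1) = (if j = i0 then 1 else v $ i0) *s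
          (if j = i0 then \<phi> (P v) else frechet_derivative \<phi> (at (P v)) (axis j 1))" for j
        using linear_0[OF lin] axis_i0[of j]
        by (simp add: g'_def scalar_mult_eq_scaleR)
      then show ?thesis by (simp add: matrix_def transpose_def vec_eq_iff)
    qed
    then have "det (matrix (g' v)) = (\<Prod>j\<in>UNIV. if j = i0 then 1 else v $ i0) * ?D (P v)"
      by (subst det_transpose[symmetric]) (simp add: det_rows_mul)
    moreover have "(\<Prod>j\<in>UNIV. if j = i0 then 1 else v $ i0) = (v $ i0) ^ (CARD('n) - 1)"
      by (simp add: prod.remove[of _ i0] prod.If_cases card_Diff_singleton)
    ultimately show ?thesis using that by (simp add: abs_mult V_def)
  qed
  \<comment> \<open>The integrand after the substitution: the factor \<open>1 / r\<close> is all that remains of the powers of the radius.\<close>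
  define K where "K = (\<lambda>v. indicator V v * ennreal (q (\<phi>0 (P v)) * \<bar>indicator U (P v) *\<^sub>R ?D (P v)\<bar>
      * (indicator annulus (v $ i0 *\<^sub>R \<phi>0 (P v)) / v $ i0)))"
  have K_meas [measurable]: "K \<in> borel_measurable borel"
    unfolding K_def using measurable_compose[OF _ D0, of P] by measurable
  have K: "indicator V v * ennreal (\<bar>det (matrix (g' v))\<bar> * cone_weight (g v)) = K v" for v
  proof (cases "v \<in> V")
    case True
    then have pos: "v $ i0 > 0" and PU: "P v \<in> U" by (auto simp: V_def)
    have "CARD('n) = Suc (CARD('n) - 1)" by simp
    then have "(v $ i0) ^ CARD('n) = v $ i0 * (v $ i0) ^ (CARD('n) - 1)" by (metis power_Suc)
    then have "cone_weight (g v) = indicator annulus (g v) * (q (\<phi> (P v)) / (v $ i0 * (v $ i0) ^ (CARD('n) - 1)))"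
      using True by (simp add: cone_weight_def Ng qg)
    moreover have "(v $ i0) ^ (CARD('n) - 1) > 0" using pos by simp
    ultimately have "\<bar>det (matrix (g' v))\<bar> * cone_weight (g v) =
        q (\<phi> (P v)) * \<bar>?D (P v)\<bar> * (indicator annulus (g v) / v $ i0)"
      unfolding det[OF True] using pos by (simp add: field_simps)
    then show ?thesis using True PU by (simp add: K_def \<phi>0_def g_def)
  qed (simp add: K_def)
  have "emeasure cone_measure S = (\<integral>\<^sup>+y. indicator (g ` V) y * ennreal (cone_weight y) \<partial>lborel)"
    unfolding gV by (rule emeasure_cone_measure) fact
  also have "\<dots> = (\<integral>\<^sup>+v. indicator V v * ennreal (\<bar>det (matrix (g' v))\<bar> * cone_weight (g v)) \<partial>lborel)"
  proof (rule nn_integral_change_of_variables[symmetric, OF V der inj_g cone_weight_nonneg])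
    show gVm: "g ` V \<in> sets borel" unfolding gV by measurable
    show "integrable lborel (\<lambda>y. indicator (g ` V) y * cone_weight y)"
      using integrable_mult_indicator[OF _ cone_weight_integrable, of "g ` V"] gVm by simp
  qed (auto simp: K)
  also have "\<dots> = (\<integral>\<^sup>+u. (\<integral>\<^sup>+r. K (set_coord i0 r u) \<partial>lborel) \<partial>hyperplane_measure i0)"
    unfolding K by (rule nn_integral_hyperplane) fact
  also have "\<dots> = (\<integral>\<^sup>+u. indicator {u\<in>U. \<phi> u \<in> S} u * ennreal (q (\<phi> u) * \<bar>?D u\<bar>) \<partial>hyperplane_measure i0)"
  proof (rule nn_integral_cong_AE, rule AE_mp[OF AE_hyperplane_measure[of i0]], rule AE_I2, rule impI)
    fix u :: "real ^ 'n" assume u0: "u $ i0 = 0"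
    have Pu: "P (set_coord i0 r u) = u" for r
      using u0 by (simp add: P_def set_coord_def vec_eq_iff)
    show "(\<integral>\<^sup>+r. K (set_coord i0 r u) \<partial>lborel) =
        indicator {u\<in>U. \<phi> u \<in> S} u * ennreal (q (\<phi> u) * \<bar>?D u\<bar>)"
    proof (cases "u \<in> U \<and> \<phi> u \<in> S")
      case True
      then have \<phi>u: "\<phi> u \<noteq> 0" using ind u0 by (auto simp: unit_sphere_def)
      have c0: "q (\<phi> u) * \<bar>?D u\<bar> \<ge> 0" using q_pos[OF \<phi>u] by simp
      have "K (set_coord i0 r u) = ennreal (q (\<phi> u) * \<bar>?D u\<bar>) *
          (indicator {r. 0 < r \<and> 1 \<le> r * norm (\<phi> u) \<and> r * norm (\<phi> u) \<le> exp 1} r * ennreal (1 / r))" for r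
        unfolding K_def Pu using True c0
        by (auto simp: Pu set_coord_nth V_def \<phi>0_def annulus_def indicator_def ennreal_mult[symmetric])
      then have "(\<integral>\<^sup>+r. K (set_coord i0 r u) \<partial>lborel) = ennreal (q (\<phi> u) * \<bar>?D u\<bar>) *
          (\<integral>\<^sup>+r. indicator {r. 0 < r \<and> 1 \<le> r * norm (\<phi> u) \<and> r * norm (\<phi> u) \<le> exp 1} r * ennreal (1 / r) \<partial>lborel)"
        by (simp add: nn_integral_cmult)
      then show ?thesis using True nn_integral_inverse_annulus[of "norm (\<phi> u)"] \<phi>u by simp
    next
      case False
      then have "K (set_coord i0 r u) = 0" for r by (auto simp: K_def V_def Pu)
      then show ?thesis using False by simp
    qed
  qed
  finally show ?thesis .
qed

end

section \<open>The volume of the indicatrix is a cone measure\<close>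

text \<open>
  Make the cover disjoint and add up.
\<close>
lemma measure_eq_on_countable_cover:
  assumes sets: "sets \<mu> = sets M" "sets \<nu> = sets M"
    and cover: "countable \<C>" "\<C> \<subseteq> sets M" "space M \<subseteq> \<Union>\<C>"
    and eq: "\<And>C S. C \<in> \<C> \<Longrightarrow> S \<in> sets M \<Longrightarrow> S \<subseteq> C \<Longrightarrow> emeasure \<mu> S = emeasure \<nu> S"
  shows "\<mu> = \<nu>"
proof (rule measure_eqI)
  show "sets \<mu> = sets \<nu>" using sets by simp
  fix B assume "B \<in> sets \<mu>"
  then have B: "B \<in> sets M" using sets by simp
  show "emeasure \<mu> B = emeasure \<nu> B"
  proof (cases "\<C> = {}")
    case True
    then have "B = {}" using cover(3) sets.sets_into_space[OF B] by auto
    then show ?thesis by simp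
  next
    case False
    define C where "C = from_nat_into \<C>"
    have rangeC: "range C = \<C>" unfolding C_def using False cover(1) by (rule range_from_nat_into)
    define D where "D n = B \<inter> disjointed C n" for n
    have C: "range C \<subseteq> sets M" using rangeC cover(2) by simp
    have D: "range D \<subseteq> sets M"
      using sets.range_disjointed_sets[OF C] B by (auto simp: D_def)
    have "disjoint_family D"
      unfolding D_def using disjoint_family_disjointed[of C] by (auto simp: disjoint_family_on_def)
    moreover have "(\<Union>n. D n) = B"
    proof -
      have "(\<Union>n. D n) = B \<inter> (\<Union>n. C n)" by (simp add: D_def UN_disjointed_eq flip: Int_UN_distrib)
      then show ?thesis using rangeC cover(3) sets.sets_into_space[OF B] by auto
    qed
    ultimately have "emeasure \<mu> B = (\<Sum>n. emeasure \<mu> (D n))" "emeasure \<nu> B = (\<Sum>n. emeasure \<nu> (D n))"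
      using suminf_emeasure[of D \<mu>] suminf_emeasure[of D \<nu>] D sets by auto
    moreover have "emeasure \<mu> (D n) = emeasure \<nu> (D n)" for n
      using D rangeC disjointed_subset[of C n] by (intro eq[of "C n"]) (auto simp: D_def)
    ultimately show ?thesis by simp
  qed
qed

text \<open>
  The vectors inserted into the form are vertical, so \<open>\<delta>y\<close> reduces to \<open>dy\<close>; and \<open>F = 1\<close> on the indicatrix.
\<close>
lemma patch_density_on_indicatrix:
  assumes "L (x, \<phi> u) = 1"
  shows "patch_density L x i0 \<phi> u = sqrt \<bar>det (fundamental L (x, \<phi> u))\<bar> *
    \<bar>det (\<chi> j. if j = i0 then \<phi> u else frechet_derivative \<phi> (at u) (axis j 1))\<bar>"
proof -
  have "(\<chi> j i. delta_y L (x, \<phi> u) i (if j = i0 then (0, \<phi> u /\<^sub>R L (x, \<phi> u))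
         else (0, frechet_derivative \<phi> (at u) (axis j 1))) / L (x, \<phi> u)) =
      (\<chi> j. if j = i0 then \<phi> u else frechet_derivative \<phi> (at u) (axis j 1))"
    using assms by (simp add: delta_y_def vec_eq_iff)
  then show ?thesis
    unfolding patch_density_def vertical_volume_form_def by (simp add: abs_mult real_sqrt_abs')
qed

context cone_data
begin

text \<open>
  The hyperplane \<open>y $ i0 = s\<close> is projected radially to the indicatrix and parametrizes the part in one open
  half-space.  The map is immersive because the radial direction, which the projection kills, is transversal to the
  hyperplane.  For the uniqueness of the volume it matters that the \<open>2n\<close> half-spaces of this form cover the
  complement of the origin.
\<close>
lemma radial_patch:
  fixes i0 :: 'n and s :: real
  assumes smooth: "smooth_on (- {0}) N" and s: "s = 1 \<or> s = - 1"
  defines "U \<equiv> {u. s * u $ i0 > - 1}"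
    and "\<phi> \<equiv> (\<lambda>u. (u + s *\<^sub>R axis i0 1) /\<^sub>R N (u + s *\<^sub>R axis i0 1))"
  shows "hypersurface_patch unit_sphere i0 U \<phi>"
    and "unit_sphere \<inter> {y. s * y $ i0 > 0} \<subseteq> \<phi> ` {u\<in>U. u $ i0 = 0}"
proof -
  let ?e = "s *\<^sub>R axis i0 1 :: real ^ 'n"
  have ss: "s * s = 1" and s0: "s \<noteq> 0" using s by auto
  have nth: "(u + ?e) $ i0 = u $ i0 + s" for u by (simp add: axis_def)
  have nz: "u + ?e \<noteq> 0" if "u \<in> U" for u
  proof
    assume "u + ?e = 0"
    then have "u $ i0 = - s" using nth[of u] by simp
    then show False using that ss by (simp add: U_def)
  qed
  have U: "open U" unfolding U_def by (intro open_Collect_less continuous_intros)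
  have smoothN: "smooth_on U (\<lambda>u. N (?e + u))"
    by (rule smooth_on_affine[OF bounded_linear_ident U _ smooth]) (use nz in \<open>auto simp: add.commute\<close>)
  have sm: "smooth_on U \<phi>"
  proof -
    have "smooth_on U (\<lambda>u. inverse (N (?e + u)) *\<^sub>R (u + ?e))"
      using nz N_pos
      by (intro smooth_on_bilinear[OF bounded_bilinear_scaleR U] smooth_on_inverse U smoothN
          smooth_on_add smooth_on_const smooth_on_id_linear bounded_linear_ident)
        (metis add.commute less_irrefl)
    then show ?thesis by (simp add: \<phi>_def add.commute)
  qed
  have inj: "inj_on \<phi> {u\<in>U. u $ i0 = 0}"
  proof (rule inj_onI)
    fix u w assume uw: "u \<in> {u\<in>U. u $ i0 = 0}" "w \<in> {u\<in>U. u $ i0 = 0}" and eq: "\<phi> u = \<phi> w"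
    have "\<phi> u $ i0 = \<phi> w $ i0" using eq by simp
    then have "s / N (u + ?e) = s / N (w + ?e)" using uw nth by (simp add: \<phi>_def divide_inverse mult.commute)
    then have "N (u + ?e) = N (w + ?e)" using s0 N_pos[OF nz] uw by (auto simp: field_simps)
    moreover have "N (w + ?e) > 0" using N_pos nz uw by auto
    ultimately show "u = w" using eq by (simp add: \<phi>_def)
  qed
  have img: "\<phi> ` {u\<in>U. u $ i0 = 0} \<subseteq> unit_sphere"
    using radial_proj_unit_sphere nz by (auto simp: \<phi>_def radial_proj_def)
  have imm: "inj_on (frechet_derivative \<phi> (at u)) {h. h $ i0 = 0}" if u: "u \<in> U" "u $ i0 = 0" for u
  proof -
    define n where "n = N (u + ?e)"
    have n: "n > 0" using N_pos nz u by (simp add: n_def)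
    obtain N' where N': "((\<lambda>u. N (u + ?e)) has_derivative N') (at u)"
      using smooth_on_differentiable[OF smoothN u(1)] by (auto simp: differentiable_def add.commute)
    have "((\<lambda>u. inverse (N (u + ?e)) *\<^sub>R (u + ?e)) has_derivative
        (\<lambda>h. inverse n *\<^sub>R h + (- (inverse n * N' h * inverse n)) *\<^sub>R (u + ?e))) (at u)"
      unfolding n_def
    proof (rule has_derivative_scaleR[OF Deriv.has_derivative_inverse[OF _ N']])
      show "N (u + ?e) \<noteq> 0" using n by (simp add: n_def)
      show "((\<lambda>u. u + ?e) has_derivative (\<lambda>h. h)) (at u)"
        using has_derivative_add[OF has_derivative_ident has_derivative_const[of ?e]] by simp
    qed
    then have der: "(\<phi> has_derivative (\<lambda>h. inverse n *\<^sub>R h + (- (inverse n * N' h * inverse n)) *\<^sub>R (u + ?e))) (at u)"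
      unfolding \<phi>_def .
    have lin: "linear (frechet_derivative \<phi> (at u))"
      using has_derivative_linear[OF der] unfolding frechet_derivative_at[OF der] .
    show ?thesis
    proof (rule inj_onI)
      fix h k assume hk: "h \<in> {h. h $ i0 = 0}" "k \<in> {h. h $ i0 = 0}"
        and eq: "frechet_derivative \<phi> (at u) h = frechet_derivative \<phi> (at u) k"
      define d where "d = h - k"
      have d0: "d $ i0 = 0" using hk by (simp add: d_def)
      have "frechet_derivative \<phi> (at u) d = 0" using eq linear_diff[OF lin] by (simp add: d_def)
      then have z: "inverse n *\<^sub>R d + (- (inverse n * N' d * inverse n)) *\<^sub>R (u + ?e) = 0"
        unfolding frechet_derivative_at[OF der, symmetric] .
      have "(inverse n *\<^sub>R d + (- (inverse n * N' d * inverse n)) *\<^sub>R (u + ?e)) $ i0 = 0" by (simp only: z zero_index)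
      then have "inverse n * N' d * inverse n = 0"
        using d0 u(2) s0 by (simp add: axis_def)
      then have "inverse n *\<^sub>R d = 0" using z by (simp only: minus_zero scaleR_zero_left add_0_right)
      then have "d = 0" using n by simp
      then show "h = k" by (simp add: d_def)
    qed
  qed
  show "hypersurface_patch unit_sphere i0 U \<phi>"
    unfolding hypersurface_patch_def using U sm inj img imm by blast
  show "unit_sphere \<inter> {y. s * y $ i0 > 0} \<subseteq> \<phi> ` {u\<in>U. u $ i0 = 0}"
  proof
    fix y assume y: "y \<in> unit_sphere \<inter> {y. s * y $ i0 > 0}"
    \<comment> \<open>\<open>r\<close> is the factor that moves \<open>y\<close> along its ray into the hyperplane.\<close>
    define r where "r = inverse (s * y $ i0)"
    define u where "u = r *\<^sub>R y - ?e"
    have r: "r > 0" unfolding r_def using y by (intro positive_imp_inverse_positive) simp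
    have "y $ i0 \<noteq> 0" using y by auto
    then have "r * y $ i0 = s" using ss s0 by (simp add: r_def field_simps)
    then have u0: "u $ i0 = 0" by (simp add: u_def axis_def)
    have "N (r *\<^sub>R y) = r" using N_scale[OF r, of y] y by (auto simp: unit_sphere_def)
    then have "\<phi> u = y" using r by (simp add: \<phi>_def u_def)
    moreover have "u \<in> U" using u0 by (simp add: U_def)
    ultimately show "y \<in> \<phi> ` {u\<in>U. u $ i0 = 0}" using u0 by auto
  qed
qed

end

text \<open>
  The cone measure has the densities required in all patches, and every measure which has them is
  determined on the \<open>2n\<close> radial patches and on the complement of the indicatrix, hence everywhere.
\<close>
lemma indicatrix_measure_eq_cone_measure:
  fixes L :: "(real ^ 'n::finite) \<times> (real ^ 'n) \<Rightarrow> real" and x :: "real ^ 'n"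
  defines "N \<equiv> \<lambda>y. L (x, y)" and "q \<equiv> \<lambda>y. sqrt \<bar>det (fundamental L (x, y))\<bar>"
  assumes cone: "cone_data N q" and smooth: "smooth_on (- {0}) N"
  shows "indicatrix_measure L x (cone_data.unit_sphere N) = cone_data.cone_measure N q"
proof -
  interpret cone_data N q by (rule cone)
  have [measurable]: "unit_sphere \<in> sets borel" unfolding unit_sphere_def by measurable
  define ok where "ok = (\<lambda>\<mu>. sets \<mu> = sets borel \<and> emeasure \<mu> (- unit_sphere) = 0 \<and>
    (\<forall>i0 U \<phi>. hypersurface_patch unit_sphere i0 U \<phi> \<longrightarrow>
      (\<forall>S\<in>sets borel. S \<subseteq> \<phi> ` {u\<in>U. u $ i0 = 0} \<longrightarrow>
        emeasure \<mu> S =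
          (\<integral>\<^sup>+ u. indicator {u\<in>U. \<phi> u \<in> S} u * ennreal (patch_density L x i0 \<phi> u)
             \<partial>hyperplane_measure i0))))"
  have "ok cone_measure"
    unfolding ok_def
  proof (intro conjI allI impI ballI)
    show "sets cone_measure = sets borel" by (simp add: cone_measure_def)
    show "emeasure cone_measure (- unit_sphere) = 0" by (rule cone_measure_off_unit_sphere)
    fix i0 U \<phi> S assume patch: "hypersurface_patch unit_sphere i0 U \<phi>"
      and S: "S \<in> sets borel" "S \<subseteq> \<phi> ` {u \<in> U. u $ i0 = 0}"
    have "patch_density L x i0 \<phi> u = q (\<phi> u) *
        \<bar>det (\<chi> j. if j = i0 then \<phi> u else frechet_derivative \<phi> (at u) (axis j 1))\<bar>"
      if "\<phi> u \<in> S" for u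
    proof -
      have "\<phi> u \<in> unit_sphere" using that S patch by (auto simp: hypersurface_patch_def)
      then have "N (\<phi> u) = 1" by (simp add: unit_sphere_def)
      then have "L (x, \<phi> u) = 1" by (simp add: N_def)
      from patch_density_on_indicatrix[where L = L and \<phi> = \<phi> and u = u and x = x, OF this] show ?thesis by (simp add: q_def)
    qed
    then show "emeasure cone_measure S = (\<integral>\<^sup>+ u. indicator {u\<in>U. \<phi> u \<in> S} u *
        ennreal (patch_density L x i0 \<phi> u) \<partial>hyperplane_measure i0)"
      unfolding cone_measure_patch[OF patch S]
      by (intro nn_integral_cong) (auto simp: indicator_def)
  qed
  moreover have "\<mu> = cone_measure" if "ok \<mu>" for \<mu>
  proof (rule measure_eq_on_countable_cover[where M = borel])
    define \<C> where "\<C> = insert (- unit_sphere) ((\<lambda>(i0, s). unit_sphere \<inter> {y. s * y $ i0 > (0::real)}) ` (UNIV \<times> {1, - 1}))"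
    show "countable \<C>" by (simp add: \<C>_def countable_finite)
    show "\<C> \<subseteq> sets borel" by (auto simp: \<C>_def)
    show "space borel \<subseteq> \<Union>\<C>"
    proof
      fix y :: "real ^ 'n"
      show "y \<in> \<Union>\<C>"
      proof (cases "y \<in> unit_sphere")
        case True
        then obtain i where "y $ i \<noteq> 0" by (auto simp: unit_sphere_def vec_eq_iff)
        then have "1 * y $ i > 0 \<or> (- 1) * y $ i > 0" by auto
        then show ?thesis using True unfolding \<C>_def by (auto intro: bexI[of _ 1] bexI[of _ "- 1"])
      qed (simp add: \<C>_def)
    qed
    fix C S :: "(real ^ 'n) set" assume C: "C \<in> \<C>" and S: "S \<in> sets borel" "S \<subseteq> C"
    show "emeasure \<mu> S = emeasure cone_measure S"
    proof (cases "C = - unit_sphere")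
      case True
      have "emeasure \<nu> S = 0" if "ok \<nu>" for \<nu>
      proof -
        have "emeasure \<nu> S \<le> emeasure \<nu> (- unit_sphere)"
          using S True that by (intro emeasure_mono) (auto simp: ok_def)
        then show ?thesis using that by (simp add: ok_def)
      qed
      then show ?thesis using that \<open>ok cone_measure\<close> by simp
    next
      case False
      then obtain i0 s where s: "s = 1 \<or> s = - 1" and "C = unit_sphere \<inter> {y. s * y $ i0 > 0}"
        using C by (auto simp: \<C>_def)
      then have sub: "S \<subseteq> (\<lambda>u. (u + s *\<^sub>R axis i0 1) /\<^sub>R N (u + s *\<^sub>R axis i0 1)) ` {u\<in>{u. s * u $ i0 > - 1}. u $ i0 = 0}"
        using radial_patch(2)[OF smooth s] S(2) by blast
      show ?thesis
      proof -
        have "emeasure \<nu> S = (\<integral>\<^sup>+ v. indicator {v\<in>{u. s * u $ i0 > - 1}. \<phi> v \<in> S} v *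
            ennreal (patch_density L x i0 \<phi> v) \<partial>hyperplane_measure i0)"
          if "ok \<nu>" and "\<phi> = (\<lambda>u. (u + s *\<^sub>R axis i0 1) /\<^sub>R N (u + s *\<^sub>R axis i0 1))" for \<nu> \<phi>
          using that(1)[unfolded ok_def, THEN conjunct2, THEN conjunct2, rule_format,
              OF radial_patch(1)[OF smooth s, of i0] S(1)] sub
          unfolding that(2) by blast
        then show ?thesis using that \<open>ok cone_measure\<close> by simp
      qed
    qed
  qed (use that in \<open>auto simp: ok_def cone_measure_def\<close>)
  ultimately show ?thesis
    unfolding indicatrix_measure_def ok_def by (intro the_equality)
qed

section \<open>Tangent spaces of the manifold and of its slit tangent bundle\<close>

text \<open>
  Only what the algebra of tangent vectors needs: the conditions apply to the atlas of the manifold and to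
  the natural atlas of its slit tangent bundle alike, and ask for no topology on the set of points.
\<close>
locale differentiable_atlas =
  fixes B :: "('p, 'e::euclidean_space) chart set"
  assumes chart_inj: "c \<in> B \<Longrightarrow> inj_on (snd c) (fst c)"
    and overlap_open: "c \<in> B \<Longrightarrow> c' \<in> B \<Longrightarrow> open (snd c ` (fst c \<inter> fst c'))"
    and transition_differentiable: "c \<in> B \<Longrightarrow> c' \<in> B \<Longrightarrow> p \<in> fst c \<Longrightarrow> p \<in> fst c' \<Longrightarrow>
      (snd c' \<circ> chart_inv c) differentiable (at (snd c p))"
begin

definition transition :: "('p, 'e) chart \<Rightarrow> ('p, 'e) chart \<Rightarrow> 'p \<Rightarrow> 'e \<Rightarrow> 'e" where
  "transition c c' p = frechet_derivative (snd c' \<circ> chart_inv c) (at (snd c p))"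

lemma chart_inv_chart: "c \<in> B \<Longrightarrow> p \<in> fst c \<Longrightarrow> chart_inv c (snd c p) = p"
  unfolding chart_inv_def by (rule inv_into_f_f[OF chart_inj])

lemma chart_chart_inv: "x \<in> snd c ` fst c \<Longrightarrow> snd c (chart_inv c x) = x"
  unfolding chart_inv_def by (rule f_inv_into_f)

lemma chart_inv_in: "x \<in> snd c ` fst c \<Longrightarrow> chart_inv c x \<in> fst c"
  unfolding chart_inv_def by (rule inv_into_into)

lemma image_open: "c \<in> B \<Longrightarrow> open (snd c ` fst c)"
  using overlap_open[of c c] by simp

lemma transition_has_derivative:
  assumes "c \<in> B" "c' \<in> B" "p \<in> fst c" "p \<in> fst c'"
  shows "((snd c' \<circ> chart_inv c) has_derivative transition c c' p) (at (snd c p))"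
  using transition_differentiable[OF assms] unfolding transition_def frechet_derivative_works .

lemma transition_linear:
  assumes "c \<in> B" "c' \<in> B" "p \<in> fst c" "p \<in> fst c'"
  shows "linear (transition c c' p)"
  using transition_has_derivative[OF assms] by (rule has_derivative_linear)

lemma transition_refl:
  assumes "c \<in> B" "p \<in> fst c" shows "transition c c p = id"
proof -
  have "((\<lambda>x. x) has_derivative transition c c p) (at (snd c p))"
    by (rule has_derivative_transform_within_open[OF transition_has_derivative[OF assms(1,1,2,2)] image_open[OF assms(1)]])
      (use assms in \<open>simp_all add: chart_chart_inv\<close>)
  then have "transition c c p = (\<lambda>x. x)" using has_derivative_unique has_derivative_ident by blast
  then show ?thesis by (simp add: id_def)
qed

text \<open>
  The chain rule, applied on the neighbourhood on which the two ways to change the chart agree.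
\<close>
lemma transition_cocycle:
  assumes B: "c \<in> B" "c' \<in> B" "c'' \<in> B" and p: "p \<in> fst c" "p \<in> fst c'" "p \<in> fst c''"
  shows "transition c' c'' p (transition c c' p y) = transition c c'' p y"
proof -
  have 1: "(snd c' \<circ> chart_inv c) (snd c p) = snd c' p" using B p by (simp add: chart_inv_chart)
  have "((snd c'' \<circ> chart_inv c') has_derivative transition c' c'' p) (at ((snd c' \<circ> chart_inv c) (snd c p)))"
    unfolding 1 by (rule transition_has_derivative[OF B(2,3) p(2,3)])
  from diff_chain_at[OF transition_has_derivative[OF B(1,2) p(1,2)] this]
  have "((snd c'' \<circ> chart_inv c) has_derivative transition c' c'' p \<circ> transition c c' p) (at (snd c p))"
  proof (rule has_derivative_transform_within_open[OF _ overlap_open[OF B(1,2)]])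
    fix x assume "x \<in> snd c ` (fst c \<inter> fst c')"
    then show "((snd c'' \<circ> chart_inv c') \<circ> (snd c' \<circ> chart_inv c)) x = (snd c'' \<circ> chart_inv c) x"
      using B by (auto simp: chart_inv_chart)
  qed (use p in blast)
  then have "transition c' c'' p \<circ> transition c c' p = transition c c'' p"
    using has_derivative_unique transition_has_derivative[OF B(1,3) p(1,3)] by blast
  then show ?thesis by (metis comp_apply)
qed

lemma tangent_component:
  "v \<in> tangent_space B p \<Longrightarrow> c \<in> B \<Longrightarrow> c' \<in> B \<Longrightarrow> p \<in> fst c \<Longrightarrow> p \<in> fst c' \<Longrightarrow> v c' = transition c c' p (v c)"
  unfolding tangent_space_def transition_def by blast

lemma tangent_component_outside:
  "v \<in> tangent_space B p \<Longrightarrow> \<not> (c \<in> B \<and> p \<in> fst c) \<Longrightarrow> v c = 0"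
  unfolding tangent_space_def by blast

lemma tangent_eqI:
  assumes "v \<in> tangent_space B p" "w \<in> tangent_space B p" "c \<in> B" "p \<in> fst c" "v c = w c"
  shows "v = w"
proof
  fix k
  show "v k = w k"
    using assms tangent_component[of v p c k] tangent_component[of w p c k]
      tangent_component_outside[of v p k] tangent_component_outside[of w p k]
    by (cases "k \<in> B \<and> p \<in> fst k") auto
qed

text \<open>
  The components in the other charts are forced by those in \<open>c\<close>; the cocycle property makes them compatible
  with each other.
\<close>
lemma tangent_exists:
  assumes "c \<in> B" "p \<in> fst c"
  shows "\<exists>v\<in>tangent_space B p. v c = y"
proof -
  define v where "v k = (if k \<in> B \<and> p \<in> fst k then transition c k p y else 0)" for k
  have "v \<in> tangent_space B p"
    unfolding tangent_space_def using assms transition_cocycle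
    by (auto simp: v_def transition_def[symmetric])
  moreover have "v c = y" using assms by (simp add: v_def transition_refl)
  ultimately show ?thesis by blast
qed

lemma
  assumes "c \<in> B" "p \<in> fst c"
  shows tangent_of_in: "tangent_of B c p y \<in> tangent_space B p"
    and tangent_of_component: "tangent_of B c p y c = y"
proof -
  have "\<exists>!v. v \<in> tangent_space B p \<and> v c = y"
    using tangent_exists[OF assms, of y] tangent_eqI[OF _ _ assms] by metis
  from theI'[OF this] show "tangent_of B c p y \<in> tangent_space B p" "tangent_of B c p y c = y"
    unfolding tangent_of_def by blast+
qed

lemma tangent_of_eqI:
  assumes "c \<in> B" "p \<in> fst c" "v \<in> tangent_space B p" "v c = y"
  shows "tangent_of B c p y = v"
  using tangent_eqI[OF tangent_of_in[OF assms(1,2)] assms(3,1,2)] tangent_of_component[OF assms(1,2)] assms(4)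
  by simp

lemma tangent_space_lincomb:
  assumes "v \<in> tangent_space B p" "w \<in> tangent_space B p"
  shows "(\<lambda>k. \<alpha> *\<^sub>R v k + \<beta> *\<^sub>R w k) \<in> tangent_space B p"
proof -
  have "\<alpha> *\<^sub>R v c' + \<beta> *\<^sub>R w c' = transition c c' p (\<alpha> *\<^sub>R v c + \<beta> *\<^sub>R w c)"
    if "c \<in> B" "c' \<in> B" "p \<in> fst c" "p \<in> fst c'" for c c'
    using transition_linear[OF that] tangent_component[OF assms(1) that] tangent_component[OF assms(2) that]
    by (simp add: linear_add linear_scale)
  moreover have "\<alpha> *\<^sub>R v c + \<beta> *\<^sub>R w c = 0" if "\<not> (c \<in> B \<and> p \<in> fst c)" for c
    using tangent_component_outside[OF assms(1) that] tangent_component_outside[OF assms(2) that] by simp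
  ultimately show ?thesis
    unfolding tangent_space_def transition_def[symmetric] by blast
qed

lemma tangent_space_zero:
  assumes "c \<in> B" "p \<in> fst c" shows "(\<lambda>_. 0) \<in> tangent_space B p"
  using tangent_space_lincomb[OF tangent_of_in[OF assms] tangent_of_in[OF assms], of 0 _ 0] by simp

lemma tangent_of_lincomb:
  assumes "c \<in> B" "p \<in> fst c"
  shows "tangent_of B c p (\<alpha> *\<^sub>R y + \<beta> *\<^sub>R z) = (\<lambda>k. \<alpha> *\<^sub>R tangent_of B c p y k + \<beta> *\<^sub>R tangent_of B c p z k)"
  by (rule tangent_of_eqI[OF assms tangent_space_lincomb[OF tangent_of_in[OF assms] tangent_of_in[OF assms]]])
    (simp add: tangent_of_component[OF assms])

end

locale smooth_manifold =
  fixes A :: "('a::{t2_space, second_countable_topology}, real ^ 'n::finite) chart set"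
  assumes smooth_atlas: "smooth_atlas A"
begin

lemma chart_homeo: "c \<in> A \<Longrightarrow> homeomorphism (fst c) (snd c ` fst c) (snd c) (chart_inv c)"
  using smooth_atlas by (auto simp: smooth_atlas_def)

lemma overlap_open: "c \<in> A \<Longrightarrow> c' \<in> A \<Longrightarrow> open (snd c ` (fst c \<inter> fst c'))"
proof -
  assume c: "c \<in> A" "c' \<in> A"
  have o: "open (fst c)" "open (fst c')" "open (snd c ` fst c)"
    using smooth_atlas c by (auto simp: smooth_atlas_def)
  have "openin (top_of_set (snd c ` fst c)) (snd c ` (fst c \<inter> fst c'))"
    by (rule homeomorphism_imp_open_map[OF chart_homeo[OF c(1)]]) (use o in auto)
  then show ?thesis using o(3) openin_open_eq by blast
qed

lemma transition_smooth:
  "c \<in> A \<Longrightarrow> c' \<in> A \<Longrightarrow> smooth_on (snd c ` (fst c \<inter> fst c')) (snd c' \<circ> chart_inv c)"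
  using smooth_atlas by (auto simp: smooth_atlas_def)

sublocale base: differentiable_atlas A
proof
  show "inj_on (snd c) (fst c)" if "c \<in> A" for c
    by (rule inj_on_inverseI[of _ "chart_inv c"]) (rule homeomorphism_apply1[OF chart_homeo[OF that]])
  show "(snd c' \<circ> chart_inv c) differentiable (at (snd c p))"
    if "c \<in> A" "c' \<in> A" "p \<in> fst c" "p \<in> fst c'" for c c' p
    using smooth_on_differentiable[OF transition_smooth[OF that(1,2)]] that by blast
qed (rule overlap_open)

lemma fst_slit_chart: "u \<in> fst (slit_chart A c) \<longleftrightarrow> u \<in> slit_bundle A \<and> fst u \<in> fst c"
  by (auto simp: slit_chart_def)

lemma snd_slit_chart: "snd (slit_chart A c) u = (snd c (fst u), snd u c)"
  by (simp add: slit_chart_def case_prod_beta)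

lemma slit_bundle_component:
  assumes "c \<in> A" "fst u \<in> fst c" "u \<in> slit_bundle A"
  shows "snd u c \<noteq> 0"
proof
  assume "snd u c = 0"
  then have "snd u = (\<lambda>_. 0)"
    using base.tangent_eqI[OF _ base.tangent_space_zero[OF assms(1,2)] assms(1,2), of "snd u"] assms(3)
    by (auto simp: slit_bundle_def)
  then show False using assms(3) by (auto simp: slit_bundle_def)
qed

lemma slit_bundle_tangent_of:
  assumes "c \<in> A" "p \<in> fst c" "y \<noteq> 0"
  shows "(p, tangent_of A c p y) \<in> slit_bundle A"
  using base.tangent_of_in[OF assms(1,2), of y] base.tangent_of_component[OF assms(1,2), of y] assms(3)
  by (auto simp: slit_bundle_def)

lemma slit_chart_image:
  assumes "c \<in> A"
  shows "snd (slit_chart A c) ` (fst (slit_chart A c) \<inter> fst (slit_chart A c')) =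
    (snd c ` (fst c \<inter> fst c')) \<times> (- {0})"
proof (intro equalityI subsetI)
  fix w :: "(real ^ 'n) \<times> (real ^ 'n)" assume "w \<in> (snd c ` (fst c \<inter> fst c')) \<times> (- {0})"
  then obtain p y where p: "p \<in> fst c" "p \<in> fst c'" and w: "w = (snd c p, y)" "y \<noteq> 0" by auto
  show "w \<in> snd (slit_chart A c) ` (fst (slit_chart A c) \<inter> fst (slit_chart A c'))"
    using slit_bundle_tangent_of[OF assms p(1) w(2)] p base.tangent_of_component[OF assms p(1), of y]
    by (intro image_eqI[of _ _ "(p, tangent_of A c p y)"]) (auto simp: fst_slit_chart snd_slit_chart w)
next
  fix w assume "w \<in> snd (slit_chart A c) ` (fst (slit_chart A c) \<inter> fst (slit_chart A c'))"
  then obtain u where "u \<in> slit_bundle A" "fst u \<in> fst c" "fst u \<in> fst c'" "w = (snd c (fst u), snd u c)"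
    by (auto simp only: fst_slit_chart snd_slit_chart)
  then show "w \<in> (snd c ` (fst c \<inter> fst c')) \<times> (- {0})"
    using slit_bundle_component[OF assms, of u] by simp
qed

lemma slit_chart_inj:
  assumes "c \<in> A" shows "inj_on (snd (slit_chart A c)) (fst (slit_chart A c))"
proof (rule inj_onI)
  fix u w assume u: "u \<in> fst (slit_chart A c)" and w: "w \<in> fst (slit_chart A c)"
    and eq: "snd (slit_chart A c) u = snd (slit_chart A c) w"
  have p: "fst u = fst w"
    using base.chart_inj[OF assms] u w eq by (auto simp: fst_slit_chart snd_slit_chart inj_on_def)
  moreover have "snd u = snd w"
    using u w eq p by (intro base.tangent_eqI[OF _ _ assms, of _ "fst u"])
      (auto simp: fst_slit_chart snd_slit_chart slit_bundle_def)
  ultimately show "u = w" by (simp add: prod_eq_iff)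
qed

lemma slit_chart_inv:
  assumes "c \<in> A" "x \<in> snd c ` fst c" "y \<noteq> 0"
  shows "chart_inv (slit_chart A c) (x, y) = (chart_inv c x, tangent_of A c (chart_inv c x) y)"
proof -
  let ?p = "chart_inv c x"
  have p: "?p \<in> fst c" using base.chart_inv_in[OF assms(2)] .
  let ?u = "(?p, tangent_of A c ?p y)"
  have "?u \<in> fst (slit_chart A c)"
    using slit_bundle_tangent_of[OF assms(1) p assms(3)] p by (simp add: fst_slit_chart)
  moreover have "snd (slit_chart A c) ?u = (x, y)"
    using base.tangent_of_component[OF assms(1) p] base.chart_chart_inv[OF assms(2)]
    by (simp add: snd_slit_chart)
  ultimately show ?thesis
    unfolding chart_inv_def using inv_into_f_f[OF slit_chart_inj[OF assms(1)]] by metis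
qed

text \<open>
  The change of natural coordinates \<open>(x, y) \<mapsto> (\<tau>(x), D\<tau>(x) y)\<close> induced by the coordinate change \<open>\<tau>\<close>.
\<close>
definition lifted_transition where
  "lifted_transition c c' w = ((snd c' \<circ> chart_inv c) (fst w),
    frechet_derivative (snd c' \<circ> chart_inv c) (at (fst w)) (snd w))"

lemma slit_transition_eq:
  assumes c: "c \<in> A" "c' \<in> A" and w: "w \<in> (snd c ` (fst c \<inter> fst c')) \<times> (- {0})"
  shows "(snd (slit_chart A c') \<circ> chart_inv (slit_chart A c)) w = lifted_transition c c' w"
proof -
  obtain p y where p: "p \<in> fst c" "p \<in> fst c'" and wp: "w = (snd c p, y)" "y \<noteq> 0" using w by auto
  have "tangent_of A c p y c' = base.transition c c' p y"
    using base.tangent_component[OF base.tangent_of_in[OF c(1) p(1), of y] c p]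
      base.tangent_of_component[OF c(1) p(1), of y] by simp
  then show ?thesis using p wp c
    by (simp add: slit_chart_inv base.chart_inv_chart snd_slit_chart lifted_transition_def base.transition_def)
qed

text \<open>
  Linearity in \<open>y\<close> turns the second component into a combination of partial derivatives with the coordinates
  of \<open>y\<close> as coefficients.  The zero vector is included because the map also serves to transform the
  values of sections, which may vanish.
\<close>
lemma lifted_transition_smooth_UNIV:
  assumes c: "c \<in> A" "c' \<in> A"
  shows "smooth_on ((snd c ` (fst c \<inter> fst c')) \<times> UNIV) (lifted_transition c c')"
proof -
  let ?O = "snd c ` (fst c \<inter> fst c')"
  let ?W = "?O \<times> (UNIV :: (real ^ 'n) set)"
  have W: "open ?W" using overlap_open[OF c] by (intro open_Times) auto
  note tau = transition_smooth[OF c]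
  have 1: "smooth_on ?W (\<lambda>w. (snd c' \<circ> chart_inv c) (fst w))"
    by (rule smooth_on_fst[OF W tau]) auto
  have lin: "bounded_linear (\<lambda>w :: (real ^ 'n) \<times> (real ^ 'n). snd w $ i)" for i
    by (rule bounded_linear_compose[OF bounded_linear_vec_nth bounded_linear_snd])
  have 2: "smooth_on ?W (\<lambda>w. \<Sum>i\<in>UNIV. (snd w $ i) *\<^sub>R
      frechet_derivative (snd c' \<circ> chart_inv c) (at (fst w)) (axis i 1))"
    by (intro smooth_on_sum W smooth_on_bilinear[OF bounded_bilinear_scaleR] smooth_on_id_linear lin
        smooth_on_fst[OF W smooth_on_derivative[OF tau]]) auto
  have "(\<Sum>i\<in>UNIV. (snd w $ i) *\<^sub>R frechet_derivative (snd c' \<circ> chart_inv c) (at (fst w)) (axis i 1)) =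
      frechet_derivative (snd c' \<circ> chart_inv c) (at (fst w)) (snd w)" if "w \<in> ?W" for w
  proof -
    have "linear (frechet_derivative (snd c' \<circ> chart_inv c) (at (fst w)))"
      using smooth_on_differentiable[OF tau] that by (intro linear_frechet_derivative) auto
    then have "frechet_derivative (snd c' \<circ> chart_inv c) (at (fst w)) (\<Sum>i\<in>UNIV. (snd w $ i) *\<^sub>R axis i 1) =
      (\<Sum>i\<in>UNIV. (snd w $ i) *\<^sub>R frechet_derivative (snd c' \<circ> chart_inv c) (at (fst w)) (axis i 1))"
      by (simp add: linear_sum linear_scale)
    then show ?thesis using basis_expansion[of "snd w"] by (simp add: scalar_mult_eq_scaleR)
  qed
  then have "smooth_on ?W (\<lambda>w. frechet_derivative (snd c' \<circ> chart_inv c) (at (fst w)) (snd w))"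
    by (rule smooth_on_cong[OF W _ 2])
  then show ?thesis unfolding lifted_transition_def[abs_def] by (rule smooth_on_Pair[OF W 1])
qed

lemma lifted_transition_smooth:
  assumes c: "c \<in> A" "c' \<in> A"
  shows "smooth_on ((snd c ` (fst c \<inter> fst c')) \<times> (- {0})) (lifted_transition c c')"
  by (rule smooth_on_subset[OF _ lifted_transition_smooth_UNIV[OF c]]) auto

sublocale slit: differentiable_atlas "slit_atlas A"
proof
  fix k k' assume "k \<in> slit_atlas A" "k' \<in> slit_atlas A"
  then obtain c c' where c: "c \<in> A" "c' \<in> A" and k: "k = slit_chart A c" "k' = slit_chart A c'"
    by (auto simp: slit_atlas_def)
  have W: "open ((snd c ` (fst c \<inter> fst c')) \<times> (- {0} :: (real ^ 'n) set))"
    using overlap_open[OF c] by (intro open_Times) auto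
  show "open (snd k ` (fst k \<inter> fst k'))" unfolding k slit_chart_image[OF c(1)] by (rule W)
  fix u assume "u \<in> fst k" "u \<in> fst k'"
  then have "snd k u \<in> snd k ` (fst k \<inter> fst k')" by blast
  then have u: "snd k u \<in> (snd c ` (fst c \<inter> fst c')) \<times> (- {0})" unfolding k slit_chart_image[OF c(1)] .
  show "(snd k' \<circ> chart_inv k) differentiable (at (snd k u))"
    by (rule differentiable_cong_open[OF W u _ smooth_on_differentiable[OF lifted_transition_smooth[OF c] u]])
      (use slit_transition_eq[OF c] in \<open>simp add: k\<close>)
qed (auto simp: slit_atlas_def slit_chart_inj)

end

section \<open>Linear differential equations and the Euler product\<close>

lemma bounded_bilinear_matrix_vector_mult:
  "bounded_bilinear ((*v) :: real ^ 'n::finite ^ 'm::finite \<Rightarrow> real ^ 'n \<Rightarrow> real ^ 'm)"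
  unfolding bilinear_conv_bounded_bilinear[symmetric] bilinear_def
  by (auto intro!: linearI simp: matrix_vector_mult_def vec_eq_iff algebra_simps sum.distrib sum_distrib_left)

lemma bounded_matrix_family:
  fixes M :: "real \<Rightarrow> real ^ 'n::finite ^ 'n"
  assumes "continuous_on {a..b} M"
  obtains C where "C \<ge> 0" "\<And>t x. t \<in> {a..b} \<Longrightarrow> norm (M t *v x) \<le> C * norm x"
proof -
  obtain K where K: "K > 0" "\<And>A x. norm (A *v x :: real ^ 'n) \<le> norm (A :: real ^ 'n ^ 'n) * norm x * K"
    using bounded_bilinear.pos_bounded[OF bounded_bilinear_matrix_vector_mult] by blast
  have "bounded (M ` {a..b})"
    using assms by (intro compact_imp_bounded compact_continuous_image) auto
  then obtain D where D: "D > 0" "\<And>t. t \<in> {a..b} \<Longrightarrow> norm (M t) \<le> D" by (auto simp: bounded_pos)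
  have "norm (M t *v x) \<le> (D * K) * norm x" if "t \<in> {a..b}" for t x
  proof -
    have "norm (M t) * (norm x * K) \<le> D * (norm x * K)" using D(2)[OF that] K(1) by (intro mult_right_mono) auto
    then show ?thesis using K(2)[of "M t" x] by (simp add: algebra_simps)
  qed
  then show thesis using that[of "D * K"] K D by simp
qed

text \<open>
  The Picard iterates, written as a series: the terms are bounded by those of an exponential series, so
  the series and the series of its derivatives converge uniformly.
\<close>
lemma linear_ode_solution_exists:
  fixes M :: "real \<Rightarrow> real ^ 'n::finite ^ 'n"
  assumes ab: "a < b" and M: "continuous_on {a..b} M"
  obtains s where "s a = s0"
    "\<And>t. t \<in> {a..b} \<Longrightarrow> (s has_vector_derivative M t *v s t) (at t within {a..b})"
proof -
  obtain C where C: "C \<ge> 0" "\<And>t x. t \<in> {a..b} \<Longrightarrow> norm (M t *v x) \<le> C * norm x"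
    using bounded_matrix_family[OF M] by blast
  define P where "P = rec_nat (\<lambda>_. s0) (\<lambda>_ p t. integral {a..t} (\<lambda>\<tau>. M \<tau> *v p \<tau>))"
  have P0: "P 0 = (\<lambda>_. s0)" and PS: "P (Suc k) = (\<lambda>t. integral {a..t} (\<lambda>\<tau>. M \<tau> *v P k \<tau>))" for k
    by (simp_all add: P_def)
  have cont: "continuous_on {a..b} (P k)" for k
  proof (induction k)
    case (Suc k)
    have "(\<lambda>\<tau>. M \<tau> *v P k \<tau>) integrable_on {a..b}"
      using Suc by (intro integrable_continuous_real bounded_bilinear.continuous_on[OF bounded_bilinear_matrix_vector_mult] M)
    then show ?case unfolding PS by (rule indefinite_integral_continuous_1)
  qed (simp add: P0)
  have der: "(P (Suc k) has_vector_derivative M t *v P k t) (at t within {a..b})" if "t \<in> {a..b}" for k t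
    unfolding PS using that
    by (intro integral_has_vector_derivative bounded_bilinear.continuous_on[OF bounded_bilinear_matrix_vector_mult] M cont)
  have Pa: "P k a = (if k = 0 then s0 else 0)" for k by (cases k) (auto simp: P0 PS)
  have bound: "norm (P k t) \<le> norm s0 * ((C * (t - a)) ^ k / fact k)" if "t \<in> {a..b}" for k t
    using that
  proof (induction k arbitrary: t)
    case (Suc k)
    show ?case
    proof (cases "t = a")
      case False
      then have at: "a < t" "t \<le> b" using Suc.prems by auto
      let ?\<phi> = "\<lambda>t. norm s0 * ((C * (t - a)) ^ Suc k / fact (Suc k))"
      have "norm (P (Suc k) t - P (Suc k) a) \<le> ?\<phi> t - ?\<phi> a"
      proof (rule differentiable_bound_general[OF at(1)])
        show "continuous_on {a..t} (P (Suc k))" using continuous_on_subset[OF cont] at by simp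
        show "continuous_on {a..t} ?\<phi>" by (intro continuous_intros) auto
        fix x assume x: "a < x" "x < t"
        have "(P (Suc k) has_vector_derivative M x *v P k x) (at x within {a<..<t})"
          using der[of x k] x at by (auto intro: has_vector_derivative_within_subset)
        then show "(P (Suc k) has_vector_derivative M x *v P k x) (at x)"
          using x by (simp add: at_within_open[of x "{a<..<t}"])
        have "(?\<phi> has_real_derivative norm s0 * (real (Suc k) * (C * (x - a)) ^ k * C / fact (Suc k))) (at x)"
          by (rule derivative_eq_intros refl | simp)+
        moreover have "real (Suc k) * (C * (x - a)) ^ k * C / fact (Suc k) = C * ((C * (x - a)) ^ k / fact k)"
          unfolding fact_Suc by (simp del: of_nat_Suc)
        ultimately show "(?\<phi> has_vector_derivative norm s0 * (C * ((C * (x - a)) ^ k / fact k))) (at x)"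
          unfolding has_real_derivative_iff_has_vector_derivative[symmetric]
          by (simp only: times_divide_eq_right[symmetric])
        have "norm (M x *v P k x) \<le> C * norm (P k x)" using C x at by simp
        also have "\<dots> \<le> C * (norm s0 * ((C * (x - a)) ^ k / fact k))"
          using Suc.IH[of x] x at C by (intro mult_left_mono) auto
        finally show "norm (M x *v P k x) \<le> norm s0 * (C * ((C * (x - a)) ^ k / fact k))"
          by (simp add: mult_ac)
      qed
      then show ?thesis by (simp add: Pa)
    qed (simp add: Pa)
  qed (simp add: P0)
  define B where "B k = norm s0 * ((C * (b - a)) ^ k / fact k)" for k
  have B: "norm (P k t) \<le> B k" if "t \<in> {a..b}" for k t
  proof -
    have "(C * (t - a)) ^ k / fact k \<le> (C * (b - a)) ^ k / fact k"
      using that C by (intro divide_right_mono power_mono mult_left_mono) auto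
    then show ?thesis using bound[OF that, of k] unfolding B_def
      by (meson mult_left_mono norm_ge_zero order_trans)
  qed
  have sumB: "summable B"
    unfolding B_def using summable_exp[of "C * (b - a)"]
    by (intro summable_mult) (simp add: divide_inverse mult.commute)
  \<comment> \<open>\<open>D k\<close> is the derivative of the term \<open>P k\<close>; the shift by one index turns the sum of the \<open>D k\<close> into \<open>M\<close> applied
    to the sum of the \<open>P k\<close>.\<close>
  define D where "D k t = (case k of 0 \<Rightarrow> 0 | Suc j \<Rightarrow> M t *v P j t)" for k t
  have derD: "(P k has_vector_derivative D k t) (at t within {a..b})" if "t \<in> {a..b}" for k t
    using der[OF that] by (cases k) (auto simp: D_def P0)
  define s where "s t = (\<Sum>k. P k t)" for t
  have sums: "(\<lambda>k. P k t) sums s t" if "t \<in> {a..b}" for t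
    unfolding s_def using B[OF that] sumB by (intro summable_sums) (rule summable_comparison_test', auto)
  have sumsD: "(\<lambda>k. D k t) sums (M t *v s t)" if "t \<in> {a..b}" for t
  proof -
    have "(\<lambda>k. M t *v P k t) sums (M t *v s t)"
      by (rule bounded_linear.sums[OF bounded_bilinear.bounded_linear_right[OF bounded_bilinear_matrix_vector_mult] sums[OF that]])
    then show ?thesis using sums_Suc_iff[of "\<lambda>k. D k t" "M t *v s t"] by (simp add: D_def)
  qed
  have unif: "uniform_limit {a..b} (\<lambda>n t. \<Sum>k<n. D k t) (\<lambda>t. \<Sum>k. D k t) sequentially"
  proof (rule Weierstrass_m_test[where M = "\<lambda>k. case k of 0 \<Rightarrow> 0 | Suc j \<Rightarrow> C * B j"])
    show "norm (D k t) \<le> (case k of 0 \<Rightarrow> 0 | Suc j \<Rightarrow> C * B j)" if "t \<in> {a..b}" for k t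
      using C(2)[OF that] B[OF that] mult_left_mono[OF B[OF that] C(1)]
      by (auto simp: D_def split: nat.split intro: order_trans)
    have "summable (\<lambda>k. C * B k)" using sumB by (rule summable_mult)
    then show "summable (\<lambda>k. case k of 0 \<Rightarrow> 0 | Suc j \<Rightarrow> C * B j)"
      by (subst summable_Suc_iff[symmetric]) simp
  qed
  have "\<exists>g. \<forall>t\<in>{a..b}. (\<lambda>k. P k t) sums g t \<and> (g has_derivative (\<lambda>h. h *\<^sub>R (M t *v s t))) (at t within {a..b})"
  proof (rule has_derivative_series[where f' = "\<lambda>k t h. h *\<^sub>R D k t" and x = a and l = "s a"])
    show "(P k has_derivative (\<lambda>h. h *\<^sub>R D k t)) (at t within {a..b})" if "t \<in> {a..b}" for k t
      using derD[OF that] by (simp add: has_vector_derivative_def)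
    show "\<forall>\<^sub>F n in sequentially. \<forall>t\<in>{a..b}. \<forall>h. norm ((\<Sum>k<n. h *\<^sub>R D k t) - h *\<^sub>R (M t *v s t)) \<le> e * norm h"
      if e: "e > 0" for e :: real
      using uniform_limitD[OF unif e]
    proof eventually_elim
      case (elim n)
      show ?case
      proof (intro ballI allI)
        fix t h assume t: "t \<in> {a..b}"
        have "norm ((\<Sum>k<n. D k t) - M t *v s t) \<le> e"
          using elim t sums_unique[OF sumsD[OF t]] by (auto simp: dist_norm less_imp_le)
        then have "norm (h *\<^sub>R ((\<Sum>k<n. D k t) - M t *v s t)) \<le> \<bar>h\<bar> * e"
          by (simp add: mult_left_mono)
        then show "norm ((\<Sum>k<n. h *\<^sub>R D k t) - h *\<^sub>R (M t *v s t)) \<le> e * norm h"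
          by (simp add: scaleR_sum_right[symmetric] scaleR_diff_right mult.commute)
      qed
    qed
  qed (use ab sums in auto)
  then obtain g where g: "\<And>t. t \<in> {a..b} \<Longrightarrow> (\<lambda>k. P k t) sums g t"
    "\<And>t. t \<in> {a..b} \<Longrightarrow> (g has_vector_derivative (M t *v s t)) (at t within {a..b})"
    unfolding has_vector_derivative_def by blast
  have gs: "g t = s t" if "t \<in> {a..b}" for t using sums_unique2[OF g(1) sums] that by blast
  have "s a = s0"
  proof -
    have "(\<lambda>k. P k a) sums s0" unfolding Pa using sums_single[of 0 "\<lambda>_. s0"] by simp
    then show ?thesis using sums_unique2[OF sums] ab by auto
  qed
  moreover have "g a = s a" using gs ab by simp
  ultimately show thesis using that[of g] g(2) gs by auto
qed

text \<open>
  A discrete Gronwall inequality.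
\<close>
lemma perturbed_growth_bound:
  fixes e :: "nat \<Rightarrow> real"
  assumes "e 0 \<le> 0" "c \<ge> 0" "d \<ge> 0" "\<And>k. k < m \<Longrightarrow> e (Suc k) \<le> (1 + c) * e k + d"
  shows "k \<le> m \<Longrightarrow> e k \<le> real k * d * (1 + c) ^ k"
proof (induction k)
  case (Suc k)
  have "(1 + c) * e k \<le> (1 + c) * (real k * d * (1 + c) ^ k)"
    using Suc assms by (intro mult_left_mono) auto
  moreover have "d * 1 \<le> d * (1 + c) ^ Suc k" using assms by (intro mult_left_mono one_le_power) auto
  moreover have "e (Suc k) \<le> (1 + c) * e k + d" using Suc.prems assms(4) by simp
  ultimately show ?case by (simp add: algebra_simps)
qed (use assms in auto)

text \<open>
  Consistency and stability.  The error satisfies the recursion of the scheme up to the local error, which by the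
  uniform continuity of \<open>s\<close> and \<open>s'\<close> is at most \<open>\<epsilon> (1 + C) \<eta>\<close> once the step is small; over \<open>m\<close> steps the Gronwall
  bound makes this at most \<open>(b - a) (1 + C) \<eta> exp (C (b - a))\<close>.
\<close>
lemma euler_product_tendsto:
  fixes M :: "real \<Rightarrow> real ^ 'n::finite ^ 'n"
  assumes ab: "a < b" and M: "continuous_on {a..b} M"
    and s: "\<And>t. t \<in> {a..b} \<Longrightarrow> (s has_vector_derivative M t *v s t) (at t within {a..b})"
  shows "(\<lambda>m. ordered_product (\<lambda>k. mat 1 + ((b - a) / real m) *\<^sub>R M (a + real k * ((b - a) / real m))) m *v s a)
    \<longlonglongrightarrow> s b"
proof -
  obtain C where C: "C \<ge> 0" "\<And>t x. t \<in> {a..b} \<Longrightarrow> norm (M t *v x) \<le> C * norm x"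
    using bounded_matrix_family[OF M] by blast
  have cs: "continuous_on {a..b} s"
    using s has_vector_derivative_continuous unfolding continuous_on_eq_continuous_within by blast
  have cs': "continuous_on {a..b} (\<lambda>t. M t *v s t)"
    by (intro bounded_bilinear.continuous_on[OF bounded_bilinear_matrix_vector_mult] M cs)
  define E where "E = (b - a) * (1 + C) * exp (C * (b - a))"
  have E: "E > 0" using ab C by (simp add: E_def)
  let ?u = "\<lambda>m. ordered_product (\<lambda>k. mat 1 + ((b - a) / real m) *\<^sub>R M (a + real k * ((b - a) / real m)))"
  have main: "\<forall>\<^sub>F m in sequentially. norm (?u m m *v s a - s b) \<le> E * \<eta>" if \<eta>: "\<eta> > 0" for \<eta>
  proof -
    have "uniformly_continuous_on {a..b} s" "uniformly_continuous_on {a..b} (\<lambda>t. M t *v s t)"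
      using cs cs' by (auto intro: compact_uniformly_continuous)
    then obtain \<delta>1 \<delta>2 where \<delta>1: "\<delta>1 > 0" "\<And>t t'. t \<in> {a..b} \<Longrightarrow> t' \<in> {a..b} \<Longrightarrow> dist t' t < \<delta>1 \<Longrightarrow> dist (s t') (s t) < \<eta>"
      and \<delta>2: "\<delta>2 > 0" "\<And>t t'. t \<in> {a..b} \<Longrightarrow> t' \<in> {a..b} \<Longrightarrow> dist t' t < \<delta>2 \<Longrightarrow> dist (M t' *v s t') (M t *v s t) < \<eta>"
      using \<eta> unfolding uniformly_continuous_on_def by metis
    have "(\<lambda>m. (b - a) / real m) \<longlonglongrightarrow> 0" by (rule lim_const_over_n)
    then have "\<forall>\<^sub>F m in sequentially. (b - a) / real m < min \<delta>1 \<delta>2"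
      using \<delta>1 \<delta>2 by (intro order_tendstoD) auto
    then show ?thesis using eventually_gt_at_top[of 0]
    proof eventually_elim
      case (elim m)
      define \<epsilon> where "\<epsilon> = (b - a) / real m"
      define \<tau> where "\<tau> k = a + real k * \<epsilon>" for k
      have \<epsilon>: "\<epsilon> > 0" "\<epsilon> < \<delta>1" "\<epsilon> < \<delta>2" "real m * \<epsilon> = b - a" using elim ab by (auto simp: \<epsilon>_def)
      have \<tau>: "\<tau> k \<in> {a..b}" if "k \<le> m" for k
      proof -
        have "real k * \<epsilon> \<le> real m * \<epsilon>" using that \<epsilon> by (intro mult_right_mono) auto
        then show ?thesis using \<epsilon> by (simp add: \<tau>_def)
      qed
      have step: "\<tau> (Suc k) - \<tau> k = \<epsilon>" for k by (simp add: \<tau>_def algebra_simps)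
      define e where "e k = norm (?u m k *v s a - s (\<tau> k))" for k
      have "e (Suc k) \<le> (1 + \<epsilon> * C) * e k + \<epsilon> * ((1 + C) * \<eta>)" if k: "k < m" for k
      proof -
        let ?t = "\<tau> k" and ?t' = "\<tau> (Suc k)"
        have t: "?t \<in> {a..b}" "?t' \<in> {a..b}" using \<tau> k by auto
        have tt: "?t \<le> ?t'" using step[of k] \<epsilon> by linarith
        have near: "norm (M x *v s x - M ?t' *v s ?t') \<le> \<eta>" if "x \<in> {?t..?t'}" for x
        proof -
          have "dist x ?t' < \<delta>2" using that step[of k] \<epsilon> by (auto simp: dist_real_def)
          then show ?thesis using \<delta>2(2)[of ?t' x] that t by (auto simp: dist_norm less_imp_le)
        qed
        have "norm (s ?t' - s ?t - (?t' - ?t) *\<^sub>R (M ?t' *v s ?t')) \<le> norm (?t' - ?t) * \<eta>"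
        proof (rule vector_differentiable_bound_linearization[where S = "{?t..?t'}" and f' = "\<lambda>t. M t *v s t"])
          show "(s has_vector_derivative M x *v s x) (at x within {?t..?t'})" if "x \<in> {?t..?t'}" for x
            using s[of x] t that by (auto intro: has_vector_derivative_within_subset)
        qed (use near tt in \<open>auto simp: closed_segment_eq_real_ivl\<close>)
        then have r1: "norm (s ?t' - s ?t - \<epsilon> *\<^sub>R (M ?t' *v s ?t')) \<le> \<epsilon> * \<eta>" using \<epsilon> by (simp add: step)
        have "norm (s ?t' - s ?t) \<le> \<eta>"
          using \<delta>1(2)[of ?t ?t'] t step[of k] \<epsilon> by (auto simp: dist_norm dist_real_def less_imp_le)
        then have "C * norm (s ?t' - s ?t) \<le> C * \<eta>" using C by (intro mult_left_mono)
        then have "norm (M ?t' *v (s ?t' - s ?t)) \<le> C * \<eta>" using C(2)[OF t(2), of "s ?t' - s ?t"] by linarith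
        then have r2: "norm (\<epsilon> *\<^sub>R (M ?t' *v (s ?t' - s ?t))) \<le> \<epsilon> * (C * \<eta>)" using \<epsilon> by simp
        define w where "w = ?u m k *v s a - s ?t"
        have r3: "norm (\<epsilon> *\<^sub>R (M ?t' *v w)) \<le> \<epsilon> * (C * norm w)"
          using C(2)[OF t(2), of w] \<epsilon> by simp
        have "?u m (Suc k) *v s a = ?u m k *v s a + \<epsilon> *\<^sub>R (M ?t' *v (?u m k *v s a))"
          by (simp add: matrix_vector_mul_assoc[symmetric] matrix_vector_mult_add_rdistrib
              scaleR_matrix_vector_assoc \<epsilon>_def \<tau>_def)
        then have "?u m (Suc k) *v s a - s ?t' = w + \<epsilon> *\<^sub>R (M ?t' *v w)
            - (s ?t' - s ?t - \<epsilon> *\<^sub>R (M ?t' *v s ?t')) - \<epsilon> *\<^sub>R (M ?t' *v (s ?t' - s ?t))"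
          by (simp add: w_def matrix_vector_mult_diff_distrib scaleR_diff_right algebra_simps)
        then have "e (Suc k) \<le> norm w + \<epsilon> * (C * norm w) + \<epsilon> * \<eta> + \<epsilon> * (C * \<eta>)"
        proof -
          have "norm (w + p - q - r) \<le> norm w + norm p + norm q + norm r" for p q r :: "real ^ 'n" by norm
          then show ?thesis unfolding e_def \<open>?u m (Suc k) *v s a - s ?t' = _\<close>
            using r1 r2 r3 by (smt (verit))
        qed
        then show ?thesis by (simp add: e_def w_def algebra_simps)
      qed
      moreover have "e 0 \<le> 0" by (simp add: e_def \<tau>_def)
      ultimately have "e m \<le> real m * (\<epsilon> * ((1 + C) * \<eta>)) * (1 + \<epsilon> * C) ^ m"
        using \<epsilon> C \<eta> by (intro perturbed_growth_bound[where m = m]) auto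
      also have "(1 + \<epsilon> * C) ^ m \<le> exp (\<epsilon> * C) ^ m"
        using \<epsilon> C by (intro power_mono exp_ge_add_one_self) auto
      also have "exp (\<epsilon> * C) ^ m = exp (C * (b - a))"
        unfolding exp_of_nat_mult[symmetric] \<epsilon>(4)[symmetric] by (simp add: mult_ac)
      also have "real m * (\<epsilon> * ((1 + C) * \<eta>)) * exp (C * (b - a)) = E * \<eta>"
        by (simp add: E_def \<epsilon>(4)[symmetric] mult_ac)
      finally show ?case using \<epsilon>(4) \<epsilon> C \<eta> by (simp add: e_def \<tau>_def mult_left_mono)
    qed
  qed
  show ?thesis
  proof (rule LIMSEQ_I)
    fix r :: real assume r: "r > 0"
    have "\<forall>\<^sub>F m in sequentially. norm (?u m m *v s a - s b) \<le> E * (r / (2 * E))"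
      using r E by (intro main) auto
    moreover have "E * (r / (2 * E)) < r" using r E by simp
    ultimately have "\<forall>\<^sub>F m in sequentially. norm (?u m m *v s a - s b) < r"
      by (auto elim: eventually_mono)
    then show "\<exists>no. \<forall>m\<ge>no. norm (?u m m *v s a - s b) < r" by (simp add: eventually_sequentially)
  qed
qed

section \<open>Local Finsler geometry\<close>

definition fiber_scale :: "real \<Rightarrow> (real ^ 'n) \<times> (real ^ 'n) \<Rightarrow> (real ^ 'n) \<times> (real ^ 'n)" where
  "fiber_scale r w = (fst w, r *\<^sub>R snd w)"

text \<open>
  Differentiating a homogeneous function in a fiber direction lowers the degree by one.  The general factor
  \<open>\<kappa>\<close> lets the rule be applied twice in a row.
\<close>
lemma fiber_derivative_scale:
  fixes f :: "(real ^ 'n::finite) \<times> (real ^ 'n) \<Rightarrow> real"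
  assumes S: "open S" "w \<in> S" and diff: "f differentiable (at w)" "f differentiable (at (fiber_scale r w))"
    and scale: "\<And>w. w \<in> S \<Longrightarrow> f (fiber_scale r w) = \<kappa> * f w"
  shows "r * ddy i f (fiber_scale r w) = \<kappa> * ddy i f w"
proof -
  have lin: "bounded_linear (fiber_scale r :: (real ^ 'n) \<times> (real ^ 'n) \<Rightarrow> _)"
    unfolding fiber_scale_def[abs_def]
    by (intro bounded_linear_Pair bounded_linear_fst bounded_linear_compose[OF bounded_linear_scaleR_right] bounded_linear_snd)
  have D: "(f has_derivative frechet_derivative f (at (fiber_scale r w))) (at (fiber_scale r w))"
    using diff(2) by (simp add: frechet_derivative_works)
  have "((\<lambda>w. f (fiber_scale r w)) has_derivative (\<lambda>h. frechet_derivative f (at (fiber_scale r w)) (fiber_scale r h))) (at w)"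
    by (rule has_derivative_compose[OF bounded_linear_imp_has_derivative[OF lin] D])
  then have 1: "((\<lambda>w. \<kappa> * f w) has_derivative (\<lambda>h. frechet_derivative f (at (fiber_scale r w)) (fiber_scale r h))) (at w)"
    by (rule has_derivative_transform_within_open[OF _ S]) (rule scale)
  have 2: "((\<lambda>w. \<kappa> * f w) has_derivative (\<lambda>h. \<kappa> * frechet_derivative f (at w) h)) (at w)"
    using diff(1) by (intro has_derivative_mult_right) (simp add: frechet_derivative_works)
  have "frechet_derivative f (at (fiber_scale r w)) (fiber_scale r (0, axis i 1)) = \<kappa> * ddy i f w"
    using fun_cong[OF has_derivative_unique[OF 1 2], of "(0, axis i 1)"] by (simp add: ddy_def)
  moreover have "fiber_scale r (0, axis i 1) = r *\<^sub>R (0, axis i 1 :: real ^ 'n)" by (simp add: fiber_scale_def)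
  ultimately show ?thesis
    using linear_scale[OF linear_frechet_derivative[OF diff(2)], of r "(0, axis i 1)"] by (simp add: ddy_def)
qed

text \<open>
  The function vanishes along the ray through \<open>y\<close>, hence so does its derivative in the direction of the ray.
\<close>
lemma radial_derivative_zero:
  fixes f :: "(real ^ 'n::finite) \<times> (real ^ 'n) \<Rightarrow> real"
  assumes "f differentiable (at (x, y))" "\<And>t. t > 0 \<Longrightarrow> f (x, t *\<^sub>R y) = 0"
  shows "frechet_derivative f (at (x, y)) (0, y) = 0"
proof -
  let ?D = "frechet_derivative f (at (x, y))"
  have D: "(f has_derivative ?D) (at (x, 1 *\<^sub>R y))" using assms(1) by (simp add: frechet_derivative_works)
  have c: "((\<lambda>t. (x, t *\<^sub>R y)) has_derivative (\<lambda>t. (0, t *\<^sub>R y))) (at (1::real))"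
    by (intro has_derivative_Pair has_derivative_const bounded_linear_imp_has_derivative bounded_linear_scaleR_left)
  have "((\<lambda>t. f (x, t *\<^sub>R y)) has_derivative (\<lambda>t. ?D (0, t *\<^sub>R y))) (at (1::real))"
    by (rule has_derivative_compose[OF c D])
  then have "((\<lambda>t. 0) has_derivative (\<lambda>t. ?D (0, t *\<^sub>R y))) (at (1::real))"
    by (rule has_derivative_transform_within_open[of _ _ _ _ "{0<..}"]) (auto simp: assms(2))
  from fun_cong[OF has_derivative_unique[OF this has_derivative_const], of 1]
  show ?thesis by simp
qed

lemma sum_axis_components: "(\<Sum>i\<in>UNIV. (y $ i) *\<^sub>R axis i 1) = (y :: real ^ 'n::finite)"
  using basis_expansion[of y] by (simp add: scalar_mult_eq_scaleR)

lemma fiber_derivative_expand: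
  fixes f :: "(real ^ 'n::finite) \<times> (real ^ 'n) \<Rightarrow> real"
  assumes "f differentiable (at w)"
  shows "frechet_derivative f (at w) (0, y) = (\<Sum>i\<in>UNIV. y $ i * ddy i f w)"
proof -
  have l: "linear (frechet_derivative f (at w))" by (rule linear_frechet_derivative[OF assms])
  have "(0, y) = (\<Sum>i\<in>UNIV. (y $ i) *\<^sub>R (0 :: real ^ 'n, axis i 1))"
    by (simp add: prod_eq_iff fst_sum snd_sum sum_axis_components)
  then show ?thesis by (simp only: linear_sum[OF l] linear_scale[OF l] ddy_def real_scaleR_def)
qed

lemma det_nonzero_of_positive_definite:
  fixes G :: "real ^ 'n::finite ^ 'n"
  assumes "\<And>\<xi>. \<xi> \<noteq> 0 \<Longrightarrow> (\<Sum>i\<in>UNIV. \<Sum>j\<in>UNIV. G $ i $ j * \<xi> $ i * \<xi> $ j) > 0"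
  shows "det G \<noteq> 0"
proof
  assume "det G = 0"
  then have "\<not> invertible G" by (simp add: invertible_det_nz)
  then obtain \<xi> where \<xi>: "G *v \<xi> = 0" "\<xi> \<noteq> 0"
    using invertible_left_inverse matrix_left_invertible_ker by blast
  have "(\<Sum>i\<in>UNIV. \<Sum>j\<in>UNIV. G $ i $ j * \<xi> $ i * \<xi> $ j) = (\<Sum>i\<in>UNIV. \<xi> $ i * (G *v \<xi>) $ i)"
    by (simp add: matrix_vector_mult_def sum_distrib_left mult_ac)
  then show False using assms[OF \<xi>(2)] \<xi>(1) by simp
qed

text \<open>
  A Finsler function in natural coordinates over the coordinate domain \<open>\<Omega>\<close>.
\<close>
locale local_finsler =
  fixes L :: "(real ^ 'n::finite) \<times> (real ^ 'n) \<Rightarrow> real" and \<Omega> :: "(real ^ 'n) set"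
  assumes open_domain: "open \<Omega>"
    and smooth: "smooth_on (\<Omega> \<times> (- {0})) L"
    and nonneg: "w \<in> \<Omega> \<times> (- {0}) \<Longrightarrow> L w \<ge> 0"
    and homogeneous: "w \<in> \<Omega> \<times> (- {0}) \<Longrightarrow> r > 0 \<Longrightarrow> L (fiber_scale r w) = r * L w"
    and positive_definite: "w \<in> \<Omega> \<times> (- {0}) \<Longrightarrow> \<xi> \<noteq> 0 \<Longrightarrow>
      (\<Sum>i\<in>UNIV. \<Sum>j\<in>UNIV. fundamental L w $ i $ j * \<xi> $ i * \<xi> $ j) > 0"
begin

abbreviation slit :: "((real ^ 'n) \<times> (real ^ 'n)) set" where "slit \<equiv> \<Omega> \<times> (- {0})"

lemma open_slit: "open slit" using open_domain by (intro open_Times) auto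

lemma fiber_scale_slit: "w \<in> slit \<Longrightarrow> r > 0 \<Longrightarrow> fiber_scale r w \<in> slit"
  by (auto simp: fiber_scale_def)

lemma ddy_smooth: "smooth_on slit f \<Longrightarrow> smooth_on slit (ddy i f)"
  and ddx_smooth: "smooth_on slit f \<Longrightarrow> smooth_on slit (ddx i f)"
  unfolding ddy_def[abs_def] ddx_def[abs_def] by (rule smooth_on_derivative, assumption)+

lemma energy_smooth: "smooth_on slit (\<lambda>w. (L w)\<^sup>2)"
  unfolding power2_eq_square by (intro smooth_on_mult open_slit smooth)

lemma fundamental_smooth: "smooth_on slit (\<lambda>w. fundamental L w $ i $ j)"
  unfolding fundamental_def by (simp, intro smooth_on_divide smooth_on_mult smooth_on_const open_slit ddy_smooth energy_smooth) simp

lemma det_fundamental: "w \<in> slit \<Longrightarrow> det (fundamental L w) \<noteq> 0"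
  by (rule det_nonzero_of_positive_definite[OF positive_definite])

text \<open>
  The square of \<open>L\<close> is homogeneous of degree \<open>2\<close> and is differentiated twice.
\<close>
lemma fundamental_scale:
  assumes w: "w \<in> slit" and r: "r > 0"
  shows "fundamental L (fiber_scale r w) = fundamental L w"
proof -
  let ?E = "\<lambda>w. (L w)\<^sup>2"
  have E: "?E (fiber_scale r w) = r\<^sup>2 * ?E w" if "w \<in> slit" for w
    using homogeneous[OF that r] by (simp add: power_mult_distrib)
  have d: "f differentiable (at w)" if "smooth_on slit f" "w \<in> slit" for f :: "_ \<Rightarrow> real" and w
    by (rule smooth_on_differentiable[OF that])
  have 1: "ddy j ?E (fiber_scale r w) = r * ddy j ?E w" if "w \<in> slit" for j w
    using fiber_derivative_scale[OF open_slit that d[OF energy_smooth that] d[OF energy_smooth fiber_scale_slit[OF that r]] E, of j] r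
    by (simp add: power2_eq_square)
  have "ddy i (ddy j ?E) (fiber_scale r w) = ddy i (ddy j ?E) w" for i j
    using fiber_derivative_scale[OF open_slit w d[OF ddy_smooth[OF energy_smooth] w]
        d[OF ddy_smooth[OF energy_smooth] fiber_scale_slit[OF w r]] 1, of i j] r by simp
  then show ?thesis by (simp add: fundamental_def)
qed

text \<open>
  If \<open>L\<close> vanished at \<open>(x, y)\<close> then by homogeneity it would vanish along the ray through \<open>y\<close>, and the second
  derivative of its square in the direction \<open>y\<close>, which is \<open>2 g(y, y)\<close>, would be \<open>0\<close>.
\<close>
lemma positive:
  assumes w: "w \<in> slit" shows "L w > 0"
proof (rule ccontr)
  assume "\<not> L w > 0"
  then have L0: "L w = 0" using nonneg[OF w] by simp
  obtain x y where xy: "w = (x, y)" "x \<in> \<Omega>" "y \<noteq> 0" using w by auto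
  let ?E = "\<lambda>w. (L w)\<^sup>2"
  have E0: "?E (x, t *\<^sub>R y) = 0" if "t > 0" for t
    using homogeneous[OF w that] L0 by (simp add: fiber_scale_def xy)
  have d: "f differentiable (at (x, t *\<^sub>R y))" if "smooth_on slit f" "t > 0" for f :: "_ \<Rightarrow> real" and t
    by (rule smooth_on_differentiable[OF that(1)]) (use xy that in auto)
  define h where "h = (\<lambda>w. \<Sum>j\<in>UNIV. y $ j * ddy j ?E w)"
  have h0: "h (x, t *\<^sub>R y) = 0" if t: "t > 0" for t
  proof -
    have "frechet_derivative ?E (at (x, t *\<^sub>R y)) (0, t *\<^sub>R y) = 0"
      by (rule radial_derivative_zero[OF d[OF energy_smooth t]]) (use E0 t in simp)
    then have "t * h (x, t *\<^sub>R y) = 0"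
      unfolding fiber_derivative_expand[OF d[OF energy_smooth t]] h_def by (simp add: sum_distrib_left mult_ac)
    then show ?thesis using t by simp
  qed
  have hs: "smooth_on slit h"
    unfolding h_def by (intro smooth_on_sum smooth_on_mult smooth_on_const open_slit ddy_smooth energy_smooth)
  have dj: "ddy j ?E differentiable (at (x, y))" for j using d[OF ddy_smooth[OF energy_smooth], of 1] by simp
  have "(h has_derivative (\<lambda>v. \<Sum>j\<in>UNIV. y $ j * frechet_derivative (ddy j ?E) (at (x, y)) v)) (at (x, y))"
    unfolding h_def using dj by (intro has_derivative_sum has_derivative_mult_right) (simp add: frechet_derivative_works)
  from frechet_derivative_at[OF this]
  have "(\<Sum>j\<in>UNIV. y $ j * frechet_derivative (ddy j ?E) (at (x, y)) (0, y)) = 0"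
    using radial_derivative_zero[of h x y] d[OF hs, of 1] h0 by (simp add: fun_eq_iff)
  then have "(\<Sum>j\<in>UNIV. \<Sum>i\<in>UNIV. y $ j * (y $ i * ddy i (ddy j ?E) (x, y))) = 0"
    unfolding fiber_derivative_expand[OF dj] by (simp add: sum_distrib_left)
  then have "(\<Sum>i\<in>UNIV. \<Sum>j\<in>UNIV. y $ j * (y $ i * ddy i (ddy j ?E) (x, y))) = 0"
    by (subst sum.swap)
  moreover have "(\<Sum>i\<in>UNIV. \<Sum>j\<in>UNIV. fundamental L w $ i $ j * y $ i * y $ j) =
      (\<Sum>i\<in>UNIV. \<Sum>j\<in>UNIV. y $ j * (y $ i * ddy i (ddy j ?E) (x, y))) / 2"
    by (simp add: fundamental_def xy sum_divide_distrib mult_ac)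
  ultimately show False using positive_definite[OF w xy(3)] by simp
qed

lemma matrix_inv_smooth: "smooth_on slit (\<lambda>w. matrix_inv (fundamental L w) $ i $ j)"
  by (intro smooth_on_matrix_inv open_slit fundamental_smooth det_fundamental)

lemma nonlinear_coeff_smooth: "smooth_on slit (nonlinear_coeff L i j)"
proof -
  have ne: "L w \<noteq> 0" if "w \<in> slit" for w using positive[OF that] by simp
  have chr: "smooth_on slit (formal_christoffel L i j k)" for i j k
    unfolding formal_christoffel_def[abs_def]
    by (intro smooth_on_mult smooth_on_const smooth_on_sum smooth_on_add smooth_on_diff open_slit
        matrix_inv_smooth ddx_smooth fundamental_smooth)
  have "smooth_on slit (\<lambda>w. L w / 2)" using smooth_on_divide[OF open_slit _ smooth smooth_on_const[OF open_slit, of 2]] by simp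
  then have car: "smooth_on slit (cartan L i j k)" for i j k
    unfolding cartan_def[abs_def] cartan_lower_def
    by (intro smooth_on_sum smooth_on_mult open_slit matrix_inv_smooth ddy_smooth fundamental_smooth)
  have y: "smooth_on slit (\<lambda>w. snd w $ k)" for k
    by (rule smooth_on_id_linear[OF bounded_linear_compose[OF bounded_linear_vec_nth bounded_linear_snd] open_slit])
  have yL: "smooth_on slit (\<lambda>w. snd w $ k / L w)" for k
    by (intro smooth_on_divide open_slit ne smooth y)
  show ?thesis
    unfolding nonlinear_coeff_def[abs_def]
    by (intro smooth_on_mult smooth_on_diff smooth_on_sum open_slit smooth chr car yL)
qed

lemma fiber_smooth: "x \<in> \<Omega> \<Longrightarrow> smooth_on (- {0}) (\<lambda>y. L (x, y))"
  using smooth_on_affine[of "\<lambda>y. (0, y)" "- {0}" "(x, 0)" slit L] smooth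
  by (simp add: bounded_linear_Pair bounded_linear_zero bounded_linear_ident open_Compl)

text \<open>
  The absolute value is the one that the choice of the orientation puts into the volume form.
\<close>
definition volume_factor :: "(real ^ 'n) \<times> (real ^ 'n) \<Rightarrow> real" where
  "volume_factor w = sqrt \<bar>det (fundamental L w)\<bar>"

lemma volume_factor_continuous: "continuous_on slit volume_factor"
  unfolding volume_factor_def[abs_def]
  by (intro continuous_intros smooth_on_continuous_on smooth_on_det fundamental_smooth open_slit)

lemma cone_data: "x \<in> \<Omega> \<Longrightarrow> cone_data (\<lambda>y. L (x, y)) (\<lambda>y. volume_factor (x, y))"
proof unfold_locales
  assume x: "x \<in> \<Omega>"
  show "continuous_on (- {0}) (\<lambda>y. L (x, y))" by (rule smooth_on_continuous_on[OF fiber_smooth[OF x]])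
  show "continuous_on (- {0}) (\<lambda>y. volume_factor (x, y))"
    by (rule continuous_on_compose2[OF volume_factor_continuous]) (use x in \<open>auto intro!: continuous_intros\<close>)
  fix y :: "real ^ 'n" assume y: "y \<noteq> 0"
  then have w: "(x, y) \<in> slit" using x by simp
  show "L (x, y) > 0" by (rule positive[OF w])
  show "volume_factor (x, y) > 0" using det_fundamental[OF w] by (simp add: volume_factor_def)
  fix r :: real assume r: "r > 0"
  show "L (x, r *\<^sub>R y) = r * L (x, y)" using homogeneous[OF w r] by (simp add: fiber_scale_def)
  show "volume_factor (x, r *\<^sub>R y) = volume_factor (x, y)"
    using fundamental_scale[OF w r] by (simp add: fiber_scale_def volume_factor_def)
qed

lemma indicatrix_measure:
  "x \<in> \<Omega> \<Longrightarrow> indicatrix_measure L x {y. y \<noteq> 0 \<and> L (x, y) = 1} =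
    cone_data.cone_measure (\<lambda>y. L (x, y)) (\<lambda>y. volume_factor (x, y))"
  using indicatrix_measure_eq_cone_measure[of L x, OF cone_data[unfolded volume_factor_def] fiber_smooth]
    cone_data.unit_sphere_def[OF cone_data]
  by (simp add: volume_factor_def)

end

text \<open>
  By compactness the integrands at nearby parameters are uniformly close on all of \<open>K\<close>.
\<close>
lemma continuous_on_integral_compact:
  fixes H :: "'a::topological_space \<Rightarrow> 'e::euclidean_space \<Rightarrow> 'b::{banach, second_countable_topology}"
  assumes K: "compact K" and H: "continuous_on (U \<times> K) (\<lambda>(x, y). H x y)"
  shows "continuous_on U (\<lambda>x. LBINT y. indicator K y *\<^sub>R H x y)"
  unfolding continuous_on_def
proof (intro ballI tendstoI)
  fix x0 and e :: real assume x0: "x0 \<in> U" and e: "e > 0"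
  define \<epsilon> where "\<epsilon> = e / (2 * (measure lborel K + 1))"
  have mK: "measure lborel K \<ge> 0" by simp
  have \<epsilon>: "\<epsilon> > 0" using e mK by (simp add: \<epsilon>_def add_nonneg_pos)
  obtain X0 where X0: "x0 \<in> X0" "open X0" and
    "\<forall>x\<in>X0 \<inter> U. \<forall>t\<in>K. dist ((\<lambda>(x, y). H x y) (x, t)) ((\<lambda>(x, y). H x y) (x0, t)) \<le> \<epsilon>"
    by (rule continuous_on_prod_compactE[OF H K x0 \<epsilon>])
  then have near: "dist (H x t) (H x0 t) \<le> \<epsilon>" if "x \<in> X0 \<inter> U" "t \<in> K" for x t
    using that by simp
  have int: "integrable lborel (\<lambda>y. indicator K y *\<^sub>R H x y)" if "x \<in> U" for x
  proof (rule borel_integrable_compact[OF K])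
    show "continuous_on K (H x)"
    proof -
      have 1: "continuous_on K (\<lambda>y. (x, y))" by (intro continuous_intros)
      have "(\<lambda>y. (x, y)) ` K \<subseteq> U \<times> K" using that by auto
      from continuous_on_compose2[OF H 1 this] show ?thesis by simp
    qed
  qed
  have intK: "integrable lborel (\<lambda>y. indicator K y *\<^sub>R \<epsilon>)"
    by (rule borel_integrable_compact[OF K]) simp
  show "\<forall>\<^sub>F x in at x0 within U. dist (LBINT y. indicator K y *\<^sub>R H x y) (LBINT y. indicator K y *\<^sub>R H x0 y) < e"
    unfolding eventually_at_topological
  proof (intro exI conjI ballI impI)
    fix x assume x: "x \<in> X0" "x \<in> U"
    have "norm ((LBINT y. indicator K y *\<^sub>R H x y) - (LBINT y. indicator K y *\<^sub>R H x0 y)) =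
        norm (LBINT y. indicator K y *\<^sub>R H x y - indicator K y *\<^sub>R H x0 y)"
      by (subst Bochner_Integration.integral_diff[OF int[OF x(2)] int[OF x0]]) simp
    also have "\<dots> \<le> (LBINT y. norm (indicator K y *\<^sub>R H x y - indicator K y *\<^sub>R H x0 y))"
      by (rule integral_norm_bound)
    also have "\<dots> \<le> (LBINT y. indicator K y *\<^sub>R \<epsilon>)"
    proof (rule integral_mono)
      show "integrable lborel (\<lambda>y. norm (indicator K y *\<^sub>R H x y - indicator K y *\<^sub>R H x0 y))"
        by (intro integrable_norm Bochner_Integration.integrable_diff int x x0)
      show "norm (indicator K y *\<^sub>R H x y - indicator K y *\<^sub>R H x0 y) \<le> indicator K y *\<^sub>R \<epsilon>" for y
        using near[of x y] x by (auto simp: indicator_def dist_norm)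
    qed (rule intK)
    also have "(LBINT y. indicator K y *\<^sub>R \<epsilon>) = measure lborel K * \<epsilon>" by simp
    also have "\<dots> < e"
    proof -
      have "measure lborel K * \<epsilon> \<le> (measure lborel K + 1) * \<epsilon>" using \<epsilon> by (intro mult_right_mono) auto
      also have "\<dots> = e / 2"
      proof -
        have "measure lborel K + 1 > 0" using mK by linarith
        then show ?thesis by (simp add: \<epsilon>_def field_simps)
      qed
      finally show ?thesis using e by simp
    qed
    finally show "dist (LBINT y. indicator K y *\<^sub>R H x y) (LBINT y. indicator K y *\<^sub>R H x0 y) < e"
      by (simp add: dist_norm)
  qed (use X0 in auto)
qed

section \<open>Integrals over the indicatrix\<close>

context cone_data
begin

lemma radial_proj_continuous: "continuous_on (- {0}) radial_proj"
  unfolding radial_proj_def[abs_def] using N_pos by (intro continuous_intros cont_N) force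

text \<open>
  Continuity is asked for off the origin only, because functions on a fiber of the slit bundle are unspecified at
  the zero vector; the annulus avoids it.
\<close>
lemma
  fixes h :: "real ^ 'n \<Rightarrow> 'b::{banach, second_countable_topology}"
  assumes h: "continuous_on (- {0}) h"
  shows weighted_integrable: "integrable lborel (\<lambda>y. cone_weight y *\<^sub>R h (radial_proj y))"
    and integral_cone_measure: "integral\<^sup>L cone_measure h = (LBINT y. cone_weight y *\<^sub>R h (radial_proj y))"
proof -
  have p: "radial_proj ` annulus \<subseteq> - {0}" "annulus \<subseteq> - {0 :: real ^ 'n}"
  proof -
    show 2: "annulus \<subseteq> - {0 :: real ^ 'n}" by (auto simp: annulus_def)
    show "radial_proj ` annulus \<subseteq> - {0}"
    proof
      fix z assume "z \<in> radial_proj ` annulus"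
      then obtain y where "y \<in> annulus" "z = radial_proj y" by blast
      moreover from this have "y \<noteq> 0" by (auto simp: annulus_def)
      ultimately show "z \<in> - {0}" using radial_proj_unit_sphere[of y] by (auto simp: unit_sphere_def)
    qed
  qed
  have ne: "\<forall>y\<in>annulus. N y ^ CARD('n) \<noteq> 0"
  proof
    fix y :: "real ^ 'n" assume "y \<in> annulus"
    then have "N y > 0" using N_pos[of y] zero_notin_annulus by metis
    then show "N y ^ CARD('n) \<noteq> 0" by simp
  qed
  have "continuous_on annulus (\<lambda>y. (q y / N y ^ CARD('n)) *\<^sub>R h (radial_proj y))"
    by (intro continuous_on_scaleR continuous_on_divide continuous_on_power ne
        continuous_on_subset[OF cont_N p(2)] continuous_on_subset[OF cont_q p(2)]
        continuous_on_compose2[OF h continuous_on_subset[OF radial_proj_continuous p(2)] p(1)])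
  from borel_integrable_compact[OF compact_annulus this]
  show "integrable lborel (\<lambda>y. cone_weight y *\<^sub>R h (radial_proj y))" by (simp add: cone_weight_def)
  have [measurable]: "h \<in> borel_measurable borel" using h by (rule measurable_off_zero)
  show "integral\<^sup>L cone_measure h = (LBINT y. cone_weight y *\<^sub>R h (radial_proj y))"
    unfolding cone_measure_def
    by (subst integral_distr, simp, simp, subst integral_density) (simp_all add: cone_weight_nonneg)
qed

lemma measure_cone_measure: "measure cone_measure UNIV = (LBINT y. cone_weight y)"
proof -
  have "emeasure cone_measure UNIV = (\<integral>\<^sup>+y. ennreal (cone_weight y) \<partial>lborel)"
    unfolding cone_measure_def by (subst emeasure_distr) (auto simp: emeasure_density)
  also have "\<dots> = ennreal (LBINT y. cone_weight y)"
    by (rule nn_integral_eq_integral[OF cone_weight_integrable]) (simp add: cone_weight_nonneg)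
  finally show ?thesis by (simp add: measure_def cone_weight_nonneg)
qed

text \<open>
  The weight is positive on the annulus, which contains a ball: as \<open>e \<ge> 5/2\<close>, the ball of radius \<open>1/2\<close> around a
  point of norm \<open>2\<close> will do.
\<close>
lemma total_weight_pos: "(LBINT y. cone_weight y) > 0"
proof -
  have "(LBINT y. cone_weight y) \<noteq> 0"
  proof
    assume "(LBINT y. cone_weight y) = 0"
    then have "AE y in lborel. cone_weight y = 0"
      using integral_nonneg_eq_0_iff_AE[OF cone_weight_integrable] by (simp add: cone_weight_nonneg)
    moreover have "cone_weight y \<noteq> 0" if y: "y \<in> annulus" for y
    proof -
      have "y \<noteq> 0" using y zero_notin_annulus by metis
      then show ?thesis using N_pos[of y] q_pos[of y] y by (simp add: cone_weight_def)
    qed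
    ultimately have "AE y in lborel. (y :: real ^ 'n) \<notin> annulus" by (auto elim: eventually_mono)
    moreover have "{y \<in> space lborel. \<not> (y :: real ^ 'n) \<notin> annulus} = annulus" by simp
    ultimately have "emeasure lborel (annulus :: (real ^ 'n) set) = 0"
      using AE_iff_measurable[of "annulus :: (real ^ 'n) set" lborel "\<lambda>y. y \<notin> annulus"] by simp
    moreover have "emeasure lborel (annulus :: (real ^ 'n) set) \<ge> emeasure lborel (ball (2 *\<^sub>R axis undefined 1 :: real ^ 'n) (1/2))"
    proof (rule emeasure_mono)
      have e2: "exp 1 \<ge> (5/2 :: real)"
        using exp_lower_Taylor_quadratic[of 1] by simp
      show "ball (2 *\<^sub>R axis undefined 1 :: real ^ 'n) (1/2) \<subseteq> annulus"
      proof
        fix y :: "real ^ 'n" assume "y \<in> ball (2 *\<^sub>R axis undefined 1) (1/2)"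
        then have d: "norm (2 *\<^sub>R axis undefined 1 - y) < 1/2" by (simp add: dist_norm)
        have "norm (2 *\<^sub>R axis undefined 1 :: real ^ 'n) = 2" by simp
        then have "norm y \<ge> 2 - 1/2" "norm y \<le> 2 + 1/2"
          using d norm_triangle_ineq2[of "2 *\<^sub>R axis undefined 1" y]
            norm_triangle_ineq2[of y "2 *\<^sub>R axis undefined 1"] by (simp_all add: norm_minus_commute)
        then show "y \<in> annulus" using e2 by (simp add: annulus_def)
      qed
    qed simp
    moreover have "emeasure lborel (ball (2 *\<^sub>R axis undefined 1 :: real ^ 'n) (1/2)) > 0"
    proof -
      let ?B = "ball (2 *\<^sub>R axis undefined 1 :: real ^ 'n) (1/2)"
      have "\<not> negligible ?B" by (rule open_not_negligible) auto
      then have "emeasure lebesgue ?B \<noteq> 0" by (subst (asm) negligible_iff_emeasure0) auto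
      then show ?thesis by (simp add: zero_less_iff_neq_zero)
    qed
    ultimately show False by simp
  qed
  moreover have "(LBINT y. cone_weight y) \<ge> 0" by (simp add: cone_weight_nonneg)
  ultimately show ?thesis by simp
qed

end

section \<open>The average connection in a chart\<close>

locale finsler_connection =
  fixes A :: "('a::{t2_space, second_countable_topology}, real ^ 'n::finite) chart set"
    and F :: "('a, 'n) bundle_point \<Rightarrow> real"
    and nabla :: "('a, 'n) bundle_point \<Rightarrow> ('a, 'n) bundle_tangent
      \<Rightarrow> (('a, 'n) bundle_point \<Rightarrow> ('a, real ^ 'n) tangent) \<Rightarrow> ('a, real ^ 'n) tangent"
  assumes finsler: "finsler_space A F" and connection: "linear_connection A nabla"
begin

sublocale smooth_manifold A
  using finsler by unfold_locales (simp add: finsler_space_def)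

abbreviation chart_dom :: "('a, real ^ 'n) chart \<Rightarrow> (real ^ 'n) set" where "chart_dom c \<equiv> snd c ` fst c"

lemma local_rep_eq:
  assumes "c \<in> A" "x \<in> chart_dom c" "y \<noteq> 0"
  shows "local_rep A F c (x, y) = F (chart_inv c x, tangent_of A c (chart_inv c x) y)"
  using slit_chart_inv[OF assms] by (simp add: local_rep_def)

lemma local_finsler:
  assumes c: "c \<in> A" shows "local_finsler (local_rep A F c) (chart_dom c)"
proof
  show "open (chart_dom c)" by (rule base.image_open[OF c])
  show "smooth_on (chart_dom c \<times> - {0}) (local_rep A F c)" using finsler c by (simp add: finsler_space_def)
  show "0 < (\<Sum>i\<in>UNIV. \<Sum>j\<in>UNIV. fundamental (local_rep A F c) w $ i $ j * \<xi> $ i * \<xi> $ j)"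
    if "w \<in> chart_dom c \<times> - {0}" "\<xi> \<noteq> 0" for w and \<xi> :: "real ^ 'n"
    using finsler c that unfolding finsler_space_def by blast
  fix w assume "w \<in> chart_dom c \<times> (- {0} :: (real ^ 'n) set)"
  then obtain x y where w: "w = (x, y)" "x \<in> chart_dom c" "y \<noteq> 0" by auto
  let ?p = "chart_inv c x"
  have p: "?p \<in> fst c" by (rule base.chart_inv_in[OF w(2)])
  note t = base.tangent_of_in[OF c p]
  show "local_rep A F c w \<ge> 0"
    using finsler t[of y] unfolding w(1) local_rep_eq[OF c w(2,3)] finsler_space_def by blast
  fix r :: real assume r: "r > 0"
  have "tangent_of A c ?p (r *\<^sub>R y) = (\<lambda>k. r *\<^sub>R tangent_of A c ?p y k)"
    using base.tangent_of_lincomb[OF c p, of r y 0 0] by simp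
  moreover have "F (?p, \<lambda>k. r *\<^sub>R tangent_of A c ?p y k) = r * F (?p, tangent_of A c ?p y)"
    using finsler t[of y] less_imp_le[OF r] unfolding finsler_space_def by blast
  ultimately show "local_rep A F c (fiber_scale r w) = r * local_rep A F c w"
    using r w by (simp add: fiber_scale_def local_rep_eq[OF c])
qed

text \<open>
  The zero vector is not on the indicatrix, because homogeneity with the factor \<open>0\<close> makes \<open>F\<close> vanish there.
\<close>
lemma indicatrix_components:
  assumes c: "c \<in> A" and p: "p \<in> fst c"
  shows "(\<lambda>v. v c) ` indicatrix A F p = {y. y \<noteq> 0 \<and> local_rep A F c (snd c p, y) = 1}"
proof -
  have inv: "chart_inv c (snd c p) = p" and x: "snd c p \<in> chart_dom c" using base.chart_inv_chart[OF c p] p by auto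
  have "v c \<noteq> 0 \<and> local_rep A F c (snd c p, v c) = 1" if v: "v \<in> tangent_space A p" and F1: "F (p, v) = 1" for v
  proof -
    have "F (p, \<lambda>k. 0 *\<^sub>R v k) = 0 * F (p, v)"
      using finsler v order_refl[of "0::real"] unfolding finsler_space_def by blast
    then have F0: "F (p, \<lambda>_. 0) = 0" by simp
    have "v c \<noteq> 0"
    proof
      assume "v c = 0"
      then have "v = (\<lambda>_. 0)"
        using base.tangent_eqI[OF v base.tangent_space_zero[OF c p] c p] by simp
      then show False using F0 F1 by simp
    qed
    then show ?thesis using F1 base.tangent_of_eqI[OF c p v refl] by (simp add: local_rep_eq[OF c x] inv)
  qed
  moreover have "y \<in> (\<lambda>v. v c) ` indicatrix A F p" if "y \<noteq> 0" "local_rep A F c (snd c p, y) = 1" for y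
    using that base.tangent_of_in[OF c p, of y] base.tangent_of_component[OF c p, of y]
    by (intro image_eqI[of _ _ "tangent_of A c p y"]) (auto simp: indicatrix_def local_rep_eq[OF c x] inv)
  ultimately show ?thesis by (auto simp: indicatrix_def)
qed

text \<open>
  The cone weight and the radial projection of the fiber over the point with coordinates \<open>x\<close>.
\<close>
definition fiber_weight :: "('a, real ^ 'n) chart \<Rightarrow> real ^ 'n \<Rightarrow> real ^ 'n \<Rightarrow> real" where
  "fiber_weight c x = cone_data.cone_weight (\<lambda>y. local_rep A F c (x, y)) (\<lambda>y. local_finsler.volume_factor (local_rep A F c) (x, y))"

definition fiber_proj :: "('a, real ^ 'n) chart \<Rightarrow> real ^ 'n \<Rightarrow> real ^ 'n \<Rightarrow> real ^ 'n" where
  "fiber_proj c x y = y /\<^sub>R local_rep A F c (x, y)"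

lemma
  assumes c: "c \<in> A" and p: "p \<in> fst c"
  shows average_eq: "\<And>f c'. continuous_on (- {0}) (\<lambda>y. f (p, tangent_of A c p y) c') \<Longrightarrow>
      average A F c p f c' = (1 / (LBINT y. fiber_weight c (snd c p) y)) *\<^sub>R
        (LBINT y. fiber_weight c (snd c p) y *\<^sub>R f (p, tangent_of A c p (fiber_proj c (snd c p) y)) c')"
    and fiber_weight_integrable: "\<And>h. continuous_on (- {0}) h \<Longrightarrow>
      integrable lborel (\<lambda>y. fiber_weight c (snd c p) y *\<^sub>R (h (fiber_proj c (snd c p) y) :: real ^ 'n))"
    and total_fiber_weight_pos: "(LBINT y. fiber_weight c (snd c p) y) > 0"
    and fiber_weight_zero: "fiber_weight c (snd c p) 0 = 0"
    and fiber_weight_eq: "\<And>y. fiber_weight c (snd c p) y = indicator annulus y *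
      (local_finsler.volume_factor (local_rep A F c) (snd c p, y) / local_rep A F c (snd c p, y) ^ CARD('n))"
    and fiber_proj_nonzero: "\<And>y. y \<noteq> 0 \<Longrightarrow> fiber_proj c (snd c p) y \<noteq> 0"
proof -
  interpret l: local_finsler "local_rep A F c" "chart_dom c" by (rule local_finsler[OF c])
  have x: "snd c p \<in> chart_dom c" using p by blast
  interpret k: cone_data "\<lambda>y. local_rep A F c (snd c p, y)" "\<lambda>y. l.volume_factor (snd c p, y)"
    by (rule l.cone_data[OF x])
  have fiber_weight: "fiber_weight c (snd c p) = k.cone_weight" by (simp add: fiber_weight_def)
  have fiber_proj: "fiber_proj c (snd c p) = k.radial_proj" by (simp add: fiber_proj_def k.radial_proj_def fun_eq_iff)
  have dvol: "dvol A F c p = k.cone_measure"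
    unfolding dvol_def indicatrix_components[OF c p] by (rule l.indicatrix_measure[OF x])
  show "average A F c p f c' = (1 / (LBINT y. fiber_weight c (snd c p) y)) *\<^sub>R
        (LBINT y. fiber_weight c (snd c p) y *\<^sub>R f (p, tangent_of A c p (fiber_proj c (snd c p) y)) c')"
    if "continuous_on (- {0}) (\<lambda>y. f (p, tangent_of A c p y) c')" for f c'
    unfolding average_def dvol k.measure_cone_measure k.integral_cone_measure[OF that] fiber_weight fiber_proj ..
  show "integrable lborel (\<lambda>y. fiber_weight c (snd c p) y *\<^sub>R (h (fiber_proj c (snd c p) y) :: real ^ 'n))"
    if "continuous_on (- {0}) h" for h
    unfolding fiber_weight fiber_proj by (rule k.weighted_integrable[OF that])
  show "(LBINT y. fiber_weight c (snd c p) y) > 0" unfolding fiber_weight by (rule k.total_weight_pos)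
  show "fiber_weight c (snd c p) 0 = 0" unfolding fiber_weight k.cone_weight_def by (simp add: annulus_def)
  show "fiber_weight c (snd c p) y = indicator annulus y *
      (l.volume_factor (snd c p, y) / local_rep A F c (snd c p, y) ^ CARD('n))" for y
    unfolding fiber_weight k.cone_weight_def ..
  show "fiber_proj c (snd c p) y \<noteq> 0" if "y \<noteq> 0" for y
    using k.radial_proj_unit_sphere[OF that] by (auto simp: fiber_proj k.unit_sphere_def)
qed

text \<open>
  The components in different charts are related by linear maps, which commute with the integral.  The other
  charts enter only through these maps, so continuity in the chart \<open>c\<close> suffices.
\<close>
lemma average_in_tangent_space:
  assumes c: "c \<in> A" and p: "p \<in> fst c"
    and f: "\<And>y. y \<noteq> 0 \<Longrightarrow> f (p, tangent_of A c p y) \<in> tangent_space A p"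
    and cont: "continuous_on (- {0}) (\<lambda>y. f (p, tangent_of A c p y) c)"
  shows "average A F c p f \<in> tangent_space A p"
proof -
  let ?f = "\<lambda>y. f (p, tangent_of A c p y)"
  let ?x = "snd c p"
  have comp: "?f y k' = base.transition k k' p (?f y k)"
    if "y \<noteq> 0" "k \<in> A" "k' \<in> A" "p \<in> fst k" "p \<in> fst k'" for y k k'
    using base.tangent_component[OF f[OF that(1)] that(2-)] .
  have lin: "bounded_linear (base.transition k k' p)"
    if "k \<in> A" "k' \<in> A" "p \<in> fst k" "p \<in> fst k'" for k k'
    using base.transition_linear[OF that] by (simp add: linear_conv_bounded_linear)
  have cont': "continuous_on (- {0}) (\<lambda>y. ?f y k)" if k: "k \<in> A" "p \<in> fst k" for k
  proof -
    have "continuous_on (- {0}) (\<lambda>y. base.transition c k p (?f y c))"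
      by (rule bounded_linear.continuous_on[OF lin[OF c k(1) p k(2)] cont])
    then show ?thesis by (rule continuous_on_eq) (use comp[OF _ c k(1) p k(2)] in auto)
  qed
  have cont0: "continuous_on (- {0}) (\<lambda>y. ?f y k)" if k: "\<not> (k \<in> A \<and> p \<in> fst k)" for k
    by (rule continuous_on_eq[OF continuous_on_const[of _ 0]])
      (use base.tangent_component_outside[OF f k] in auto)
  have "average A F c p f k' = base.transition k k' p (average A F c p f k)"
    if k: "k \<in> A" "k' \<in> A" "p \<in> fst k" "p \<in> fst k'" for k k'
  proof -
    interpret t: bounded_linear "base.transition k k' p" by (rule lin[OF k])
    have "(LBINT y. fiber_weight c ?x y *\<^sub>R ?f (fiber_proj c ?x y) k') =
        (LBINT y. base.transition k k' p (fiber_weight c ?x y *\<^sub>R ?f (fiber_proj c ?x y) k))"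
    proof (rule Bochner_Integration.integral_cong[OF refl])
      fix y
      show "fiber_weight c ?x y *\<^sub>R ?f (fiber_proj c ?x y) k' = base.transition k k' p (fiber_weight c ?x y *\<^sub>R ?f (fiber_proj c ?x y) k)"
        using comp[OF fiber_proj_nonzero[OF c p, of y] k] fiber_weight_zero[OF c p] by (cases "y = 0") (auto simp: t.scaleR t.zero)
    qed
    also have "\<dots> = base.transition k k' p (LBINT y. fiber_weight c ?x y *\<^sub>R ?f (fiber_proj c ?x y) k)"
      by (rule integral_bounded_linear[OF t.bounded_linear_axioms fiber_weight_integrable[OF c p cont'[OF k(1,3)]]])
    finally show ?thesis
      unfolding average_eq[OF c p, where f = f and c' = k, OF cont'[OF k(1,3)]]
        average_eq[OF c p, where f = f and c' = k', OF cont'[OF k(2,4)]] by (simp add: t.scaleR)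
  qed
  moreover have "average A F c p f k = 0" if k: "\<not> (k \<in> A \<and> p \<in> fst k)" for k
  proof -
    have z: "fiber_weight c ?x y *\<^sub>R ?f (fiber_proj c ?x y) k = 0" for y
      using base.tangent_component_outside[OF f[OF fiber_proj_nonzero[OF c p, of y]] k] fiber_weight_zero[OF c p]
      by (cases "y = 0") auto
    show ?thesis
      unfolding average_eq[OF c p, where f = f and c' = k, OF cont0[OF k]] z by simp
  qed
  ultimately show ?thesis unfolding tangent_space_def base.transition_def by blast
qed

lemma slit_chart_in: "c \<in> A \<Longrightarrow> slit_chart A c \<in> slit_atlas A"
  by (simp add: slit_atlas_def)

lemma slit_chart_dom: "c \<in> A \<Longrightarrow> snd (slit_chart A c) ` fst (slit_chart A c) = chart_dom c \<times> (- {0})"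
  using slit_chart_image[of c c] by simp

lemma open_slit_dom: "c \<in> A \<Longrightarrow> open (chart_dom c \<times> (- {0} :: (real ^ 'n) set))"
  using base.image_open by (intro open_Times) auto

lemma coord_nbhd_slit:
  assumes "c \<in> A" "u \<in> slit_bundle A" "fst u \<in> fst c"
  shows "coord_nbhd (slit_atlas A) u (slit_chart A c) (chart_dom c \<times> (- {0}))"
proof -
  have "u \<in> fst (slit_chart A c)" using assms by (simp add: fst_slit_chart)
  then show ?thesis
    unfolding coord_nbhd_def using slit_chart_in open_slit_dom slit_chart_dom assms(1) by blast
qed

lemma slit_point:
  assumes "c \<in> A" "w \<in> chart_dom c \<times> (- {0})"
  shows "chart_inv (slit_chart A c) w \<in> slit_bundle A" "fst (chart_inv (slit_chart A c) w) \<in> fst c"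
    "fst (chart_inv (slit_chart A c) w) = chart_inv c (fst w)"
    "snd (slit_chart A c) (chart_inv (slit_chart A c) w) = w"
proof -
  have w: "w \<in> snd (slit_chart A c) ` fst (slit_chart A c)" using assms slit_chart_dom by blast
  show "chart_inv (slit_chart A c) w \<in> slit_bundle A" "fst (chart_inv (slit_chart A c) w) \<in> fst c"
    using slit.chart_inv_in[OF w] by (simp_all add: fst_slit_chart)
  show "snd (slit_chart A c) (chart_inv (slit_chart A c) w) = w" by (rule slit.chart_chart_inv[OF w])
  show "fst (chart_inv (slit_chart A c) w) = chart_inv c (fst w)"
    using assms slit_chart_inv[of c "fst w" "snd w"] by (auto simp: mem_Times_iff)
qed

lemma coord_field:
  assumes "c \<in> A" "p \<in> fst c"
  shows "coord_field A c i p \<in> tangent_space A p" "coord_field A c i p c = axis i 1"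
  using base.tangent_of_in[OF assms] base.tangent_of_component[OF assms] by (simp_all add: coord_field_def)

lemma coord_section_smooth:
  assumes "c \<in> A" "u \<in> slit_bundle A" "fst u \<in> fst c"
  shows "smooth_section_near A u (coord_field A c i \<circ> fst)"
proof -
  have "smooth_on (chart_dom c \<times> (- {0})) (\<lambda>w. (coord_field A c i \<circ> fst) (chart_inv (slit_chart A c) w) c)"
    by (rule smooth_on_cong[OF open_slit_dom[OF assms(1)] _ smooth_on_const[OF open_slit_dom[OF assms(1)], of "axis i 1"]])
      (simp add: coord_field(2)[OF assms(1) slit_point(2)[OF assms(1)]])
  then show ?thesis
    unfolding smooth_section_near_def
    using assms(1) coord_nbhd_slit[OF assms] coord_field(1)[OF assms(1) slit_point(2)[OF assms(1)]]
    by (metis comp_apply)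
qed

text \<open>
  The horizontal lift as a function of the components of the vector, so that its linearity can be stated
  in a vector space.
\<close>
definition coord_lift :: "('a, real ^ 'n) chart \<Rightarrow> ('a, 'n) bundle_point \<Rightarrow> real ^ 'n \<Rightarrow> ('a, 'n) bundle_tangent" where
  "coord_lift c u \<xi> = tangent_of (slit_atlas A) (slit_chart A c) u
    (\<xi>, \<chi> i. - (\<Sum>j\<in>UNIV. nonlinear_coeff (local_rep A F c) i j (snd (slit_chart A c) u) * \<xi> $ j))"

lemma horizontal_lift_eq: "horizontal_lift A F c u X = coord_lift c u (X c)"
  by (simp add: horizontal_lift_def coord_lift_def)

lemma lift_in:
  assumes "c \<in> A" "u \<in> slit_bundle A" "fst u \<in> fst c"
  shows "coord_lift c u \<xi> \<in> tangent_space (slit_atlas A) u"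
  unfolding coord_lift_def using assms by (intro slit.tangent_of_in slit_chart_in) (simp_all add: fst_slit_chart)

lemma lift_lincomb:
  assumes "c \<in> A" "u \<in> slit_bundle A" "fst u \<in> fst c"
  shows "coord_lift c u (\<alpha> *\<^sub>R \<xi> + \<beta> *\<^sub>R \<eta>) = (\<lambda>k. \<alpha> *\<^sub>R coord_lift c u \<xi> k + \<beta> *\<^sub>R coord_lift c u \<eta> k)"
proof -
  have u: "u \<in> fst (slit_chart A c)" using assms by (simp add: fst_slit_chart)
  show ?thesis
    unfolding coord_lift_def slit.tangent_of_lincomb[OF slit_chart_in[OF assms(1)] u, symmetric]
    by (rule arg_cong[of _ _ "tangent_of (slit_atlas A) (slit_chart A c) u"])
      (simp add: vec_eq_iff sum.distrib sum_distrib_left algebra_simps)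
qed

text \<open>
  In the natural chart the components are constant or given by the nonlinear connection.
\<close>
lemma lift_field_smooth:
  assumes c: "c \<in> A" and u: "u \<in> slit_bundle A" "fst u \<in> fst c"
  shows "smooth_field_near (slit_atlas A) u (\<lambda>u. coord_lift c u \<xi>)"
proof -
  interpret l: local_finsler "local_rep A F c" "chart_dom c" by (rule local_finsler[OF c])
  let ?N = "nonlinear_coeff (local_rep A F c)"
  have "smooth_on l.slit (\<lambda>w. (\<xi>, \<chi> i. - (\<Sum>j\<in>UNIV. ?N i j w * \<xi> $ j)))"
    by (intro smooth_on_Pair smooth_on_vec smooth_on_minus smooth_on_sum smooth_on_mult smooth_on_const
        l.open_slit l.nonlinear_coeff_smooth)
  then have "smooth_on l.slit (\<lambda>w. coord_lift c (chart_inv (slit_chart A c) w) \<xi> (slit_chart A c))"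
  proof (rule smooth_on_cong[OF l.open_slit, rotated])
    fix w assume w: "w \<in> l.slit"
    show "(\<xi>, \<chi> i. - (\<Sum>j\<in>UNIV. ?N i j w * \<xi> $ j)) = coord_lift c (chart_inv (slit_chart A c) w) \<xi> (slit_chart A c)"
      unfolding coord_lift_def slit_point(4)[OF c w]
      by (rule slit.tangent_of_component[symmetric, OF slit_chart_in[OF c]])
        (use slit_point[OF c w] in \<open>simp add: fst_slit_chart\<close>)
  qed
  then show ?thesis
    unfolding smooth_field_near_def
    using coord_nbhd_slit[OF c u] lift_in[OF c slit_point(1,2)[OF c]] by blast
qed

lemma nabla_in:
  assumes "u \<in> slit_bundle A" "Z \<in> tangent_space (slit_atlas A) u" "smooth_section_near A u s"
  shows "nabla u Z s \<in> tangent_space A (fst u)"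
  using connection assms unfolding linear_connection_def by blast

lemma nabla_lincomb:
  assumes "u \<in> slit_bundle A" "Z \<in> tangent_space (slit_atlas A) u" "Z' \<in> tangent_space (slit_atlas A) u"
    "smooth_section_near A u s"
  shows "nabla u (\<lambda>k. \<alpha> *\<^sub>R Z k + \<beta> *\<^sub>R Z' k) s = (\<lambda>c. \<alpha> *\<^sub>R nabla u Z s c + \<beta> *\<^sub>R nabla u Z' s c)"
  using connection assms unfolding linear_connection_def by blast

lemma nabla_smooth:
  assumes "u \<in> slit_bundle A" "smooth_field_near (slit_atlas A) u Zf" "smooth_section_near A u s"
  shows "smooth_section_near A u (\<lambda>u'. nabla u' (Zf u') s)"
  using connection assms unfolding linear_connection_def by blast

definition coord_nabla :: "('a, real ^ 'n) chart \<Rightarrow> 'n \<Rightarrow> ('a, 'n) bundle_point \<Rightarrow> real ^ 'n \<Rightarrow> ('a, real ^ 'n) tangent" where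
  "coord_nabla c i u \<xi> = nabla u (coord_lift c u \<xi>) (coord_field A c i \<circ> fst)"

lemma average_connection_eq:
  "average_connection A F nabla c p X (coord_field A c i) = average A F c p (\<lambda>u. coord_nabla c i u (X c))"
  by (simp add: average_connection_def coord_nabla_def horizontal_lift_eq)

lemma coord_nabla_in:
  assumes "c \<in> A" "u \<in> slit_bundle A" "fst u \<in> fst c"
  shows "coord_nabla c i u \<xi> \<in> tangent_space A (fst u)"
  unfolding coord_nabla_def by (intro nabla_in lift_in coord_section_smooth assms)

text \<open>
  Tensoriality in the direction, transported to the components.
\<close>
lemma coord_nabla_expand:
  assumes "c \<in> A" "u \<in> slit_bundle A" "fst u \<in> fst c"
  shows "coord_nabla c i u \<xi> k = (\<Sum>l\<in>UNIV. (\<xi> $ l) *\<^sub>R coord_nabla c i u (axis l 1) k)"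
proof -
  have lc: "coord_nabla c i u (\<alpha> *\<^sub>R \<xi> + \<beta> *\<^sub>R \<eta>) k = \<alpha> *\<^sub>R coord_nabla c i u \<xi> k + \<beta> *\<^sub>R coord_nabla c i u \<eta> k"
    for \<alpha> \<beta> \<xi> \<eta>
    unfolding coord_nabla_def lift_lincomb[OF assms]
      nabla_lincomb[OF assms(2) lift_in[OF assms] lift_in[OF assms] coord_section_smooth[OF assms]] ..
  have l: "linear (\<lambda>\<xi>. coord_nabla c i u \<xi> k)"
    using lc[of 1 _ 1] lc[of _ _ 0 0] by (intro linearI) simp_all
  have "coord_nabla c i u (\<Sum>l\<in>UNIV. (\<xi> $ l) *\<^sub>R axis l 1) k = (\<Sum>l\<in>UNIV. (\<xi> $ l) *\<^sub>R coord_nabla c i u (axis l 1) k)"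
    by (simp add: linear_sum[OF l] linear_scale[OF l])
  then show ?thesis by (simp add: sum_axis_components)
qed

text \<open>
  Near a given point a smooth section is known to have smooth components in some chart \<open>c'\<close>, which varies with the
  point.  Its components in \<open>c\<close> are obtained by passing to the natural coordinates of \<open>c'\<close>, taking the components
  there, and transforming them back; all three steps are continuous.
\<close>
lemma smooth_section_continuous:
  assumes c: "c \<in> A"
    and T: "\<And>u. u \<in> slit_bundle A \<Longrightarrow> fst u \<in> fst c \<Longrightarrow> smooth_section_near A u T"
  shows "continuous_on (chart_dom c \<times> (- {0})) (\<lambda>w. T (chart_inv (slit_chart A c) w) c)"
proof -
  let ?W = "chart_dom c \<times> (- {0} :: (real ^ 'n) set)" and ?inv = "chart_inv (slit_chart A c)"
  have "continuous (at w0) (\<lambda>w. T (?inv w) c)" if w0: "w0 \<in> ?W" for w0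
  proof -
    obtain c' Q where c': "c' \<in> A" and Q: "coord_nbhd (slit_atlas A) (?inv w0) (slit_chart A c') Q"
      and tan: "\<And>w. w \<in> Q \<Longrightarrow> T (chart_inv (slit_chart A c') w) \<in> tangent_space A (fst (chart_inv (slit_chart A c') w))"
      and sm: "smooth_on Q (\<lambda>w. T (chart_inv (slit_chart A c') w) c')"
      using T[OF slit_point(1,2)[OF c w0]] unfolding smooth_section_near_def by blast
    have Q': "open Q" "snd (slit_chart A c') (?inv w0) \<in> Q" "?inv w0 \<in> fst (slit_chart A c')"
      using Q by (auto simp: coord_nbhd_def)
    let ?O = "(snd c ` (fst c \<inter> fst c')) \<times> (- {0} :: (real ^ 'n) set)"
    let ?\<tau> = "lifted_transition c c'"
    have openO: "open ?O" using overlap_open[OF c c'] by (intro open_Times) auto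
    have cont\<tau>: "continuous_on ?O ?\<tau>" by (rule smooth_on_continuous_on[OF lifted_transition_smooth[OF c c']])
    have w0O: "w0 \<in> ?O"
      unfolding slit_chart_image[OF c, of c', symmetric]
    proof (rule image_eqI)
      show "w0 = snd (slit_chart A c) (?inv w0)" using slit_point(4)[OF c w0] by simp
      show "?inv w0 \<in> fst (slit_chart A c) \<inter> fst (slit_chart A c')"
        using slit_point(1,2)[OF c w0] Q'(3) by (simp add: fst_slit_chart)
    qed
    define V where "V = {w \<in> ?O. ?\<tau> w \<in> Q}"
    have openV: "open V"
      using continuous_open_preimage[OF cont\<tau> openO Q'(1)] by (simp add: V_def vimage_def Int_def)
    have w0V: "w0 \<in> V"
      using w0O Q'(2) slit_transition_eq[OF c c' w0O] by (simp add: V_def)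
    have eq: "T (?inv w) c = snd (lifted_transition c' c (fst (?\<tau> w), T (chart_inv (slit_chart A c') (?\<tau> w)) c'))"
      if w: "w \<in> V" for w
    proof -
      have wO: "w \<in> ?O" and wQ: "?\<tau> w \<in> Q" using w by (auto simp: V_def)
      then have "w \<in> ?W" by auto
      then have u: "?inv w \<in> slit_bundle A" "fst (?inv w) \<in> fst c" "fst (?inv w) = chart_inv c (fst w)"
        using slit_point[OF c] by auto
      have uc': "fst (?inv w) \<in> fst c'"
        using wO base.chart_inv_chart[OF c] by (auto simp: u(3))
      then have "?inv w \<in> fst (slit_chart A c')" using u by (simp add: fst_slit_chart)
      note slit.chart_inv_chart[OF slit_chart_in[OF c'] this]
      then have inv: "chart_inv (slit_chart A c') (?\<tau> w) = ?inv w"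
        using slit_transition_eq[OF c c' wO] by simp
      have f: "fst (?\<tau> w) = snd c' (fst (?inv w))"
        by (simp add: lifted_transition_def u(3))
      have "T (?inv w) \<in> tangent_space A (fst (?inv w))" using tan[OF wQ] by (simp add: inv)
      from base.tangent_component[OF this c' c uc' u(2)] show ?thesis
        by (simp add: inv lifted_transition_def[of c' c] f base.transition_def)
    qed
    have contT: "continuous_on V (\<lambda>w. T (chart_inv (slit_chart A c') (?\<tau> w)) c')"
      by (rule continuous_on_compose2[OF smooth_on_continuous_on[OF sm] continuous_on_subset[OF cont\<tau>]])
        (auto simp: V_def)
    have fstV: "fst (?\<tau> w) \<in> snd c' ` (fst c' \<inter> fst c)" if "w \<in> V" for w
      using that base.chart_inv_chart[OF c] by (auto simp: V_def lifted_transition_def)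
    have "continuous_on V (\<lambda>w. snd (lifted_transition c' c (fst (?\<tau> w), T (chart_inv (slit_chart A c') (?\<tau> w)) c')))"
      by (intro continuous_on_snd continuous_on_compose2[OF smooth_on_continuous_on[OF lifted_transition_smooth_UNIV[OF c' c]]]
          continuous_on_Pair contT continuous_on_fst continuous_on_subset[OF cont\<tau>])
        (use fstV in \<open>auto simp: V_def\<close>)
    then have "continuous_on V (\<lambda>w. T (?inv w) c)"
      by (rule continuous_on_eq) (rule eq[symmetric])
    then show ?thesis using openV w0V by (simp add: continuous_on_eq_continuous_at)
  qed
  then show ?thesis by (rule continuous_at_imp_continuous_on[rule_format])
qed

lemma coord_nabla_continuous:
  assumes c: "c \<in> A"
  shows "continuous_on (chart_dom c \<times> (- {0})) (\<lambda>w. coord_nabla c i (chart_inv (slit_chart A c) w) (axis l 1) c)"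
proof (rule smooth_section_continuous[where T = "\<lambda>u. coord_nabla c i u (axis l 1)", OF c])
  fix u assume u: "u \<in> slit_bundle A" "fst u \<in> fst c"
  show "smooth_section_near A u (\<lambda>u. coord_nabla c i u (axis l 1))"
    unfolding coord_nabla_def by (rule nabla_smooth[OF u(1) lift_field_smooth[OF c u] coord_section_smooth[OF c u]])
qed

lemma coord_nabla_fiber_continuous:
  assumes c: "c \<in> A" and p: "p \<in> fst c"
  shows "continuous_on (- {0}) (\<lambda>y. coord_nabla c i (p, tangent_of A c p y) \<xi> c)"
proof -
  have inv: "chart_inv (slit_chart A c) (snd c p, y) = (p, tangent_of A c p y)" if "y \<noteq> 0" for y
    using slit_chart_inv[OF c _ that, of "snd c p"] p by (simp add: base.chart_inv_chart[OF c p])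
  have "continuous_on (- {0}) (\<lambda>y. coord_nabla c i (chart_inv (slit_chart A c) (snd c p, y)) (axis l 1) c)" for l
    by (rule continuous_on_compose2[OF coord_nabla_continuous[OF c]]) (use p in \<open>auto intro!: continuous_intros\<close>)
  then have "continuous_on (- {0}) (\<lambda>y. \<Sum>l\<in>UNIV. (\<xi> $ l) *\<^sub>R
      coord_nabla c i (chart_inv (slit_chart A c) (snd c p, y)) (axis l 1) c)"
    by (intro continuous_intros)
  then show ?thesis
  proof (rule continuous_on_eq)
    fix y :: "real ^ 'n" assume "y \<in> - {0}"
    then have "y \<noteq> 0" by simp
    then show "(\<Sum>l\<in>UNIV. (\<xi> $ l) *\<^sub>R coord_nabla c i (chart_inv (slit_chart A c) (snd c p, y)) (axis l 1) c) =
        coord_nabla c i (p, tangent_of A c p y) \<xi> c"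
      using coord_nabla_expand[OF c slit_bundle_tangent_of[OF c p], of y i \<xi> c] p by (simp add: inv)
  qed
qed

lemma average_connection_in:
  assumes c: "c \<in> A" and p: "p \<in> fst c"
  shows "average_connection A F nabla c p X (coord_field A c i) \<in> tangent_space A p"
  unfolding average_connection_eq
  using coord_nabla_in[OF c slit_bundle_tangent_of[OF c p]] p
  by (intro average_in_tangent_space[OF c p] coord_nabla_fiber_continuous[OF c p]) simp

lemma average_connection_coord:
  assumes c: "c \<in> A" and p: "p \<in> fst c"
  shows "average_connection A F nabla c p X (coord_field A c i) c = (1 / (LBINT y. fiber_weight c (snd c p) y)) *\<^sub>R
    (LBINT y. fiber_weight c (snd c p) y *\<^sub>R coord_nabla c i (p, tangent_of A c p (fiber_proj c (snd c p) y)) (X c) c)"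
  unfolding average_connection_eq
  by (rule average_eq[OF c p, where f = "\<lambda>u. coord_nabla c i u (X c)", OF coord_nabla_fiber_continuous[OF c p]])

text \<open>
  The connection and the horizontal lift are linear in the direction for each \<open>y\<close>, and so is the integral
  over \<open>y\<close>; the integrability that this takes comes from the continuity on the fiber.
\<close>
lemma average_connection_expand:
  assumes c: "c \<in> A" and p: "p \<in> fst c"
  shows "average_connection A F nabla c p X (coord_field A c i) c $ j =
    (\<Sum>l\<in>UNIV. connection_coeff A c (average_connection A F nabla c) j i l p * X c $ l)"
proof -
  let ?x = "snd c p"
  let ?h = "\<lambda>\<xi> y. fiber_weight c ?x y *\<^sub>R coord_nabla c i (p, tangent_of A c p (fiber_proj c ?x y)) \<xi> c"
  have int: "integrable lborel (?h \<xi>)" for \<xi>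
    by (rule fiber_weight_integrable[OF c p coord_nabla_fiber_continuous[OF c p]])
  have "?h (X c) y = (\<Sum>l\<in>UNIV. (X c $ l) *\<^sub>R ?h (axis l 1) y)" for y
  proof (cases "y = 0")
    case False
    have "coord_nabla c i (p, tangent_of A c p (fiber_proj c ?x y)) (X c) c =
        (\<Sum>l\<in>UNIV. (X c $ l) *\<^sub>R coord_nabla c i (p, tangent_of A c p (fiber_proj c ?x y)) (axis l 1) c)"
      using p by (intro coord_nabla_expand[OF c slit_bundle_tangent_of[OF c p fiber_proj_nonzero[OF c p False]]]) simp
    then show ?thesis by (simp add: scaleR_sum_right mult.commute)
  qed (simp add: fiber_weight_zero[OF c p])
  then have "(LBINT y. ?h (X c) y) = (LBINT y. (\<Sum>l\<in>UNIV. (X c $ l) *\<^sub>R ?h (axis l 1) y))" by simp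
  also have "\<dots> = (\<Sum>l\<in>UNIV. (X c $ l) *\<^sub>R (LBINT y. ?h (axis l 1) y))"
    using Bochner_Integration.integral_sum[of UNIV lborel "\<lambda>l y. (X c $ l) *\<^sub>R ?h (axis l 1) y",
        OF integrable_scaleR_right[OF int]] by (simp only: integral_scaleR_right)
  finally have "average_connection A F nabla c p X (coord_field A c i) c =
      (\<Sum>l\<in>UNIV. (X c $ l) *\<^sub>R average_connection A F nabla c p (coord_field A c l p) (coord_field A c i) c)"
    unfolding average_connection_coord[OF c p] coord_field(2)[OF c p]
    by (simp add: scaleR_sum_right mult.commute)
  then show ?thesis by (simp add: connection_coeff_def mult.commute)
qed

lemma fiber_weight_continuous:
  assumes c: "c \<in> A"
  shows "continuous_on (chart_dom c \<times> (- {0})) (\<lambda>(x, y).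
      local_finsler.volume_factor (local_rep A F c) (x, y) / local_rep A F c (x, y) ^ CARD('n))"
    and fiber_proj_continuous: "continuous_on (chart_dom c \<times> (- {0})) (\<lambda>(x, y). fiber_proj c x y)"
proof -
  interpret l: local_finsler "local_rep A F c" "chart_dom c" by (rule local_finsler[OF c])
  have ne: "\<forall>w\<in>l.slit. local_rep A F c w ^ CARD('n) \<noteq> 0" "\<forall>w\<in>l.slit. local_rep A F c w \<noteq> 0"
    using l.positive by force+
  note cont = smooth_on_continuous_on[OF l.smooth]
  have "continuous_on l.slit (\<lambda>w. l.volume_factor w / local_rep A F c w ^ CARD('n))"
    by (intro continuous_on_divide continuous_on_power cont l.volume_factor_continuous ne)
  then show "continuous_on l.slit (\<lambda>(x, y). l.volume_factor (x, y) / local_rep A F c (x, y) ^ CARD('n))"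
    by (simp add: case_prod_beta)
  have "continuous_on l.slit (\<lambda>w. snd w /\<^sub>R local_rep A F c w)"
    by (intro continuous_on_scaleR continuous_on_inverse cont ne continuous_on_snd continuous_on_id)
  then show "continuous_on l.slit (\<lambda>(x, y). fiber_proj c x y)"
    by (simp add: case_prod_beta fiber_proj_def)
qed

lemma annulus_nonzero: "(annulus :: (real ^ 'n) set) \<subseteq> - {0}"
  by (auto simp: annulus_def)

text \<open>
  The coefficient is a quotient of two integrals over the same annulus for all \<open>x\<close>, with jointly continuous
  integrands and a positive denominator.
\<close>
lemma connection_coeff_continuous:
  assumes c: "c \<in> A"
  shows "continuous_on (chart_dom c) (\<lambda>x. connection_coeff A c (average_connection A F nabla c) j i l (chart_inv c x))"
proof -
  let ?\<rho> = "\<lambda>x y. local_finsler.volume_factor (local_rep A F c) (x, y) / local_rep A F c (x, y) ^ CARD('n)"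
  let ?g = "\<lambda>x y. coord_nabla c i (chart_inv (slit_chart A c) (x, fiber_proj c x y)) (axis l 1) c"
  have sub: "chart_dom c \<times> annulus \<subseteq> chart_dom c \<times> (- {0} :: (real ^ 'n) set)"
    using annulus_nonzero by blast
  have p: "chart_inv c x \<in> fst c" "snd c (chart_inv c x) = x" if "x \<in> chart_dom c" for x
    using base.chart_inv_in[OF that] base.chart_chart_inv[OF that] by auto
  have fiber_weight: "fiber_weight c x y = indicator annulus y * ?\<rho> x y" if "x \<in> chart_dom c" for x y
    using fiber_weight_eq[OF c p(1)[OF that], of y] by (simp add: p(2)[OF that])
  have nz: "fiber_proj c x y \<noteq> 0" if "x \<in> chart_dom c" "y \<noteq> 0" for x y
    using fiber_proj_nonzero[OF c p(1)[OF that(1)] that(2)] by (simp add: p(2)[OF that(1)])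
  have c1: "continuous_on (chart_dom c) (\<lambda>x. LBINT y. indicator annulus y *\<^sub>R ?\<rho> x y)"
    by (rule continuous_on_integral_compact[OF compact_annulus continuous_on_subset[OF fiber_weight_continuous(1)[OF c] sub]])
  have pr_img: "(\<lambda>w. (fst w, fiber_proj c (fst w) (snd w))) ` (chart_dom c \<times> (- {0})) \<subseteq> chart_dom c \<times> (- {0})"
    using nz by auto
  have "continuous_on (chart_dom c \<times> (- {0})) (\<lambda>w. fiber_proj c (fst w) (snd w))"
    using fiber_proj_continuous[OF c] by (simp add: case_prod_beta)
  then have "continuous_on (chart_dom c \<times> (- {0})) (\<lambda>w. (fst w, fiber_proj c (fst w) (snd w)))"
    by (intro continuous_on_Pair continuous_on_fst continuous_on_id)
  from continuous_on_compose2[OF coord_nabla_continuous[OF c] this pr_img]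
  have "continuous_on (chart_dom c \<times> (- {0})) (\<lambda>(x, y). ?g x y)" by (simp add: case_prod_beta)
  then have "continuous_on (chart_dom c \<times> (- {0})) (\<lambda>w. (case w of (x, y) \<Rightarrow> ?\<rho> x y) *\<^sub>R (case w of (x, y) \<Rightarrow> ?g x y))"
    by (rule continuous_on_scaleR[OF fiber_weight_continuous(1)[OF c]])
  then have "continuous_on (chart_dom c \<times> (- {0})) (\<lambda>(x, y). ?\<rho> x y *\<^sub>R ?g x y)" by (simp add: case_prod_beta)
  from continuous_on_integral_compact[OF compact_annulus continuous_on_subset[OF this sub]]
  have c2: "continuous_on (chart_dom c) (\<lambda>x. LBINT y. indicator annulus y *\<^sub>R (?\<rho> x y *\<^sub>R ?g x y))" .
  have pos: "\<forall>x\<in>chart_dom c. (LBINT y. indicator annulus y *\<^sub>R ?\<rho> x y) \<noteq> 0"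
  proof
    fix x assume x: "x \<in> chart_dom c"
    show "(LBINT y. indicator annulus y *\<^sub>R ?\<rho> x y) \<noteq> 0"
      using total_fiber_weight_pos[OF c p(1)[OF x]] unfolding p(2)[OF x] fiber_weight[OF x] by simp
  qed
  have "continuous_on (chart_dom c) (\<lambda>x. ((1 / (LBINT y. indicator annulus y *\<^sub>R ?\<rho> x y)) *\<^sub>R
      (LBINT y. indicator annulus y *\<^sub>R (?\<rho> x y *\<^sub>R ?g x y))) $ j)"
    by (intro continuous_on_component continuous_on_scaleR continuous_on_divide continuous_on_const c1 c2 pos)
  then show ?thesis
  proof (rule continuous_on_eq)
    fix x assume x: "x \<in> chart_dom c"
    have w: "indicator annulus y *\<^sub>R ?\<rho> x y = fiber_weight c x y" for y by (simp add: fiber_weight[OF x])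
    have h: "indicator annulus y *\<^sub>R (?\<rho> x y *\<^sub>R ?g x y) =
        fiber_weight c x y *\<^sub>R coord_nabla c i (chart_inv c x, tangent_of A c (chart_inv c x) (fiber_proj c x y)) (axis l 1) c" for y
    proof (cases "y = 0")
      case False
      then show ?thesis by (simp add: fiber_weight[OF x] slit_chart_inv[OF c x nz[OF x]])
    qed (simp add: fiber_weight[OF x] annulus_def)
    show "((1 / (LBINT y. indicator annulus y *\<^sub>R ?\<rho> x y)) *\<^sub>R
      (LBINT y. indicator annulus y *\<^sub>R (?\<rho> x y *\<^sub>R ?g x y))) $ j =
      connection_coeff A c (average_connection A F nabla c) j i l (chart_inv c x)"
      unfolding connection_coeff_def average_connection_coord[OF c p(1)[OF x]] coord_field(2)[OF c p(1)[OF x]] p(2)[OF x] w h ..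
  qed
qed

end

section \<open>Parallel transport\<close>

context finsler_connection
begin

text \<open>
  The coefficient matrix of the equation of parallel transport; the sign is that of \<open>s' = M s\<close>.
\<close>
definition transport_matrix ::
  "('a, real ^ 'n) chart \<Rightarrow> real \<Rightarrow> real \<Rightarrow> (real \<Rightarrow> 'a) \<Rightarrow> real \<Rightarrow> real ^ 'n ^ 'n" where
  "transport_matrix c a b \<gamma> t = (\<chi> r i. - (\<Sum>l\<in>UNIV.
    connection_coeff A c (average_connection A F nabla c) r i l (\<gamma> t) * velocity A c a b \<gamma> t c $ l))"

lemma velocity_component:
  assumes "c \<in> A" "\<gamma> t \<in> fst c"
  shows "velocity A c a b \<gamma> t c = vector_derivative (snd c \<circ> \<gamma>) (at t within {a..b})"
  unfolding velocity_def using assms by (rule base.tangent_of_component)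

lemma tangent_space_sum:
  assumes "c \<in> A" "p \<in> fst c" "\<And>i. i \<in> I \<Longrightarrow> v i \<in> tangent_space A p"
  shows "(\<lambda>k. \<Sum>i\<in>I. v i k) \<in> tangent_space A p"
  using assms(3)
proof (induction I rule: infinite_finite_induct)
  case (insert i I)
  then show ?case
    using base.tangent_space_lincomb[of "v i" p "\<lambda>k. \<Sum>i\<in>I. v i k" 1 1] by simp
qed (use base.tangent_space_zero[OF assms(1,2)] in simp_all)

lemma derivative_along_average:
  fixes S :: "real \<Rightarrow> ('a, real ^ 'n) tangent" and a b t :: real
  assumes c: "c \<in> A" and \<gamma>: "\<gamma> t \<in> fst c"
  defines "V \<equiv> derivative_along A c (average_connection A F nabla c) a b \<gamma> S t"
  shows "V \<in> tangent_space A (\<gamma> t)"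
    and "V c = vector_derivative (\<lambda>s. S s c) (at t within {a..b}) - transport_matrix c a b \<gamma> t *v S t c"
proof -
  let ?D = "average_connection A F nabla c"
  let ?d = "vector_derivative (\<lambda>s. S s c) (at t within {a..b})"
  show "V \<in> tangent_space A (\<gamma> t)"
    unfolding V_def derivative_along_def
    by (intro tangent_space_sum[OF c \<gamma>] base.tangent_space_lincomb coord_field[OF c \<gamma>] average_connection_in[OF c \<gamma>])
  have "V c = (\<Sum>i\<in>UNIV. (?d $ i) *\<^sub>R axis i 1) +
      (\<Sum>i\<in>UNIV. (S t c $ i) *\<^sub>R ?D (\<gamma> t) (velocity A c a b \<gamma> t) (coord_field A c i) c)"
    unfolding V_def derivative_along_def coord_field(2)[OF c \<gamma>] by (rule sum.distrib)
  also have "(\<Sum>i\<in>UNIV. (S t c $ i) *\<^sub>R ?D (\<gamma> t) (velocity A c a b \<gamma> t) (coord_field A c i) c) =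
      - (transport_matrix c a b \<gamma> t *v S t c)"
    by (simp add: vec_eq_iff sum_component average_connection_expand[OF c \<gamma>] transport_matrix_def
        matrix_vector_mult_def sum_negf mult.commute)
  finally show "V c = ?d - transport_matrix c a b \<gamma> t *v S t c" by (simp add: sum_axis_components)
qed

text \<open>
  The derivative along the curve is a tangent vector, so it vanishes in all charts as soon as its components in \<open>c\<close>
  vanish.
\<close>
lemma parallel_along_iff:
  assumes c: "c \<in> A" and ab: "a < b" and \<gamma>: "\<gamma> ` {a..b} \<subseteq> fst c"
  shows "parallel_along A c (average_connection A F nabla c) a b \<gamma> S \<longleftrightarrow>
    (\<forall>t\<in>{a..b}. S t \<in> tangent_space A (\<gamma> t) \<and>
      ((\<lambda>s. S s c) has_vector_derivative transport_matrix c a b \<gamma> t *v S t c) (at t within {a..b}))"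
  unfolding parallel_along_def
proof (intro ball_cong refl conj_cong)
  fix t assume t: "t \<in> {a..b}"
  then have \<gamma>t: "\<gamma> t \<in> fst c" using \<gamma> by blast
  let ?V = "derivative_along A c (average_connection A F nabla c) a b \<gamma> S t"
  let ?s = "\<lambda>s. S s c" and ?w = "transport_matrix c a b \<gamma> t *v S t c"
  have V0: "?V = (\<lambda>_. 0) \<longleftrightarrow> vector_derivative ?s (at t within {a..b}) = ?w"
    using derivative_along_average[where \<gamma> = \<gamma> and t = t and a = a and b = b and S = S, OF c \<gamma>t]
      base.tangent_eqI[OF _ base.tangent_space_zero[OF c \<gamma>t] c \<gamma>t, of ?V] by auto
  show "?s differentiable (at t within {a..b}) \<and> ?V = (\<lambda>_. 0) \<longleftrightarrow>
      (?s has_vector_derivative ?w) (at t within {a..b})"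
    unfolding V0
  proof
    assume "?s differentiable (at t within {a..b}) \<and> vector_derivative ?s (at t within {a..b}) = ?w"
    then show "(?s has_vector_derivative ?w) (at t within {a..b})"
      using vector_derivative_works by metis
  next
    assume d: "(?s has_vector_derivative ?w) (at t within {a..b})"
    have "vector_derivative ?s (at t within cbox a b) = ?w"
      by (rule vector_derivative_within_cbox) (use ab t d in auto)
    then show "?s differentiable (at t within {a..b}) \<and> vector_derivative ?s (at t within {a..b}) = ?w"
      using d by (auto intro: differentiableI_vector)
  qed
qed

lemma transport_matrix_continuous:
  assumes c: "c \<in> A" and ab: "a < b" and \<gamma>: "\<gamma> ` {a..b} \<subseteq> fst c"
    and smooth: "smooth_on_interval a b (snd c \<circ> \<gamma>)"
  shows "continuous_on {a..b} (transport_matrix c a b \<gamma>)"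
proof -
  obtain d where d0: "d (0::nat) = snd c \<circ> \<gamma>"
    and d: "\<And>k t. t \<in> {a..b} \<Longrightarrow> (d k has_vector_derivative d (Suc k) t) (at t within {a..b})"
    using smooth unfolding smooth_on_interval_def by blast
  have cont: "continuous_on {a..b} (d k)" for k
    unfolding continuous_on_eq_continuous_within using d has_vector_derivative_continuous by blast
  have vel: "velocity A c a b \<gamma> t c = d 1 t" if t: "t \<in> {a..b}" for t
  proof -
    have "vector_derivative (d 0) (at t within cbox a b) = d 1 t"
      by (rule vector_derivative_within_cbox) (use ab t d[OF t, of 0] in auto)
    moreover have "\<gamma> t \<in> fst c" using \<gamma> t by blast
    ultimately show ?thesis using velocity_component[where \<gamma> = \<gamma> and t = t and a = a and b = b, OF c] by (simp add: d0)
  qed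
  have coeff: "continuous_on {a..b} (\<lambda>t. connection_coeff A c (average_connection A F nabla c) r i l (\<gamma> t))" for r i l
  proof -
    have "continuous_on {a..b} (\<lambda>t. connection_coeff A c (average_connection A F nabla c) r i l (chart_inv c (d 0 t)))"
      by (rule continuous_on_compose2[OF connection_coeff_continuous[OF c] cont]) (use \<gamma> in \<open>auto simp: d0\<close>)
    then show ?thesis
      by (rule continuous_on_eq) (simp add: d0 base.chart_inv_chart[OF c subsetD[OF \<gamma> imageI]])
  qed
  have entry: "continuous_on {a..b} (\<lambda>t. - (\<Sum>l\<in>UNIV. connection_coeff A c (average_connection A F nabla c) r i l (\<gamma> t) * d 1 t $ l))" for r i
    by (intro continuous_on_minus continuous_on_sum continuous_on_mult coeff continuous_on_component cont)
  have "continuous_on {a..b} (\<lambda>t. \<chi> r i. - (\<Sum>l\<in>UNIV. connection_coeff A c (average_connection A F nabla c) r i l (\<gamma> t) * d 1 t $ l))"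
    by (intro continuous_on_vec_lambda entry)
  then show ?thesis
    by (rule continuous_on_eq) (simp add: transport_matrix_def vel)
qed

text \<open>
  The difference scheme converges to the endpoint of every parallel field that starts at \<open>X\<close>.  So there is at
  most one endpoint, and the definite description in the definition of the parallel transport denotes the
  endpoint of the field that Picard iteration provides.
\<close>
lemma parallel_transport_component:
  assumes c: "c \<in> A" and ab: "a < b" and \<gamma>: "\<gamma> ` {a..b} \<subseteq> fst c"
    and smooth: "smooth_on_interval a b (snd c \<circ> \<gamma>)" and X: "X \<in> tangent_space A (\<gamma> a)"
  shows "(\<lambda>m. ordered_product (\<lambda>k. mat 1 + ((b - a) / real m) *\<^sub>R
      transport_matrix c a b \<gamma> (a + real k * ((b - a) / real m))) m *v X c)
    \<longlonglongrightarrow> parallel_transport A c (average_connection A F nabla c) a b \<gamma> X c"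
proof -
  let ?D = "average_connection A F nabla c" and ?M = "transport_matrix c a b \<gamma>"
  let ?euler = "\<lambda>m. ordered_product (\<lambda>k. mat 1 + ((b - a) / real m) *\<^sub>R ?M (a + real k * ((b - a) / real m))) m *v X c"
  note M = transport_matrix_continuous[OF c ab \<gamma> smooth]
  have \<gamma>ab: "\<gamma> a \<in> fst c" "\<gamma> b \<in> fst c" using \<gamma> ab by auto
  have limit: "?euler \<longlonglongrightarrow> S b c" if "parallel_along A c ?D a b \<gamma> S" "S a = X" for S
    using euler_product_tendsto[OF ab M, of "\<lambda>t. S t c"] that
    unfolding parallel_along_iff[OF c ab \<gamma>] by blast
  obtain s where s: "s a = X c" "\<And>t. t \<in> {a..b} \<Longrightarrow> (s has_vector_derivative ?M t *v s t) (at t within {a..b})"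
    using linear_ode_solution_exists[OF ab M] by blast
  define S where "S t = tangent_of A c (\<gamma> t) (s t)" for t
  have Sc: "S t c = s t" and St: "S t \<in> tangent_space A (\<gamma> t)" if "t \<in> {a..b}" for t
  proof -
    have "\<gamma> t \<in> fst c" using \<gamma> that by blast
    then show "S t c = s t" "S t \<in> tangent_space A (\<gamma> t)"
      unfolding S_def by (rule base.tangent_of_component[OF c], rule base.tangent_of_in[OF c])
  qed
  have "((\<lambda>t. S t c) has_vector_derivative ?M t *v S t c) (at t within {a..b})" if t: "t \<in> {a..b}" for t
    unfolding Sc[OF t]
    by (rule has_vector_derivative_transform[OF t _ s(2)[OF t]]) (simp add: Sc)
  then have par: "parallel_along A c ?D a b \<gamma> S"
    unfolding parallel_along_iff[OF c ab \<gamma>] using St by blast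
  have Sa: "S a = X"
    unfolding S_def s(1) by (rule base.tangent_of_eqI[OF c \<gamma>ab(1) X refl])
  have "parallel_transport A c ?D a b \<gamma> X = S b"
    unfolding parallel_transport_def
  proof (rule the_equality)
    show "\<exists>S'. parallel_along A c ?D a b \<gamma> S' \<and> S' a = X \<and> S' b = S b" using par Sa by blast
    fix Z assume "\<exists>S'. parallel_along A c ?D a b \<gamma> S' \<and> S' a = X \<and> S' b = Z"
    then obtain S' where S': "parallel_along A c ?D a b \<gamma> S'" "S' a = X" "S' b = Z" by blast
    have "S' b c = S b c" using LIMSEQ_unique[OF limit[OF S'(1,2)] limit[OF par Sa]] .
    moreover have "S' b \<in> tangent_space A (\<gamma> b)"
      using S'(1) ab unfolding parallel_along_iff[OF c ab \<gamma>] by auto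
    ultimately show "Z = S b"
      using base.tangent_eqI[OF _ St c \<gamma>ab(2), of "S' b"] ab S'(3) by auto
  qed
  then show ?thesis using limit[OF par Sa] by simp
qed

end

theorem proposition5p1:
  fixes A :: "('a::{t2_space, second_countable_topology}, real ^ 'n::finite) chart set"
    and F :: "('a, 'n) bundle_point \<Rightarrow> real"
    and nabla :: "('a, 'n) bundle_point \<Rightarrow> ('a, 'n) bundle_tangent
      \<Rightarrow> (('a, 'n) bundle_point \<Rightarrow> ('a, real ^ 'n) tangent) \<Rightarrow> ('a, real ^ 'n) tangent"
    and c :: "('a, real ^ 'n) chart"
    and \<gamma> :: "real \<Rightarrow> 'a"
    and a b :: real
    and X :: "('a, real ^ 'n) tangent"
    and j :: 'n
  assumes "finsler_space A F"
    and "linear_connection A nabla"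
    and "c \<in> A"
    and "a < b"
    and "\<gamma> ` {a..b} \<subseteq> fst c"
    and "smooth_on_interval a b (snd c \<circ> \<gamma>)"
    and "X \<in> tangent_space A (\<gamma> a)"
  defines "\<Gamma> \<equiv> connection_coeff A c (average_connection A F nabla c)"
    and "eps \<equiv> (\<lambda>m::nat. (b - a) / real m)"
    and "\<tau> \<equiv> (\<lambda>(m::nat) (k::nat). a + real k * ((b - a) / real m))"
  shows "(\<lambda>m. (ordered_product
             (\<lambda>k. \<chi> r i. (if r = i then 1 else 0)
                - eps m * (\<Sum>l\<in>UNIV. \<Gamma> r i l (\<gamma> (\<tau> m k)) * velocity A c a b \<gamma> (\<tau> m k) c $ l))
             m *v X c) $ j)
         \<longlonglongrightarrow> parallel_transport A c (average_connection A F nabla c) a b \<gamma> X c $ j"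
proof -
  interpret finsler_connection A F nabla using assms(1,2) by unfold_locales
  have "(\<chi> r i. (if r = i then 1 else 0)
        - eps m * (\<Sum>l\<in>UNIV. \<Gamma> r i l (\<gamma> (\<tau> m k)) * velocity A c a b \<gamma> (\<tau> m k) c $ l)) =
      mat 1 + ((b - a) / real m) *\<^sub>R transport_matrix c a b \<gamma> (a + real k * ((b - a) / real m))" for m k
    by (simp add: vec_eq_iff mat_def transport_matrix_def \<Gamma>_def eps_def \<tau>_def)
  then show ?thesis
    using tendsto_vec_nth[OF parallel_transport_component[OF assms(3-7)], of j] by simp
qed

end
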